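(* Let $\mathsf{A}$ be an abelian category and $\mathsf{W}$ a special precovering subcategory of $\mathsf{A}$. Suppose that $\mathsf{W}$ is closed under direct summands. Let $M$ be an object in $\mathsf{A}$ that has a Tate $\mathsf{W}$-resolution $H\to P\xrightarrow{\simeq}M$. Then for each object $N$ in $\mathsf{A}$ and all $n\in\mathbb{Z}$ there is a natural isomorphism $$\widehat{\operatorname{Ext}}{}^{n}_{\mathsf{W}}(M,N)\cong\mathrm{H}^n(\operatorname{Hom}_{\mathsf{A}}(H,N)).$$
   Context: "Subcategory" means a full additive subcategory closed under isomorphisms; Ext is Yoneda Ext. $\mathsf{W}^{\perp}=\{N\mid\operatorname{Ext}^1_{\mathsf{A}}(W,N)=0\ \forall W\in\mathsf{W}\}$. A special $\mathsf{W}$-precover of $M$ is an exact sequence $0\to K\to W\to M\to0$ with $W\in\mathsf{W}$, $K\in\mathsf{W}^{\perp}$; $\mathsf{W}$ is special precovering if every object has one. A proper $\mathsf{W}$-resolution $P\xrightarrow{\simeq}M$ is a complex $P=(\cdots\to P_1\to P_0\to0)$ of objects in $\mathsf{W}$ with an exact sequence $\cdots\to P_1\to P_0\to M\to0$ staying exact under $\operatorname{Hom}_{\mathsf{A}}(W,-)$ for all $W\in\mathsf{W}$. It is special if $\operatorname{Coker}(P_{i+1}\to P_i)\in\mathsf{W}^{\perp}$ for $i\ge1$; special ones exist for all objects. $\mathsf{\Omega}_i^{\mathsf{W}}M$ is $\operatorname{Coker}(P_{i+1}\to P_i)$ for a chosen special proper $\mathsf{W}$-resolution $P$ of $M$; $\mathsf{\Omega}_0^{\mathsf{W}}M=M$,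 $\mathsf{\Omega}^{\mathsf{W}}=\mathsf{\Omega}_1^{\mathsf{W}}$. A complex $H$ of objects in $\mathsf{W}$ is totally $\mathsf{W}$-acyclic if $H$, $\operatorname{Hom}_{\mathsf{A}}(D,H)$ and $\operatorname{Hom}_{\mathsf{A}}(H,D)$ are acyclic for each $D\in\mathsf{W}$. A Tate $\mathsf{W}$-resolution of $M$ is a diagram $H\xrightarrow{\gamma}P\xrightarrow{\simeq}M$ with $H$ totally $\mathsf{W}$-acyclic, $P\xrightarrow{\simeq}M$ a proper $\mathsf{W}$-resolution, and $\gamma_n$ an isomorphism for homological degrees $n\gg0$. $\operatorname{Hom}_{\mathsf{A}}(H,N)$ has $\operatorname{Hom}_{\mathsf{A}}(H_n,N)$ in cohomological degree $n$. Complete cohomology. $\underline{\operatorname{Hom}}{}^{\mathsf{W}}_{\mathsf{A}}(M,N)$ is $\operatorname{Hom}_{\mathsf{A}}(M,N)$ modulo the subgroup of morphisms factoring through an object of $\mathsf{W}$. Take special $\mathsf{W}$-precovers $0\to\mathsf{\Omega}^{\mathsf{W}}M\to P_0\to M\to0$ and $0\to\mathsf{\Omega}^{\mathsf{W}}N\to Q_0\to N\to0$. The connecting morphism $\operatorname{Hom}_{\mathsf{A}}(M,N)\to\operatorname{Ext}^1_{\mathsf{A}}(M,\mathsf{\Omega}^{\mathsf{W}}N)$ induces a monomorphism $\overline{\delta}\colon\underline{\operatorname{Hom}}{}^{\mathsf{W}}_{\mathsf{A}}(M,N)\to\operatorname{Ext}^1_{\mathsf{A}}(M,\mathsf{\Omega}^{\mathsf{W}}N)$;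 the connecting morphism $\partial\colon\operatorname{Hom}_{\mathsf{A}}(\mathsf{\Omega}^{\mathsf{W}}M,\mathsf{\Omega}^{\mathsf{W}}N)\to\operatorname{Ext}^1_{\mathsf{A}}(M,\mathsf{\Omega}^{\mathsf{W}}N)$ is epi, and there is a unique $\beta\colon\operatorname{Ext}^1_{\mathsf{A}}(M,\mathsf{\Omega}^{\mathsf{W}}N)\to\underline{\operatorname{Hom}}{}^{\mathsf{W}}_{\mathsf{A}}(\mathsf{\Omega}^{\mathsf{W}}M,\mathsf{\Omega}^{\mathsf{W}}N)$ with $\beta\partial$ the canonical projection. Put $\Lambda=\beta\overline{\delta}$. Iterating yields, for $n\in\mathbb{Z}$, a direct system over the integers $i\ge\max\{0,-n\}$ and $\widehat{\operatorname{Ext}}{}^{n}_{\mathsf{W}}(M,N)=\operatorname{colim}_i\underline{\operatorname{Hom}}{}^{\mathsf{W}}_{\mathsf{A}}(\mathsf{\Omega}^{\mathsf{W}}_{i+n}M,\mathsf{\Omega}^{\mathsf{W}}_iN)$. *)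

theory Defs
  imports "HOL-Algebra.Coset"
begin

section \<open>Abelian categories\<close>

text \<open>
  Every arrow carries its source and target, so Hom-sets of different pairs of objects are
  disjoint. The additive structure is part of the data: madd f g is only relevant for parallel
  arrows, and mzero X Y is the zero arrow from X to Y.
\<close>

record ('o, 'm) cat =
  objs :: "'o set"
  arrs :: "'m set"
  src :: "'m \<Rightarrow> 'o"
  tgt :: "'m \<Rightarrow> 'o"
  idm :: "'o \<Rightarrow> 'm"
  cmp :: "'m \<Rightarrow> 'm \<Rightarrow> 'm"  (infixl "\<cdot>\<index>" 70)
  madd :: "'m \<Rightarrow> 'm \<Rightarrow> 'm"
  mzero :: "'o \<Rightarrow> 'o \<Rightarrow> 'm"

definition Hom :: "('o, 'm, 'z) cat_scheme \<Rightarrow> 'o \<Rightarrow> 'o \<Rightarrow> 'm set" where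
  "Hom A X Y = {f \<in> arrs A. src A f = X \<and> tgt A f = Y}"

definition Hom_group :: "('o, 'm, 'z) cat_scheme \<Rightarrow> 'o \<Rightarrow> 'o \<Rightarrow> 'm monoid" where
  "Hom_group A X Y = \<lparr>carrier = Hom A X Y, mult = madd A, one = mzero A X Y\<rparr>"

locale category =
  fixes A :: "('o, 'm, 'z) cat_scheme" (structure)
  assumes src_in: "f \<in> arrs A \<Longrightarrow> src A f \<in> objs A"
    and tgt_in: "f \<in> arrs A \<Longrightarrow> tgt A f \<in> objs A"
    and idm_in: "X \<in> objs A \<Longrightarrow> idm A X \<in> Hom A X X"
    and cmp_in: "\<lbrakk>g \<in> Hom A Y Z; f \<in> Hom A X Y\<rbrakk> \<Longrightarrow> g \<cdot> f \<in> Hom A X Z"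
    and cmp_idm_left: "f \<in> Hom A X Y \<Longrightarrow> idm A Y \<cdot> f = f"
    and cmp_idm_right: "f \<in> Hom A X Y \<Longrightarrow> f \<cdot> idm A X = f"
    and cmp_assoc: "\<lbrakk>h \<in> Hom A Y Z; g \<in> Hom A X Y; f \<in> Hom A V X\<rbrakk>
          \<Longrightarrow> (h \<cdot> g) \<cdot> f = h \<cdot> (g \<cdot> f)"

locale preadditive_category = category +
  assumes Hom_comm_group: "\<lbrakk>X \<in> objs A; Y \<in> objs A\<rbrakk> \<Longrightarrow> comm_group (Hom_group A X Y)"
    and cmp_madd_right: "\<lbrakk>g \<in> Hom A Y Z; f \<in> Hom A X Y; f' \<in> Hom A X Y\<rbrakk>
          \<Longrightarrow> g \<cdot> madd A f f' = madd A (g \<cdot> f) (g \<cdot> f')"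
    and cmp_madd_left: "\<lbrakk>g \<in> Hom A Y Z; g' \<in> Hom A Y Z; f \<in> Hom A X Y\<rbrakk>
          \<Longrightarrow> madd A g g' \<cdot> f = madd A (g \<cdot> f) (g' \<cdot> f)"

definition is_iso :: "('o, 'm, 'z) cat_scheme \<Rightarrow> 'm \<Rightarrow> bool" where
  "is_iso A f \<longleftrightarrow> f \<in> arrs A \<and>
     (\<exists>g \<in> Hom A (tgt A f) (src A f).
        g \<cdot>\<^bsub>A\<^esub> f = idm A (src A f) \<and> f \<cdot>\<^bsub>A\<^esub> g = idm A (tgt A f))"

definition is_mono :: "('o, 'm, 'z) cat_scheme \<Rightarrow> 'm \<Rightarrow> bool" where
  "is_mono A f \<longleftrightarrow> f \<in> arrs A \<and>
     (\<forall>Z \<in> objs A. \<forall>u \<in> Hom A Z (src A f). \<forall>v \<in> Hom A Z (src A f).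
        f \<cdot>\<^bsub>A\<^esub> u = f \<cdot>\<^bsub>A\<^esub> v \<longrightarrow> u = v)"

definition is_epi :: "('o, 'm, 'z) cat_scheme \<Rightarrow> 'm \<Rightarrow> bool" where
  "is_epi A f \<longleftrightarrow> f \<in> arrs A \<and>
     (\<forall>Z \<in> objs A. \<forall>u \<in> Hom A (tgt A f) Z. \<forall>v \<in> Hom A (tgt A f) Z.
        u \<cdot>\<^bsub>A\<^esub> f = v \<cdot>\<^bsub>A\<^esub> f \<longrightarrow> u = v)"

definition is_zero_obj :: "('o, 'm, 'z) cat_scheme \<Rightarrow> 'o \<Rightarrow> bool" where
  "is_zero_obj A Z \<longleftrightarrow> Z \<in> objs A \<and>
     (\<forall>X \<in> objs A. (\<exists>!f. f \<in> Hom A X Z) \<and> (\<exists>!f. f \<in> Hom A Z X))"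

definition is_biproduct ::
    "('o, 'm, 'z) cat_scheme \<Rightarrow> 'o \<Rightarrow> 'o \<Rightarrow> 'o \<Rightarrow> 'm \<Rightarrow> 'm \<Rightarrow> 'm \<Rightarrow> 'm \<Rightarrow> bool" where
  "is_biproduct A X Y S i j p q \<longleftrightarrow>
     X \<in> objs A \<and> Y \<in> objs A \<and> S \<in> objs A \<and>
     i \<in> Hom A X S \<and> j \<in> Hom A Y S \<and> p \<in> Hom A S X \<and> q \<in> Hom A S Y \<and>
     p \<cdot>\<^bsub>A\<^esub> i = idm A X \<and> q \<cdot>\<^bsub>A\<^esub> j = idm A Y \<and>
     q \<cdot>\<^bsub>A\<^esub> i = mzero A X Y \<and> p \<cdot>\<^bsub>A\<^esub> j = mzero A Y X \<and>
     madd A (i \<cdot>\<^bsub>A\<^esub> p) (j \<cdot>\<^bsub>A\<^esub> q) = idm A S"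

definition is_ker :: "('o, 'm, 'z) cat_scheme \<Rightarrow> 'm \<Rightarrow> 'm \<Rightarrow> bool" where
  "is_ker A k g \<longleftrightarrow> k \<in> arrs A \<and> g \<in> arrs A \<and> tgt A k = src A g \<and>
     g \<cdot>\<^bsub>A\<^esub> k = mzero A (src A k) (tgt A g) \<and>
     (\<forall>Z \<in> objs A. \<forall>t \<in> Hom A Z (src A g). g \<cdot>\<^bsub>A\<^esub> t = mzero A Z (tgt A g) \<longrightarrow>
        (\<exists>!u. u \<in> Hom A Z (src A k) \<and> k \<cdot>\<^bsub>A\<^esub> u = t))"

definition is_coker :: "('o, 'm, 'z) cat_scheme \<Rightarrow> 'm \<Rightarrow> 'm \<Rightarrow> bool" where
  "is_coker A c f \<longleftrightarrow> c \<in> arrs A \<and> f \<in> arrs A \<and> src A c = tgt A f \<and>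
     c \<cdot>\<^bsub>A\<^esub> f = mzero A (src A f) (tgt A c) \<and>
     (\<forall>Z \<in> objs A. \<forall>t \<in> Hom A (tgt A f) Z. t \<cdot>\<^bsub>A\<^esub> f = mzero A (src A f) Z \<longrightarrow>
        (\<exists>!u. u \<in> Hom A (tgt A c) Z \<and> u \<cdot>\<^bsub>A\<^esub> c = t))"

locale abelian_category = preadditive_category +
  assumes ex_zero_obj: "\<exists>Z. is_zero_obj A Z"
    and ex_biproduct: "\<lbrakk>X \<in> objs A; Y \<in> objs A\<rbrakk> \<Longrightarrow> \<exists>S i j p q. is_biproduct A X Y S i j p q"
    and ex_ker: "f \<in> arrs A \<Longrightarrow> \<exists>k. is_ker A k f"
    and ex_coker: "f \<in> arrs A \<Longrightarrow> \<exists>c. is_coker A c f"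
    and mono_is_ker: "is_mono A f \<Longrightarrow> \<exists>g. is_ker A f g"
    and epi_is_coker: "is_epi A f \<Longrightarrow> \<exists>g. is_coker A f g"

text \<open>
  Exactness of X -f-> Y -g-> Z at Y: the image of f, that is, the kernel k of a cokernel c of f,
  is a kernel of g.
\<close>

definition exact_at :: "('o, 'm, 'z) cat_scheme \<Rightarrow> 'm \<Rightarrow> 'm \<Rightarrow> bool" where
  "exact_at A f g \<longleftrightarrow> (\<exists>c k. is_coker A c f \<and> is_ker A k c \<and> is_ker A k g)"

text \<open>
  A short exact sequence 0 -> K -k-> E -p-> X -> 0 is encoded by the pair (k, p); the three
  objects are the sources and targets of k and p.
\<close>

definition short_exact :: "('o, 'm, 'z) cat_scheme \<Rightarrow> 'm \<Rightarrow> 'm \<Rightarrow> bool" where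
  "short_exact A k p \<longleftrightarrow> is_ker A k p \<and> is_coker A p k"


section \<open>Subcategories\<close>

text \<open>A full subcategory is given by its set of objects.\<close>

definition additive_subcategory :: "('o, 'm, 'z) cat_scheme \<Rightarrow> 'o set \<Rightarrow> bool" where
  "additive_subcategory A W \<longleftrightarrow> W \<subseteq> objs A \<and>
     (\<forall>Z. is_zero_obj A Z \<longrightarrow> Z \<in> W) \<and>
     (\<forall>X Y S i j p q. X \<in> W \<and> Y \<in> W \<and> is_biproduct A X Y S i j p q \<longrightarrow> S \<in> W) \<and>
     (\<forall>f. is_iso A f \<and> src A f \<in> W \<longrightarrow> tgt A f \<in> W)"

definition closed_under_summands :: "('o, 'm, 'z) cat_scheme \<Rightarrow> 'o set \<Rightarrow> bool" where
  "closed_under_summands A W \<longleftrightarrow>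
     (\<forall>X Y S i j p q. is_biproduct A X Y S i j p q \<and> S \<in> W \<longrightarrow> X \<in> W)"


section \<open>Yoneda Ext in degree one\<close>

text \<open>
  Extensions of X by Y are short exact sequences 0 -> Y -> E -> X -> 0; Ext1 A X Y is the set of
  their equivalence classes, with the class of split extensions as zero element. The Baer sum
  is not used below: the vanishing of Ext1 and the connecting maps only involve classes.
\<close>

definition extensions :: "('o, 'm, 'z) cat_scheme \<Rightarrow> 'o \<Rightarrow> 'o \<Rightarrow> ('m \<times> 'm) set" where
  "extensions A X Y = {(i, p). short_exact A i p \<and> src A i = Y \<and> tgt A p = X}"

definition ext_equiv :: "('o, 'm, 'z) cat_scheme \<Rightarrow> 'o \<Rightarrow> 'o \<Rightarrow> (('m \<times> 'm) \<times> ('m \<times> 'm)) set" where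
  "ext_equiv A X Y = {((i, p), (i', p')).
     (i, p) \<in> extensions A X Y \<and> (i', p') \<in> extensions A X Y \<and>
     (\<exists>h \<in> Hom A (src A p) (src A p'). is_iso A h \<and> h \<cdot>\<^bsub>A\<^esub> i = i' \<and> p' \<cdot>\<^bsub>A\<^esub> h = p)}"

definition Ext1 :: "('o, 'm, 'z) cat_scheme \<Rightarrow> 'o \<Rightarrow> 'o \<Rightarrow> ('m \<times> 'm) set set" where
  "Ext1 A X Y = extensions A X Y // ext_equiv A X Y"

definition split_class :: "('o, 'm, 'z) cat_scheme \<Rightarrow> 'o \<Rightarrow> 'o \<Rightarrow> ('m \<times> 'm) set" where
  "split_class A X Y =
     {(i, p) \<in> extensions A X Y. \<exists>s \<in> Hom A X (src A p). p \<cdot>\<^bsub>A\<^esub> s = idm A X}"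

definition right_perp :: "('o, 'm, 'z) cat_scheme \<Rightarrow> 'o set \<Rightarrow> 'o set" where
  "right_perp A W = {N \<in> objs A. \<forall>V \<in> W. Ext1 A V N = {split_class A V N}}"

text \<open>
  The connecting maps, following Mac Lane: for an extension E = (k, p) of N by K and g : M -> N,
  the class ext_pull A E g in Ext1 A M K consists of all E' admitting a morphism E' -> E of
  extensions of the form (id, h, g); for an extension E = (k, p) of M by K and f : K -> Y, the
  class ext_push A E f in Ext1 A M Y consists of all E' admitting a morphism E -> E' of
  the form (f, h, id). By the universal properties of pullback and pushout each of these sets is
  a single equivalence class.
\<close>

definition ext_pull :: "('o, 'm, 'z) cat_scheme \<Rightarrow> 'm \<times> 'm \<Rightarrow> 'm \<Rightarrow> ('m \<times> 'm) set" where
  "ext_pull A E g = (case E of (k, p) \<Rightarrow>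
     {(i', p') \<in> extensions A (src A g) (src A k).
        \<exists>h \<in> Hom A (src A p') (src A p). h \<cdot>\<^bsub>A\<^esub> i' = k \<and> p \<cdot>\<^bsub>A\<^esub> h = g \<cdot>\<^bsub>A\<^esub> p'})"

definition ext_push :: "('o, 'm, 'z) cat_scheme \<Rightarrow> 'm \<times> 'm \<Rightarrow> 'm \<Rightarrow> ('m \<times> 'm) set" where
  "ext_push A E f = (case E of (k, p) \<Rightarrow>
     {(i', p') \<in> extensions A (tgt A p) (tgt A f).
        \<exists>h \<in> Hom A (src A p) (src A p'). h \<cdot>\<^bsub>A\<^esub> k = i' \<cdot>\<^bsub>A\<^esub> f \<and> p' \<cdot>\<^bsub>A\<^esub> h = p})"


section \<open>Special precovers, complexes and resolutions\<close>

definition special_precover ::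
    "('o, 'm, 'z) cat_scheme \<Rightarrow> 'o set \<Rightarrow> 'o \<Rightarrow> 'm \<times> 'm \<Rightarrow> bool" where
  "special_precover A W M E \<longleftrightarrow> (case E of (k, p) \<Rightarrow>
     short_exact A k p \<and> tgt A p = M \<and> src A p \<in> W \<and> src A k \<in> right_perp A W)"

definition special_precovering :: "('o, 'm, 'z) cat_scheme \<Rightarrow> 'o set \<Rightarrow> bool" where
  "special_precovering A W \<longleftrightarrow> (\<forall>M \<in> objs A. \<exists>E. special_precover A W M E)"

text \<open>
  Complexes are indexed homologically by the integers, with dif X n : cob X n -> cob X (n - 1).
\<close>

record ('o, 'm) cplx =
  cob :: "int \<Rightarrow> 'o"
  dif :: "int \<Rightarrow> 'm"

definition is_complex ::
    "('o, 'm, 'z) cat_scheme \<Rightarrow> ('o, 'm, 'y) cplx_scheme \<Rightarrow> bool" where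
  "is_complex A X \<longleftrightarrow> (\<forall>n. cob X n \<in> objs A \<and> dif X n \<in> Hom A (cob X n) (cob X (n - 1)) \<and>
     dif X n \<cdot>\<^bsub>A\<^esub> dif X (n + 1) = mzero A (cob X (n + 1)) (cob X (n - 1)))"

definition chain_map ::
    "('o, 'm, 'z) cat_scheme \<Rightarrow> ('o, 'm, 'x) cplx_scheme \<Rightarrow> ('o, 'm, 'y) cplx_scheme
      \<Rightarrow> (int \<Rightarrow> 'm) \<Rightarrow> bool" where
  "chain_map A X Y u \<longleftrightarrow> (\<forall>n. u n \<in> Hom A (cob X n) (cob Y n) \<and>
     dif Y n \<cdot>\<^bsub>A\<^esub> u n = u (n - 1) \<cdot>\<^bsub>A\<^esub> dif X n)"

text \<open>Exactness of Hom(D, f), Hom(D, g) and of Hom(g, D), Hom(f, D) at the middle term,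
  for f : X -> Y and g : Y -> Z.\<close>

definition Hom_from_exact_at ::
    "('o, 'm, 'z) cat_scheme \<Rightarrow> 'o \<Rightarrow> 'm \<Rightarrow> 'm \<Rightarrow> bool" where
  "Hom_from_exact_at A D f g \<longleftrightarrow>
     (\<lambda>h. f \<cdot>\<^bsub>A\<^esub> h) ` Hom A D (src A f) =
     kernel (Hom_group A D (src A g)) (Hom_group A D (tgt A g)) (\<lambda>h. g \<cdot>\<^bsub>A\<^esub> h)"

definition Hom_to_exact_at ::
    "('o, 'm, 'z) cat_scheme \<Rightarrow> 'o \<Rightarrow> 'm \<Rightarrow> 'm \<Rightarrow> bool" where
  "Hom_to_exact_at A D f g \<longleftrightarrow>
     (\<lambda>h. h \<cdot>\<^bsub>A\<^esub> g) ` Hom A (tgt A g) D =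
     kernel (Hom_group A (tgt A f) D) (Hom_group A (src A f) D) (\<lambda>h. h \<cdot>\<^bsub>A\<^esub> f)"

text \<open>
  A proper W-resolution P -> M with augmentation e : P_0 -> M. The last conjunct is exactness
  of Hom(D, P_0) -> Hom(D, M) -> 0.
\<close>

definition proper_resolution ::
    "('o, 'm, 'z) cat_scheme \<Rightarrow> 'o set \<Rightarrow> ('o, 'm, 'y) cplx_scheme \<Rightarrow> 'm \<Rightarrow> 'o \<Rightarrow> bool" where
  "proper_resolution A W P e M \<longleftrightarrow>
     is_complex A P \<and> (\<forall>n. cob P n \<in> W) \<and> (\<forall>n<0. is_zero_obj A (cob P n)) \<and>
     e \<in> Hom A (cob P 0) M \<and>
     (\<forall>n\<ge>1. exact_at A (dif P (n + 1)) (dif P n)) \<and> exact_at A (dif P 1) e \<and> is_epi A e \<and>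
     (\<forall>D \<in> W. (\<forall>n\<ge>1. Hom_from_exact_at A D (dif P (n + 1)) (dif P n)) \<and>
        Hom_from_exact_at A D (dif P 1) e \<and>
        (\<lambda>h. e \<cdot>\<^bsub>A\<^esub> h) ` Hom A D (cob P 0) = Hom A D M)"

definition special_proper_resolution ::
    "('o, 'm, 'z) cat_scheme \<Rightarrow> 'o set \<Rightarrow> ('o, 'm, 'y) cplx_scheme \<Rightarrow> 'm \<Rightarrow> 'o \<Rightarrow> bool" where
  "special_proper_resolution A W P e M \<longleftrightarrow> proper_resolution A W P e M \<and>
     (\<forall>n\<ge>1. \<forall>c. is_coker A c (dif P (n + 1)) \<longrightarrow> tgt A c \<in> right_perp A W)"

definition totally_acyclic ::
    "('o, 'm, 'z) cat_scheme \<Rightarrow> 'o set \<Rightarrow> ('o, 'm, 'y) cplx_scheme \<Rightarrow> bool" where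
  "totally_acyclic A W H \<longleftrightarrow> is_complex A H \<and> (\<forall>n. cob H n \<in> W) \<and>
     (\<forall>n. exact_at A (dif H (n + 1)) (dif H n)) \<and>
     (\<forall>D \<in> W. \<forall>n. Hom_from_exact_at A D (dif H (n + 1)) (dif H n) \<and>
        Hom_to_exact_at A D (dif H (n + 1)) (dif H n))"

text \<open>The data of a diagram H -> P -> M.\<close>

record ('o, 'm) tate =
  tate_obj :: 'o
  tate_res :: "('o, 'm) cplx"
  tate_aug :: 'm
  tate_tac :: "('o, 'm) cplx"
  tate_map :: "int \<Rightarrow> 'm"

definition tate_resolution ::
    "('o, 'm, 'z) cat_scheme \<Rightarrow> 'o set \<Rightarrow> ('o, 'm) tate \<Rightarrow> bool" where
  "tate_resolution A W T \<longleftrightarrow>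
     tate_obj T \<in> objs A \<and>
     totally_acyclic A W (tate_tac T) \<and>
     proper_resolution A W (tate_res T) (tate_aug T) (tate_obj T) \<and>
     chain_map A (tate_tac T) (tate_res T) (tate_map T) \<and>
     (\<exists>m. \<forall>n\<ge>m. is_iso A (tate_map T n))"

text \<open>
  A morphism of Tate resolutions over f: a lift u of f to the proper resolutions and a chain map
  v of the totally acyclic complexes that is compatible with u in all large degrees, the only
  ones that matter in the definition of a Tate resolution. Every f admits such a pair.
\<close>

definition tate_morphism ::
    "('o, 'm, 'z) cat_scheme \<Rightarrow> ('o, 'm) tate \<Rightarrow> ('o, 'm) tate
      \<Rightarrow> 'm \<Rightarrow> (int \<Rightarrow> 'm) \<Rightarrow> (int \<Rightarrow> 'm) \<Rightarrow> bool" where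
  "tate_morphism A T T' f u v \<longleftrightarrow>
     f \<in> Hom A (tate_obj T) (tate_obj T') \<and>
     chain_map A (tate_res T) (tate_res T') u \<and>
     chain_map A (tate_tac T) (tate_tac T') v \<and>
     tate_aug T' \<cdot>\<^bsub>A\<^esub> u 0 = f \<cdot>\<^bsub>A\<^esub> tate_aug T \<and>
     (\<exists>m. \<forall>n\<ge>m. tate_map T' n \<cdot>\<^bsub>A\<^esub> v n = u n \<cdot>\<^bsub>A\<^esub> tate_map T n)"


section \<open>Syzygies\<close>

text \<open>
  A special proper resolution together with chosen cokernels cok P i : P_i -> Omega_i of its
  differentials; cok P 0 is the augmentation, so that Omega_0 is the resolved object itself.
\<close>

record ('o, 'm) syzygy_resolution = "('o, 'm) cplx" +
  cok :: "nat \<Rightarrow> 'm"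

definition syzygy_choice ::
    "('o, 'm, 'z) cat_scheme \<Rightarrow> 'o set \<Rightarrow> ('o \<Rightarrow> ('o, 'm) syzygy_resolution) \<Rightarrow> bool" where
  "syzygy_choice A W R \<longleftrightarrow> (\<forall>M \<in> objs A.
     special_proper_resolution A W (R M) (cok (R M) 0) M \<and>
     (\<forall>i. is_coker A (cok (R M) i) (dif (R M) (int i + 1))))"

definition syz :: "('o, 'm, 'z) cat_scheme \<Rightarrow> ('o, 'm) syzygy_resolution \<Rightarrow> nat \<Rightarrow> 'o" where
  "syz A P i = tgt A (cok P i)"

text \<open>The special precover 0 -> Omega_(i+1) -> P_i -> Omega_i -> 0; its first map is induced by
  the differential P_(i+1) -> P_i.\<close>

definition syz_seq ::
    "('o, 'm, 'z) cat_scheme \<Rightarrow> ('o, 'm) syzygy_resolution \<Rightarrow> nat \<Rightarrow> 'm \<times> 'm" where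
  "syz_seq A P i =
     (THE j. j \<in> Hom A (syz A P (Suc i)) (cob P (int i)) \<and>
        j \<cdot>\<^bsub>A\<^esub> cok P (Suc i) = dif P (int i + 1),
      cok P i)"


section \<open>Stable Hom groups and the maps between them\<close>

definition factoring ::
    "('o, 'm, 'z) cat_scheme \<Rightarrow> 'o set \<Rightarrow> 'o \<Rightarrow> 'o \<Rightarrow> 'm set" where
  "factoring A W X Y =
     {f. \<exists>V \<in> W. \<exists>a \<in> Hom A X V. \<exists>b \<in> Hom A V Y. f = b \<cdot>\<^bsub>A\<^esub> a}"

definition stable_Hom ::
    "('o, 'm, 'z) cat_scheme \<Rightarrow> 'o set \<Rightarrow> 'o \<Rightarrow> 'o \<Rightarrow> 'm set monoid" where
  "stable_Hom A W X Y = Hom_group A X Y Mod factoring A W X Y"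

definition stable_class :: "('o, 'm, 'z) cat_scheme \<Rightarrow> 'o set \<Rightarrow> 'm \<Rightarrow> 'm set" where
  "stable_class A W f =
     factoring A W (src A f) (tgt A f) #>\<^bsub>Hom_group A (src A f) (tgt A f)\<^esub> f"

text \<open>The map induced on a quotient by a map that is constant on classes.\<close>

definition induced :: "('a \<Rightarrow> 'b) \<Rightarrow> 'a set \<Rightarrow> 'b" where
  "induced f c = the_elem (f ` c)"

definition stable_comp ::
    "('o, 'm, 'z) cat_scheme \<Rightarrow> 'o set \<Rightarrow> 'm set \<Rightarrow> 'm set \<Rightarrow> 'm set" where
  "stable_comp A W c d = induced (\<lambda>(g, f). stable_class A W (g \<cdot>\<^bsub>A\<^esub> f)) (c \<times> d)"

text \<open>
  For special precovers E = (k, p) of M and E' = (k', p') of N: delta_bar is the map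
  stable_Hom M N -> Ext1 M (src k'), and beta the unique map
  Ext1 M (src k') -> stable_Hom (src k) (src k') whose composite with the connecting map
  Hom (src k) (src k') -> Ext1 M (src k') is the canonical projection.
\<close>

definition delta_bar ::
    "('o, 'm, 'z) cat_scheme \<Rightarrow> 'm \<times> 'm \<Rightarrow> 'm set \<Rightarrow> ('m \<times> 'm) set" where
  "delta_bar A E' = induced (ext_pull A E')"

definition beta ::
    "('o, 'm, 'z) cat_scheme \<Rightarrow> 'o set \<Rightarrow> 'm \<times> 'm \<Rightarrow> 'm \<times> 'm \<Rightarrow> ('m \<times> 'm) set \<Rightarrow> 'm set" where
  "beta A W E E' =
     (THE b. b \<in> Ext1 A (tgt A (snd E)) (src A (fst E')) \<rightarrow>\<^sub>E
                carrier (stable_Hom A W (src A (fst E)) (src A (fst E'))) \<and>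
             (\<forall>f \<in> Hom A (src A (fst E)) (src A (fst E')).
                b (ext_push A E f) = stable_class A W f))"

definition Lam ::
    "('o, 'm, 'z) cat_scheme \<Rightarrow> 'o set \<Rightarrow> 'm \<times> 'm \<Rightarrow> 'm \<times> 'm \<Rightarrow> 'm set \<Rightarrow> 'm set" where
  "Lam A W E E' c = beta A W E E' (delta_bar A E' c)"

text \<open>Iterating from degree zero gives the action of Omega_i on stable morphisms M -> N.\<close>

primrec Lam_iter ::
    "('o, 'm, 'z) cat_scheme \<Rightarrow> 'o set \<Rightarrow> ('o \<Rightarrow> ('o, 'm) syzygy_resolution)
      \<Rightarrow> 'o \<Rightarrow> 'o \<Rightarrow> nat \<Rightarrow> 'm set \<Rightarrow> 'm set" where
  "Lam_iter A W R M N 0 c = c"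
| "Lam_iter A W R M N (Suc i) c =
     Lam A W (syz_seq A (R M) i) (syz_seq A (R N) i) (Lam_iter A W R M N i c)"


section \<open>Sequential colimits of abelian groups\<close>

text \<open>
  The colimit of groups G i, indexed by the natural numbers i with s \<le> i, along
  t i : G i -> G (i + 1). The map G i -> G (i + m) is seq_map t i m.
\<close>

primrec seq_map :: "(nat \<Rightarrow> 'a \<Rightarrow> 'a) \<Rightarrow> nat \<Rightarrow> nat \<Rightarrow> 'a \<Rightarrow> 'a" where
  "seq_map t i 0 x = x"
| "seq_map t i (Suc m) x = t (i + m) (seq_map t i m x)"

definition colim_rel ::
    "nat \<Rightarrow> (nat \<Rightarrow> 'a monoid) \<Rightarrow> (nat \<Rightarrow> 'a \<Rightarrow> 'a) \<Rightarrow> ((nat \<times> 'a) \<times> (nat \<times> 'a)) set" where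
  "colim_rel s G t = {((i, x), (j, y)).
     s \<le> i \<and> s \<le> j \<and> x \<in> carrier (G i) \<and> y \<in> carrier (G j) \<and>
     (\<exists>k. i \<le> k \<and> j \<le> k \<and> seq_map t i (k - i) x = seq_map t j (k - j) y)}"

definition colim_class ::
    "nat \<Rightarrow> (nat \<Rightarrow> 'a monoid) \<Rightarrow> (nat \<Rightarrow> 'a \<Rightarrow> 'a) \<Rightarrow> nat \<Rightarrow> 'a \<Rightarrow> (nat \<times> 'a) set" where
  "colim_class s G t i x = colim_rel s G t `` {(i, x)}"

text \<open>Two classes are multiplied by multiplying representatives of equal index.\<close>

definition seq_colim ::
    "nat \<Rightarrow> (nat \<Rightarrow> 'a monoid) \<Rightarrow> (nat \<Rightarrow> 'a \<Rightarrow> 'a) \<Rightarrow> (nat \<times> 'a) set monoid" where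
  "seq_colim s G t =
     \<lparr>carrier = {colim_class s G t i x |i x. s \<le> i \<and> x \<in> carrier (G i)},
      mult = (\<lambda>c d. \<Union>{colim_class s G t k (x \<otimes>\<^bsub>G k\<^esub> y) |k x y. (k, x) \<in> c \<and> (k, y) \<in> d}),
      one = colim_class s G t s \<one>\<^bsub>G s\<^esub>\<rparr>"


section \<open>Complete cohomology\<close>

definition cExt_start :: "int \<Rightarrow> nat" where
  "cExt_start n = nat (max 0 (- n))"

definition cExt_group ::
    "('o, 'm, 'z) cat_scheme \<Rightarrow> 'o set \<Rightarrow> ('o \<Rightarrow> ('o, 'm) syzygy_resolution)
      \<Rightarrow> int \<Rightarrow> 'o \<Rightarrow> 'o \<Rightarrow> nat \<Rightarrow> 'm set monoid" where
  "cExt_group A W R n M N i =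
     stable_Hom A W (syz A (R M) (nat (int i + n))) (syz A (R N) i)"

definition cExt_trans ::
    "('o, 'm, 'z) cat_scheme \<Rightarrow> 'o set \<Rightarrow> ('o \<Rightarrow> ('o, 'm) syzygy_resolution)
      \<Rightarrow> int \<Rightarrow> 'o \<Rightarrow> 'o \<Rightarrow> nat \<Rightarrow> 'm set \<Rightarrow> 'm set" where
  "cExt_trans A W R n M N i =
     Lam A W (syz_seq A (R M) (nat (int i + n))) (syz_seq A (R N) i)"

definition cExt ::
    "('o, 'm, 'z) cat_scheme \<Rightarrow> 'o set \<Rightarrow> ('o \<Rightarrow> ('o, 'm) syzygy_resolution)
      \<Rightarrow> int \<Rightarrow> 'o \<Rightarrow> 'o \<Rightarrow> (nat \<times> 'm set) set monoid" where
  "cExt A W R n M N =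
     seq_colim (cExt_start n) (cExt_group A W R n M N) (cExt_trans A W R n M N)"

definition cExt_class ::
    "('o, 'm, 'z) cat_scheme \<Rightarrow> 'o set \<Rightarrow> ('o \<Rightarrow> ('o, 'm) syzygy_resolution)
      \<Rightarrow> int \<Rightarrow> 'o \<Rightarrow> 'o \<Rightarrow> nat \<Rightarrow> 'm set \<Rightarrow> (nat \<times> 'm set) set" where
  "cExt_class A W R n M N =
     colim_class (cExt_start n) (cExt_group A W R n M N) (cExt_trans A W R n M N)"

text \<open>
  Functoriality of complete cohomology: at stage i a morphism g : N -> N' acts by composition
  with Omega_i g, and a morphism f : M -> M' by composition with Omega_(i+n) f.
\<close>

definition cExt_map_right ::
    "('o, 'm, 'z) cat_scheme \<Rightarrow> 'o set \<Rightarrow> ('o \<Rightarrow> ('o, 'm) syzygy_resolution)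
      \<Rightarrow> int \<Rightarrow> 'o \<Rightarrow> 'm \<Rightarrow> (nat \<times> 'm set) set \<Rightarrow> (nat \<times> 'm set) set" where
  "cExt_map_right A W R n M g = induced (\<lambda>(i, x).
     cExt_class A W R n M (tgt A g) i
       (stable_comp A W (Lam_iter A W R (src A g) (tgt A g) i (stable_class A W g)) x))"

definition cExt_map_left ::
    "('o, 'm, 'z) cat_scheme \<Rightarrow> 'o set \<Rightarrow> ('o \<Rightarrow> ('o, 'm) syzygy_resolution)
      \<Rightarrow> int \<Rightarrow> 'm \<Rightarrow> 'o \<Rightarrow> (nat \<times> 'm set) set \<Rightarrow> (nat \<times> 'm set) set" where
  "cExt_map_left A W R n f N = induced (\<lambda>(i, x).
     cExt_class A W R n (src A f) N i
       (stable_comp A W x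
          (Lam_iter A W R (src A f) (tgt A f) (nat (int i + n)) (stable_class A W f))))"


section \<open>Cohomology of Hom complexes\<close>

text \<open>
  Hom(H, N) has Hom(H_n, N) in cohomological degree n. Its differential is composition with
  dif H (n + 1); a sign in its definition would change neither cocycles nor coboundaries.
\<close>

definition cocycles ::
    "('o, 'm, 'z) cat_scheme \<Rightarrow> ('o, 'm, 'y) cplx_scheme \<Rightarrow> 'o \<Rightarrow> int \<Rightarrow> 'm set" where
  "cocycles A H N n =
     kernel (Hom_group A (cob H n) N) (Hom_group A (cob H (n + 1)) N)
       (\<lambda>f. f \<cdot>\<^bsub>A\<^esub> dif H (n + 1))"

definition coboundaries ::
    "('o, 'm, 'z) cat_scheme \<Rightarrow> ('o, 'm, 'y) cplx_scheme \<Rightarrow> 'o \<Rightarrow> int \<Rightarrow> 'm set" where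
  "coboundaries A H N n = (\<lambda>f. f \<cdot>\<^bsub>A\<^esub> dif H n) ` Hom A (cob H (n - 1)) N"

definition Hom_cohomology ::
    "('o, 'm, 'z) cat_scheme \<Rightarrow> ('o, 'm, 'y) cplx_scheme \<Rightarrow> 'o \<Rightarrow> int \<Rightarrow> 'm set monoid" where
  "Hom_cohomology A H N n =
     (Hom_group A (cob H n) N)\<lparr>carrier := cocycles A H N n\<rparr> Mod coboundaries A H N n"

definition cohomology_class ::
    "('o, 'm, 'z) cat_scheme \<Rightarrow> ('o, 'm, 'y) cplx_scheme \<Rightarrow> 'o \<Rightarrow> int \<Rightarrow> 'm \<Rightarrow> 'm set" where
  "cohomology_class A H N n f = coboundaries A H N n #>\<^bsub>Hom_group A (cob H n) N\<^esub> f"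

definition cohomology_map_right ::
    "('o, 'm, 'z) cat_scheme \<Rightarrow> ('o, 'm, 'y) cplx_scheme \<Rightarrow> 'm \<Rightarrow> int \<Rightarrow> 'm set \<Rightarrow> 'm set" where
  "cohomology_map_right A H g n =
     induced (\<lambda>f. cohomology_class A H (tgt A g) n (g \<cdot>\<^bsub>A\<^esub> f))"

text \<open>The map H^n(Hom(H', N)) -> H^n(Hom(H, N)) induced by a chain map v : H -> H'.\<close>

definition cohomology_map_left ::
    "('o, 'm, 'z) cat_scheme \<Rightarrow> ('o, 'm, 'y) cplx_scheme \<Rightarrow> (int \<Rightarrow> 'm) \<Rightarrow> 'o \<Rightarrow> int
      \<Rightarrow> 'm set \<Rightarrow> 'm set" where
  "cohomology_map_left A H v N n =
     induced (\<lambda>f. cohomology_class A H N n (f \<cdot>\<^bsub>A\<^esub> v n))"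

end

theory Submission
  imports Defs
begin

text \<open>
  Let \<open>Q\<close> be the chosen special proper resolution of \<open>N\<close>, with syzygies \<open>\<Omega>\<^sub>i N\<close>. Since \<open>H\<close> consists of
  objects of \<open>W\<close> and the kernel \<open>\<Omega>\<^sub>i\<^sub>+\<^sub>1 N\<close> lies in the right orthogonal of \<open>W\<close>, the sequence
  \<open>0 \<rightarrow> Hom(H, \<Omega>\<^sub>i\<^sub>+\<^sub>1 N) \<rightarrow> Hom(H, Q\<^sub>i) \<rightarrow> Hom(H, \<Omega>\<^sub>i N) \<rightarrow> 0\<close> is exact, and its middle term is acyclic, so
  dimension shifting identifies \<open>H\<^sup>n(Hom(H, N))\<close> with \<open>H\<^sup>n\<^sup>+\<^sup>i(Hom(H, \<Omega>\<^sub>i N))\<close>. Composing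
  \<open>f : \<Omega>\<^sub>k M \<rightarrow> \<Omega>\<^sub>i N\<close>, where \<open>k = n + i\<close>, with \<open>H\<^sub>k \<rightarrow> P\<^sub>k \<rightarrow> \<Omega>\<^sub>k M\<close> gives a cocycle of the latter complex. A morphism
  \<open>(f', b, f)\<close> between the short exact sequences of syzygies shows both that the transition map sends
  the class of \<open>f\<close> to that of \<open>f'\<close> and that the cocycles of \<open>f\<close> and \<open>f'\<close> correspond under the
  shift; this defines the map on the colimit. For large \<open>k\<close> the complexes \<open>H\<close> and \<open>P\<close> agree, and \<open>P\<close>
  is homotopy equivalent to the chosen resolution of \<open>M\<close>, so the maps at stage \<open>i\<close> are bijective for
  large \<open>i\<close>.
\<close>

section \<open>Arithmetic of arrows\<close>

text \<open>The definition of \<open>Lam\<close> runs through \<open>Ext1\<close>, where morphisms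
  are visible only as sets of extensions. \<open>Lam_class\<close> removes this obstacle: every
  morphism between two special precovers computes a transition map, and after that lemma classes of
  extensions no longer occur. Commutation holds only up to homotopy, because the given
  \<open>P\<close> and the chosen resolution of \<open>M\<close> are merely homotopy equivalent.
  \<open>Phi_eqI\<close> therefore evaluates the comparison map from any cocycle that differs from
  the expected one by a coboundary. The comparison map exists at every stage, since
  \<open>\<gamma>\<close> is given in all degrees, but it is bijective only at large stages. This
  suffices: two elements are identified in the colimit as soon as their images agree, because both
  can be pushed to a stage where the map is injective. Questions about the colimit are thus settled
  in the cohomology group. The system starts at the larger of 0 and \<open>-n\<close>, so
  \<open>k = n + i\<close> is always a natural number; only the nonnegative part of each resolution
  is seen, even when \<open>n\<close> is negative.\<close>

lemma in_Hom [simp]: "f \<in> Hom A X Y \<longleftrightarrow> f \<in> arrs A \<and> src A f = X \<and> tgt A f = Y"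
  by (simp add: Hom_def)

lemma Hom_group_simps [simp]:
  "carrier (Hom_group A X Y) = Hom A X Y" "mult (Hom_group A X Y) = madd A"
  "one (Hom_group A X Y) = mzero A X Y"
  by (simp_all add: Hom_group_def)

text \<open>Source and target are read off from the arrow, so negation takes no Hom-set as a
  parameter.\<close>

definition mneg :: "('o, 'm, 'z) cat_scheme \<Rightarrow> 'm \<Rightarrow> 'm" where
  "mneg A f = inv\<^bsub>Hom_group A (src A f) (tgt A f)\<^esub> f"

context category
begin

text \<open>
  Typing is expressed through \<open>src\<close> and \<open>tgt\<close> instead of membership in \<open>Hom\<close>: the rules below then
  have no variables in their premises that do not occur in their left-hand sides, so the simplifier
  can discharge all typing conditions by itself.
\<close>

lemma cmp_arr [simp]:
  assumes "g \<in> arrs A" "f \<in> arrs A" "src A g = tgt A f"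
  shows "g \<cdot> f \<in> arrs A" "src A (g \<cdot> f) = src A f" "tgt A (g \<cdot> f) = tgt A g"
  using cmp_in[of g "tgt A f" "tgt A g" f "src A f"] assms by simp_all

lemma arr_objs [simp]: "f \<in> arrs A \<Longrightarrow> src A f \<in> objs A" "f \<in> arrs A \<Longrightarrow> tgt A f \<in> objs A"
  by (simp_all add: src_in tgt_in)

lemma idm_arr [simp]:
  assumes "X \<in> objs A"
  shows "idm A X \<in> arrs A" "src A (idm A X) = X" "tgt A (idm A X) = X"
  using idm_in[OF assms] by simp_all

lemma cmp_idm [simp]:
  "f \<in> arrs A \<Longrightarrow> src A f = X \<Longrightarrow> f \<cdot> idm A X = f"
  "f \<in> arrs A \<Longrightarrow> tgt A f = X \<Longrightarrow> idm A X \<cdot> f = f"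
  using cmp_idm_left cmp_idm_right by auto

lemma assoc [simp]:
  assumes "h \<in> arrs A" "g \<in> arrs A" "f \<in> arrs A" "src A h = tgt A g" "src A g = tgt A f"
  shows "(h \<cdot> g) \<cdot> f = h \<cdot> (g \<cdot> f)"
  using assms by (intro cmp_assoc[of _ "tgt A g" _ _ "tgt A f" _ "src A f"]) auto

text \<open>The simplifier nests compositions to the right, so an equation for
  \<open>g \<cdot> f\<close> no longer matches inside a longer composite. This variant carries the
  tail \<open>x\<close> along; the two expansion rules below use such an equation backwards, on
  either side.\<close>

lemma cmp_reduce:
  assumes "g \<cdot> f = e" "g \<in> arrs A" "f \<in> arrs A" "src A g = tgt A f" "x \<in> arrs A" "tgt A x = src A f"
  shows "g \<cdot> (f \<cdot> x) = e \<cdot> x"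
  using assms by (metis assoc)

lemma cmp_expand_left:
  assumes "g \<cdot> f = e" "g \<in> arrs A" "f \<in> arrs A" "src A g = tgt A f" "x \<in> arrs A" "tgt A x = src A f"
  shows "e \<cdot> x = g \<cdot> (f \<cdot> x)"
  using assms by (metis assoc)

lemma cmp_expand_right:
  assumes "g \<cdot> f = e" "g \<in> arrs A" "f \<in> arrs A" "src A g = tgt A f" "x \<in> arrs A" "src A x = tgt A g"
  shows "x \<cdot> e = (x \<cdot> g) \<cdot> f"
  using assms by (metis assoc)

end

context preadditive_category
begin

lemma zero_arr [simp]:
  assumes "X \<in> objs A" "Y \<in> objs A"
  shows "mzero A X Y \<in> arrs A" "src A (mzero A X Y) = X" "tgt A (mzero A X Y) = Y"
proof -
  interpret comm_group "Hom_group A X Y" by (rule Hom_comm_group[OF assms])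
  show "mzero A X Y \<in> arrs A" "src A (mzero A X Y) = X" "tgt A (mzero A X Y) = Y"
    using one_closed by simp_all
qed

lemma Hom_group_arr: "f \<in> arrs A \<Longrightarrow> comm_group (Hom_group A (src A f) (tgt A f))"
  by (simp add: Hom_comm_group)

lemma madd_arr [simp]:
  assumes "f \<in> arrs A" "g \<in> arrs A" "src A g = src A f" "tgt A g = tgt A f"
  shows "madd A f g \<in> arrs A" "src A (madd A f g) = src A f" "tgt A (madd A f g) = tgt A f"
proof -
  interpret comm_group "Hom_group A (src A f) (tgt A f)" by (rule Hom_group_arr[OF assms(1)])
  show "madd A f g \<in> arrs A" "src A (madd A f g) = src A f" "tgt A (madd A f g) = tgt A f"
    using m_closed[of f g] assms by simp_all
qed

lemma mneg_arr [simp]: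
  assumes "f \<in> arrs A"
  shows "mneg A f \<in> arrs A" "src A (mneg A f) = src A f" "tgt A (mneg A f) = tgt A f"
proof -
  interpret comm_group "Hom_group A (src A f) (tgt A f)" by (rule Hom_group_arr[OF assms(1)])
  show "mneg A f \<in> arrs A" "src A (mneg A f) = src A f" "tgt A (mneg A f) = tgt A f"
    using inv_closed[of f] assms by (simp_all add: mneg_def)
qed

lemma madd_assoc:
  assumes "f \<in> arrs A" "g \<in> arrs A" "h \<in> arrs A" "src A g = src A f" "tgt A g = tgt A f"
    "src A h = src A f" "tgt A h = tgt A f"
  shows "madd A (madd A f g) h = madd A f (madd A g h)"
proof -
  interpret comm_group "Hom_group A (src A f) (tgt A f)" by (rule Hom_group_arr[OF assms(1)])
  show ?thesis using m_assoc[of f g h] assms by simp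
qed

lemma madd_comm:
  assumes "f \<in> arrs A" "g \<in> arrs A" "src A g = src A f" "tgt A g = tgt A f"
  shows "madd A f g = madd A g f"
proof -
  interpret comm_group "Hom_group A (src A f) (tgt A f)" by (rule Hom_group_arr[OF assms(1)])
  show ?thesis using m_comm[of f g] assms by simp
qed

lemma madd_left_comm:
  assumes "f \<in> arrs A" "g \<in> arrs A" "h \<in> arrs A" "src A g = src A f" "tgt A g = tgt A f"
    "src A h = src A f" "tgt A h = tgt A f"
  shows "madd A f (madd A g h) = madd A g (madd A f h)"
proof -
  interpret comm_group "Hom_group A (src A f) (tgt A f)" by (rule Hom_group_arr[OF assms(1)])
  show ?thesis using m_lcomm[of f g h] assms by simp
qed

lemma madd_zero [simp]:
  assumes "f \<in> arrs A" "src A f = X" "tgt A f = Y"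
  shows "madd A f (mzero A X Y) = f" "madd A (mzero A X Y) f = f"
proof -
  interpret comm_group "Hom_group A (src A f) (tgt A f)" by (rule Hom_group_arr[OF assms(1)])
  show "madd A f (mzero A X Y) = f" "madd A (mzero A X Y) f = f"
    using r_one[of f] l_one[of f] assms by simp_all
qed

lemma madd_mneg [simp]:
  assumes "f \<in> arrs A"
  shows "madd A f (mneg A f) = mzero A (src A f) (tgt A f)"
    "madd A (mneg A f) f = mzero A (src A f) (tgt A f)"
proof -
  interpret comm_group "Hom_group A (src A f) (tgt A f)" by (rule Hom_group_arr[OF assms(1)])
  show "madd A f (mneg A f) = mzero A (src A f) (tgt A f)"
    "madd A (mneg A f) f = mzero A (src A f) (tgt A f)"
    using r_inv[of f] l_inv[of f] assms by (simp_all add: mneg_def)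
qed

lemma madd_mneg_cancel [simp]:
  assumes "f \<in> arrs A" "g \<in> arrs A" "src A g = src A f" "tgt A g = tgt A f"
  shows "madd A f (madd A (mneg A f) g) = g" "madd A (mneg A f) (madd A f g) = g"
  using assms by (simp_all flip: madd_assoc)

lemma madd_cancel:
  assumes "f \<in> arrs A" "g \<in> arrs A" "h \<in> arrs A" "src A g = src A f" "tgt A g = tgt A f"
    "src A h = src A f" "tgt A h = tgt A f"
  shows "madd A f g = madd A f h \<longleftrightarrow> g = h"
  using assms by (metis madd_mneg_cancel(2))

lemma madd_eq_zero:
  assumes "f \<in> arrs A" "g \<in> arrs A" "src A g = src A f" "tgt A g = tgt A f"
    "madd A f g = mzero A (src A f) (tgt A f)"
  shows "g = mneg A f" "f = mneg A g"
proof -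
  have *: "g = mneg A f" if "f \<in> arrs A" "g \<in> arrs A" "src A g = X" "tgt A g = Y" "src A f = X"
    "tgt A f = Y" "madd A f g = mzero A X Y" for f g X Y
    using that madd_cancel[of f g "mneg A f"] by simp
  show "g = mneg A f"
    by (rule *) (use assms in simp_all)
  show "f = mneg A g"
    by (rule *[of _ _ "src A f" "tgt A f"]) (use assms madd_comm[of g f] in simp_all)
qed

lemma mneg_mneg [simp]: "f \<in> arrs A \<Longrightarrow> mneg A (mneg A f) = f"
  using madd_eq_zero(2)[of f "mneg A f"] by simp

lemma mneg_madd [simp]:
  assumes "f \<in> arrs A" "g \<in> arrs A" "src A g = src A f" "tgt A g = tgt A f"
  shows "mneg A (madd A f g) = madd A (mneg A f) (mneg A g)"
proof -
  have "madd A (madd A f g) (madd A (mneg A f) (mneg A g)) =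
      madd A f (madd A g (madd A (mneg A f) (mneg A g)))"
    using assms by (intro madd_assoc) simp_all
  also have "\<dots> = madd A f (madd A (mneg A f) (madd A g (mneg A g)))"
    using assms by (subst madd_left_comm) simp_all
  also have "\<dots> = mzero A (src A f) (tgt A f)"
    using assms by simp
  finally show ?thesis
    using assms madd_eq_zero(1)[of "madd A f g" "madd A (mneg A f) (mneg A g)"] by simp
qed

lemma cmp_madd [simp]:
  assumes "f \<in> arrs A" "f' \<in> arrs A" "src A f' = src A f" "tgt A f' = tgt A f" "g \<in> arrs A"
  shows "src A g = tgt A f \<Longrightarrow> g \<cdot> madd A f f' = madd A (g \<cdot> f) (g \<cdot> f')"
    "tgt A g = src A f \<Longrightarrow> madd A f f' \<cdot> g = madd A (f \<cdot> g) (f' \<cdot> g)"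
  using assms cmp_madd_right[of g "tgt A f" "tgt A g" f "src A f" f']
    cmp_madd_left[of f "src A f" "tgt A f" f' g "src A g"] by simp_all

lemma cmp_zero [simp]:
  assumes "g \<in> arrs A" "X \<in> objs A"
  shows "src A g = Y \<Longrightarrow> g \<cdot> mzero A X Y = mzero A X (tgt A g)"
    "tgt A g = Y \<Longrightarrow> mzero A Y X \<cdot> g = mzero A (src A g) X"
proof -
  assume Y: "src A g = Y"
  then have "Y \<in> objs A" using assms by auto
  then have "madd A (g \<cdot> mzero A X Y) (g \<cdot> mzero A X Y) = madd A (g \<cdot> mzero A X Y) (mzero A X (tgt A g))"
    using Y assms by (subst cmp_madd(1)[symmetric]) simp_all
  then show "g \<cdot> mzero A X Y = mzero A X (tgt A g)"
    using Y assms \<open>Y \<in> objs A\<close> by (subst (asm) madd_cancel) simp_all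
next
  assume Y: "tgt A g = Y"
  then have "Y \<in> objs A" using assms by auto
  then have "madd A (mzero A Y X \<cdot> g) (mzero A Y X \<cdot> g) = madd A (mzero A Y X \<cdot> g) (mzero A (src A g) X)"
    using Y assms by (subst cmp_madd(2)[symmetric]) simp_all
  then show "mzero A Y X \<cdot> g = mzero A (src A g) X"
    using Y assms \<open>Y \<in> objs A\<close> by (subst (asm) madd_cancel) simp_all
qed

lemma mneg_zero [simp]: "X \<in> objs A \<Longrightarrow> Y \<in> objs A \<Longrightarrow> mneg A (mzero A X Y) = mzero A X Y"
  using madd_eq_zero(1)[of "mzero A X Y" "mzero A X Y"] by simp

lemma cmp_mneg [simp]:
  assumes "g \<in> arrs A" "f \<in> arrs A" "src A g = tgt A f"
  shows "g \<cdot> mneg A f = mneg A (g \<cdot> f)" "mneg A g \<cdot> f = mneg A (g \<cdot> f)"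
proof -
  have "madd A (g \<cdot> f) (g \<cdot> mneg A f) = mzero A (src A f) (tgt A g)"
    using assms by (subst cmp_madd(1)[symmetric]) simp_all
  then show "g \<cdot> mneg A f = mneg A (g \<cdot> f)"
    using assms by (intro madd_eq_zero(1)) simp_all
  have "madd A (g \<cdot> f) (mneg A g \<cdot> f) = mzero A (src A f) (tgt A g)"
    using assms by (subst cmp_madd(2)[symmetric]) simp_all
  then show "mneg A g \<cdot> f = mneg A (g \<cdot> f)"
    using assms by (intro madd_eq_zero(1)) simp_all
qed

lemma eq_iff_diff:
  assumes "f \<in> arrs A" "g \<in> arrs A" "src A g = src A f" "tgt A g = tgt A f"
  shows "f = g \<longleftrightarrow> madd A f (mneg A g) = mzero A (src A f) (tgt A f)"
proof
  assume "madd A f (mneg A g) = mzero A (src A f) (tgt A f)"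
  then have "f = mneg A (mneg A g)"
    using assms by (intro madd_eq_zero(2)) simp_all
  then show "f = g" using assms by simp
next
  assume "f = g"
  then show "madd A f (mneg A g) = mzero A (src A f) (tgt A f)" using assms(2) by simp
qed

lemma diff_eq_iff:
  assumes "f \<in> arrs A" "g \<in> arrs A" "h \<in> arrs A" "src A g = src A f" "tgt A g = tgt A f"
    "src A h = src A f" "tgt A h = tgt A f"
  shows "madd A f (mneg A g) = h \<longleftrightarrow> f = madd A h g"
proof
  assume *: "madd A f (mneg A g) = h"
  show "f = madd A h g" using assms(1,2,4,5) by (simp add: madd_assoc flip: *)
next
  assume *: "f = madd A h g"
  have "madd A (madd A h g) (mneg A g) = h"
    using assms by (subst madd_assoc) simp_all
  then show "madd A f (mneg A g) = h" using * by simp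
qed

section \<open>Kernels, cokernels, monomorphisms and epimorphisms\<close>

lemma kerD:
  assumes "is_ker A k g"
  shows "k \<in> arrs A" "g \<in> arrs A" "src A g = tgt A k" "g \<cdot> k = mzero A (src A k) (tgt A g)"
  using assms by (auto simp: is_ker_def)

lemma ker_lift:
  assumes "is_ker A k g" "t \<in> arrs A" "tgt A t = src A g" "g \<cdot> t = mzero A (src A t) (tgt A g)"
  obtains u where "u \<in> arrs A" "src A u = src A t" "tgt A u = src A k" "k \<cdot> u = t"
proof -
  have "t \<in> Hom A (src A t) (src A g)" using assms(2,3) by simp
  then have "\<exists>!u. u \<in> Hom A (src A t) (src A k) \<and> k \<cdot> u = t"
    using assms(1,4) arr_objs(1)[OF assms(2)] unfolding is_ker_def by blast
  then obtain u where "u \<in> Hom A (src A t) (src A k) \<and> k \<cdot> u = t" by blast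
  then show thesis using that[of u] by simp
qed

lemma cokerD:
  assumes "is_coker A c f"
  shows "c \<in> arrs A" "f \<in> arrs A" "src A c = tgt A f" "c \<cdot> f = mzero A (src A f) (tgt A c)"
  using assms by (auto simp: is_coker_def)

lemma coker_desc:
  assumes "is_coker A c f" "t \<in> arrs A" "src A t = tgt A f" "t \<cdot> f = mzero A (src A f) (tgt A t)"
  obtains u where "u \<in> arrs A" "src A u = tgt A c" "tgt A u = tgt A t" "u \<cdot> c = t"
proof -
  have "t \<in> Hom A (tgt A f) (tgt A t)" using assms(2,3) by simp
  then have "\<exists>!u. u \<in> Hom A (tgt A c) (tgt A t) \<and> u \<cdot> c = t"
    using assms(1,4) arr_objs(2)[OF assms(2)] unfolding is_coker_def by blast
  then obtain u where "u \<in> Hom A (tgt A c) (tgt A t) \<and> u \<cdot> c = t" by blast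
  then show thesis using that[of u] by simp
qed

lemma ker_mono:
  assumes "is_ker A k g" shows "is_mono A k"
  unfolding is_mono_def
proof (intro conjI ballI impI)
  note K = kerD[OF assms]
  show "k \<in> arrs A" by (rule K)
  fix Z u v assume *: "Z \<in> objs A" "u \<in> Hom A Z (src A k)" "v \<in> Hom A Z (src A k)" "k \<cdot> u = k \<cdot> v"
  have "g \<cdot> (k \<cdot> u) = mzero A Z (tgt A g)"
    using * K cmp_reduce[OF K(4)] by simp
  moreover have "k \<cdot> u \<in> Hom A Z (src A g)" using * K by simp
  ultimately have "\<exists>!w. w \<in> Hom A Z (src A k) \<and> k \<cdot> w = k \<cdot> u"
    using assms *(1) unfolding is_ker_def by (metis (no_types, lifting))
  then show "u = v" using * by auto
qed

lemma coker_epi: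
  assumes "is_coker A c f" shows "is_epi A c"
  unfolding is_epi_def
proof (intro conjI ballI impI)
  note K = cokerD[OF assms]
  show "c \<in> arrs A" by (rule K)
  fix Z u v assume *: "Z \<in> objs A" "u \<in> Hom A (tgt A c) Z" "v \<in> Hom A (tgt A c) Z" "u \<cdot> c = v \<cdot> c"
  have "(u \<cdot> c) \<cdot> f = mzero A (src A f) Z"
    using * K assoc[of v c f] by simp
  moreover have "u \<cdot> c \<in> Hom A (tgt A f) Z" using * K by simp
  ultimately have "\<exists>!w. w \<in> Hom A (tgt A c) Z \<and> w \<cdot> c = u \<cdot> c"
    using assms *(1) unfolding is_coker_def by (metis (no_types, lifting))
  then show "u = v" using * by auto
qed

text \<open>By additivity the test is made on the difference of two arrows, so that only zero has to
  be cancelled.\<close>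

lemma monoI:
  assumes "f \<in> arrs A"
    and "\<And>u. u \<in> arrs A \<Longrightarrow> tgt A u = src A f \<Longrightarrow> f \<cdot> u = mzero A (src A u) (tgt A f) \<Longrightarrow>
      u = mzero A (src A u) (src A f)"
  shows "is_mono A f"
  unfolding is_mono_def
proof (intro conjI ballI impI)
  fix Z u v assume *: "Z \<in> objs A" "u \<in> Hom A Z (src A f)" "v \<in> Hom A Z (src A f)" "f \<cdot> u = f \<cdot> v"
  then have "madd A u (mneg A v) = mzero A Z (src A f)"
    using assms(2)[of "madd A u (mneg A v)"] assms(1) by auto
  then show "u = v" using * eq_iff_diff[of u v] by auto
qed (rule assms)

lemma epiI:
  assumes "f \<in> arrs A"
    and "\<And>u. u \<in> arrs A \<Longrightarrow> src A u = tgt A f \<Longrightarrow> u \<cdot> f = mzero A (src A f) (tgt A u) \<Longrightarrow>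
      u = mzero A (tgt A f) (tgt A u)"
  shows "is_epi A f"
  unfolding is_epi_def
proof (intro conjI ballI impI)
  fix Z u v assume *: "Z \<in> objs A" "u \<in> Hom A (tgt A f) Z" "v \<in> Hom A (tgt A f) Z" "u \<cdot> f = v \<cdot> f"
  then have "madd A u (mneg A v) = mzero A (tgt A f) Z"
    using assms(2)[of "madd A u (mneg A v)"] assms(1) by auto
  then show "u = v" using * eq_iff_diff[of u v] by auto
qed (rule assms)

lemma mono_cancel:
  assumes "is_mono A f" "u \<in> arrs A" "v \<in> arrs A" "tgt A u = src A f" "tgt A v = src A f"
    "src A u = src A v" "f \<cdot> u = f \<cdot> v"
  shows "u = v"
proof -
  have "u \<in> Hom A (src A v) (src A f)" "v \<in> Hom A (src A v) (src A f)" using assms(2-6) by simp_all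
  then show ?thesis using assms(1,7) arr_objs(1)[OF assms(3)] unfolding is_mono_def by blast
qed

lemma epi_cancel:
  assumes "is_epi A f" "u \<in> arrs A" "v \<in> arrs A" "src A u = tgt A f" "src A v = tgt A f"
    "tgt A u = tgt A v" "u \<cdot> f = v \<cdot> f"
  shows "u = v"
proof -
  have "u \<in> Hom A (tgt A f) (tgt A v)" "v \<in> Hom A (tgt A f) (tgt A v)" using assms(2-6) by simp_all
  then show ?thesis using assms(1,7) arr_objs(2)[OF assms(3)] unfolding is_epi_def by blast
qed

text \<open>Uniqueness of factorisations is traded for \<open>k\<close> being mono, which leaves a
  pure existence problem.\<close>

lemma is_kerI:
  assumes "is_mono A k" "g \<in> arrs A" "src A g = tgt A k" "g \<cdot> k = mzero A (src A k) (tgt A g)"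
    and "\<And>t. t \<in> arrs A \<Longrightarrow> tgt A t = src A g \<Longrightarrow> g \<cdot> t = mzero A (src A t) (tgt A g) \<Longrightarrow>
      \<exists>u. u \<in> arrs A \<and> src A u = src A t \<and> tgt A u = src A k \<and> k \<cdot> u = t"
  shows "is_ker A k g"
  unfolding is_ker_def
proof (intro conjI ballI impI)
  show "k \<in> arrs A" using assms(1) by (simp add: is_mono_def)
  fix Z t assume "Z \<in> objs A" "t \<in> Hom A Z (src A g)" "g \<cdot> t = mzero A Z (tgt A g)"
  then obtain u where u: "u \<in> Hom A Z (src A k) \<and> k \<cdot> u = t" using assms(5)[of t] by auto
  show "\<exists>!u. u \<in> Hom A Z (src A k) \<and> k \<cdot> u = t"
  proof (rule ex1I, rule u)
    fix v assume "v \<in> Hom A Z (src A k) \<and> k \<cdot> v = t"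
    then show "v = u" using u mono_cancel[OF assms(1), of v u] by simp
  qed
qed (use assms in auto)

lemma is_cokerI:
  assumes "is_epi A c" "f \<in> arrs A" "src A c = tgt A f" "c \<cdot> f = mzero A (src A f) (tgt A c)"
    and "\<And>t. t \<in> arrs A \<Longrightarrow> src A t = tgt A f \<Longrightarrow> t \<cdot> f = mzero A (src A f) (tgt A t) \<Longrightarrow>
      \<exists>u. u \<in> arrs A \<and> src A u = tgt A c \<and> tgt A u = tgt A t \<and> u \<cdot> c = t"
  shows "is_coker A c f"
  unfolding is_coker_def
proof (intro conjI ballI impI)
  show "c \<in> arrs A" using assms(1) by (simp add: is_epi_def)
  fix Z t assume "Z \<in> objs A" "t \<in> Hom A (tgt A f) Z" "t \<cdot> f = mzero A (src A f) Z"
  then obtain u where u: "u \<in> Hom A (tgt A c) Z \<and> u \<cdot> c = t" using assms(5)[of t] by auto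
  show "\<exists>!u. u \<in> Hom A (tgt A c) Z \<and> u \<cdot> c = t"
  proof (rule ex1I, rule u)
    fix v assume "v \<in> Hom A (tgt A c) Z \<and> v \<cdot> c = t"
    then show "v = u" using u epi_cancel[OF assms(1), of v u] by simp
  qed
qed (use assms in auto)

section \<open>Calculation with biproducts\<close>

lemma biproductD:
  assumes "is_biproduct A X Y S i j p q"
  shows "i \<in> arrs A" "j \<in> arrs A" "p \<in> arrs A" "q \<in> arrs A"
    "X \<in> objs A" "Y \<in> objs A" "S \<in> objs A"
    "src A i = X" "tgt A i = S" "src A j = Y" "tgt A j = S"
    "src A p = S" "tgt A p = X" "src A q = S" "tgt A q = Y"
    "p \<cdot> i = idm A X" "q \<cdot> j = idm A Y" "q \<cdot> i = mzero A X Y" "p \<cdot> j = mzero A Y X"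
    "madd A (i \<cdot> p) (j \<cdot> q) = idm A S"
  using assms by (auto simp: is_biproduct_def)

lemma biproduct_cmp:
  assumes "is_biproduct A X Y S i j p q" "z \<in> arrs A"
  shows "tgt A z = X \<Longrightarrow> p \<cdot> (i \<cdot> z) = z" "tgt A z = Y \<Longrightarrow> q \<cdot> (j \<cdot> z) = z"
    "tgt A z = X \<Longrightarrow> q \<cdot> (i \<cdot> z) = mzero A (src A z) Y"
    "tgt A z = Y \<Longrightarrow> p \<cdot> (j \<cdot> z) = mzero A (src A z) X"
  using biproductD[OF assms(1)] assms(2)
  by (simp_all add: cmp_reduce[of p i] cmp_reduce[of q j] cmp_reduce[of q i] cmp_reduce[of p j])

lemma biproduct_split_in:
  assumes "is_biproduct A X Y S i j p q" "z \<in> arrs A" "tgt A z = S"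
  shows "z = madd A (i \<cdot> (p \<cdot> z)) (j \<cdot> (q \<cdot> z))"
proof -
  note B = biproductD[OF assms(1)]
  have "z = madd A (i \<cdot> p) (j \<cdot> q) \<cdot> z" using B assms by simp
  then show ?thesis using B(1-15) assms by simp
qed

lemma biproduct_split_out:
  assumes "is_biproduct A X Y S i j p q" "z \<in> arrs A" "src A z = S"
  shows "z = madd A (z \<cdot> (i \<cdot> p)) (z \<cdot> (j \<cdot> q))"
proof -
  note B = biproductD[OF assms(1)]
  have "z = z \<cdot> madd A (i \<cdot> p) (j \<cdot> q)" using B assms by simp
  then show ?thesis using B(1-15) assms by simp
qed

lemma biproduct_eq_in:
  assumes "is_biproduct A X Y S i j p q" "z \<in> arrs A" "tgt A z = S" "z' \<in> arrs A" "tgt A z' = S"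
    "p \<cdot> z = p \<cdot> z'" "q \<cdot> z = q \<cdot> z'"
  shows "z = z'"
  using biproduct_split_in[OF assms(1-3)] biproduct_split_in[OF assms(1,4,5)] assms(6,7) by simp

lemma biproduct_eq_out:
  assumes "is_biproduct A X Y S i j p q" "z \<in> arrs A" "src A z = S" "z' \<in> arrs A" "src A z' = S"
    "z \<cdot> i = z' \<cdot> i" "z \<cdot> j = z' \<cdot> j"
  shows "z = z'"
proof -
  note B = biproductD(1-15)[OF assms(1)]
  have "z \<cdot> (i \<cdot> p) = z' \<cdot> (i \<cdot> p)" "z \<cdot> (j \<cdot> q) = z' \<cdot> (j \<cdot> q)"
    using assms B by (simp_all flip: assoc)
  then show ?thesis
    using biproduct_split_out[OF assms(1-3)] biproduct_split_out[OF assms(1,4,5)] by simp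
qed

end

section \<open>Pushouts and pullbacks of short exact sequences\<close>

lemma short_exactD:
  assumes "short_exact A k p"
  shows "is_ker A k p" "is_coker A p k"
  using assms by (simp_all add: short_exact_def)

lemma (in preadditive_category) short_exact_arr:
  assumes "short_exact A k p"
  shows "k \<in> arrs A" "p \<in> arrs A" "src A p = tgt A k" "p \<cdot> k = mzero A (src A k) (tgt A p)"
  using kerD[OF short_exactD(1)[OF assms]] by simp_all

lemma (in preadditive_category) short_exact_mono_epi:
  assumes "short_exact A k p"
  shows "is_mono A k" "is_epi A p"
  using ker_mono coker_epi short_exactD[OF assms] by blast+

context preadditive_category
begin

lemma mono_zero:
  assumes "is_mono A f" "u \<in> arrs A" "tgt A u = src A f" "f \<cdot> u = mzero A (src A u) (tgt A f)"
  shows "u = mzero A (src A u) (src A f)"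
  by (rule mono_cancel[OF assms(1)]) (use assms in \<open>simp_all add: is_mono_def\<close>)

lemma epi_zero:
  assumes "is_epi A f" "u \<in> arrs A" "src A u = tgt A f" "u \<cdot> f = mzero A (src A f) (tgt A u)"
  shows "u = mzero A (tgt A f) (tgt A u)"
  by (rule epi_cancel[OF assms(1)]) (use assms in \<open>simp_all add: is_epi_def\<close>)

end

context abelian_category
begin

text \<open>If \<open>f\<close> is the kernel of some \<open>g\<close>, then \<open>g\<close>
  factors through the cokernel \<open>c\<close>; hence whatever \<open>c\<close> kills is killed by
  \<open>g\<close> and lifts along \<open>f\<close>. The next lemma is the dual.\<close>

lemma mono_is_ker_coker:
  assumes "is_mono A f" "is_coker A c f"
  shows "is_ker A f c"
proof -
  obtain g where g: "is_ker A f g" using mono_is_ker[OF assms(1)] by blast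
  note G = kerD[OF g] and C = cokerD[OF assms(2)]
  obtain g' where g': "g' \<in> arrs A" "src A g' = tgt A c" "tgt A g' = tgt A g" "g' \<cdot> c = g"
    using coker_desc[OF assms(2), of g] G by auto
  show ?thesis
  proof (rule is_kerI[OF assms(1) C(1,3,4)])
    fix t assume t: "t \<in> arrs A" "tgt A t = src A c" "c \<cdot> t = mzero A (src A t) (tgt A c)"
    have "g \<cdot> t = g' \<cdot> (c \<cdot> t)"
      by (rule cmp_expand_left[OF g'(4)]) (use t g' C in simp_all)
    then have "g \<cdot> t = mzero A (src A t) (tgt A g)"
      using g'(1-3) C t by simp
    moreover have "tgt A t = src A g" using t C G by simp
    ultimately obtain u where "u \<in> arrs A" "src A u = src A t" "tgt A u = src A f" "f \<cdot> u = t"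
      using ker_lift[OF g t(1)] by blast
    then show "\<exists>u. u \<in> arrs A \<and> src A u = src A t \<and> tgt A u = src A f \<and> f \<cdot> u = t"
      by blast
  qed
qed

lemma epi_is_coker_ker:
  assumes "is_epi A f" "is_ker A k f"
  shows "is_coker A f k"
proof -
  obtain g where g: "is_coker A f g" using epi_is_coker[OF assms(1)] by blast
  note G = cokerD[OF g] and C = kerD[OF assms(2)]
  obtain g' where g': "g' \<in> arrs A" "src A g' = src A g" "tgt A g' = src A k" "k \<cdot> g' = g"
    using ker_lift[OF assms(2), of g] G by auto
  show ?thesis
  proof (rule is_cokerI[OF assms(1) C(1,3,4)])
    fix t assume t: "t \<in> arrs A" "src A t = tgt A k" "t \<cdot> k = mzero A (src A k) (tgt A t)"
    have "t \<cdot> g = (t \<cdot> k) \<cdot> g'"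
      by (rule cmp_expand_right[OF g'(4)]) (use t g' C in simp_all)
    then have "t \<cdot> g = mzero A (src A g) (tgt A t)"
      using g'(1-3) C t by simp
    moreover have "src A t = tgt A g" using t C G by simp
    ultimately obtain u where "u \<in> arrs A" "src A u = tgt A f" "tgt A u = tgt A t" "u \<cdot> f = t"
      using coker_desc[OF g t(1)] by blast
    then show "\<exists>u. u \<in> arrs A \<and> src A u = tgt A f \<and> tgt A u = tgt A t \<and> u \<cdot> f = t"
      by blast
  qed
qed

text \<open>The map from the coimage of \<open>d\<close> is mono. Given \<open>z\<close> killed by
  \<open>j\<close>, its cokernel \<open>q\<close> turns out to be split mono, and
  \<open>q \<cdot> z = 0\<close> then gives \<open>z = 0\<close>.\<close>

lemma coimage_mono:
  assumes "is_ker A k d" "is_coker A c k" "j \<in> arrs A" "src A j = tgt A c" "j \<cdot> c = d"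
  shows "is_mono A j"
proof (rule monoI[OF assms(3)])
  note D = kerD[OF assms(1)] and C = cokerD[OF assms(2)]
  fix z assume z: "z \<in> arrs A" "tgt A z = src A j" "j \<cdot> z = mzero A (src A z) (tgt A j)"
  obtain q where q: "is_coker A q z" using ex_coker z by blast
  note Q = cokerD[OF q]
  have jd: "tgt A d = tgt A j" using assms C by auto
  obtain j' where j': "j' \<in> arrs A" "src A j' = tgt A q" "tgt A j' = tgt A j" "j' \<cdot> q = j"
    by (rule coker_desc[OF q, of j]) (use assms z in auto)
  have "is_epi A (q \<cdot> c)"
  proof (rule epiI)
    show "q \<cdot> c \<in> arrs A" using Q C z assms by simp
    fix u assume u: "u \<in> arrs A" "src A u = tgt A (q \<cdot> c)"
      "u \<cdot> (q \<cdot> c) = mzero A (src A (q \<cdot> c)) (tgt A u)"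
    then have "u \<cdot> q = mzero A (tgt A c) (tgt A u)"
      using epi_zero[OF coker_epi[OF assms(2)], of "u \<cdot> q"] Q C z assms by simp
    then show "u = mzero A (tgt A (q \<cdot> c)) (tgt A u)"
      using epi_zero[OF coker_epi[OF q], of u] Q C z assms u by simp
  qed
  \<comment> \<open>Since \<open>j\<close> factors through \<open>q\<close>, the arrow
    \<open>t\<close> is killed by \<open>d\<close>; it therefore comes from the kernel of
    \<open>d\<close> and is already killed by \<open>c\<close>.\<close>
  then obtain t where t: "is_coker A (q \<cdot> c) t" using epi_is_coker by blast
  note T = cokerD[OF t]
  have st: "tgt A t = src A c" using T Q C z assms by simp
  have "d \<cdot> t = j \<cdot> (c \<cdot> t)"
    by (rule cmp_expand_left[OF assms(5)]) (use T st C assms in simp_all)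
  also have "\<dots> = j' \<cdot> (q \<cdot> (c \<cdot> t))"
    by (rule cmp_expand_left[OF j'(4)]) (use T st C Q z assms j' in simp_all)
  also have "\<dots> = j' \<cdot> ((q \<cdot> c) \<cdot> t)"
    using T(2) C(1,2,3) Q(1,3) z(1,2) assms(4) j'(1-3) st by simp
  also have "\<dots> = mzero A (src A t) (tgt A d)" using T(4) j' T C Q z assms jd by simp
  finally obtain s where s: "s \<in> arrs A" "src A s = src A t" "tgt A s = src A k" "k \<cdot> s = t"
    using ker_lift[OF assms(1), of t] T(2) st C(3) D(3) by auto
  have "c \<cdot> t = (c \<cdot> k) \<cdot> s"
    by (rule cmp_expand_right[OF s(4)]) (use s C in simp_all)
  also have "\<dots> = mzero A (src A t) (tgt A c)" unfolding C(4) using s C by simp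
  finally have "c \<cdot> t = mzero A (src A t) (tgt A c)" .
  \<comment> \<open>As \<open>c\<close> kills \<open>t\<close>, it descends along the cokernel
    \<open>q \<cdot> c\<close> of \<open>t\<close>; cancelling the epi \<open>c\<close> makes
    \<open>r\<close> a left inverse of \<open>q\<close>.\<close>
  then obtain r where r: "r \<in> arrs A" "src A r = tgt A q" "tgt A r = tgt A c" "r \<cdot> (q \<cdot> c) = c"
    using coker_desc[OF t, of c] C st Q z assms by auto
  have "r \<cdot> q = idm A (tgt A c)"
    by (rule epi_cancel[OF coker_epi[OF assms(2)]]) (use r C Q z assms in auto)
  then have "z = (r \<cdot> q) \<cdot> z" using z assms by simp
  also have "\<dots> = mzero A (src A z) (src A j)" using Q r z assms by simp
  finally show "z = mzero A (src A z) (src A j)" .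
qed

text \<open>The pushout is the cokernel \<open>c\<close> of \<open>m = (k, -f)\<close> into the
  biproduct. Since \<open>p1 \<cdot> m = k\<close> is mono, so is \<open>m\<close>, and
  \<open>m\<close> is the kernel of \<open>c\<close>; this is what makes the new map
  \<open>i\<close> mono.\<close>

lemma pushout_exists:
  assumes "short_exact A k p" "f \<in> arrs A" "src A f = src A k"
  obtains i p' h where "short_exact A i p'" "src A i = tgt A f" "tgt A p' = tgt A p"
    "h \<in> arrs A" "src A h = tgt A k" "tgt A h = tgt A i" "h \<cdot> k = i \<cdot> f" "p' \<cdot> h = p"
proof -
  note KP = short_exact_arr[OF assms(1)] short_exact_mono_epi[OF assms(1)]
  obtain S i1 i2 p1 p2 where b: "is_biproduct A (tgt A k) (tgt A f) S i1 i2 p1 p2"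
    using ex_biproduct KP assms by (meson arr_objs)
  note B = biproductD[OF b]
  define m where "m = madd A (i1 \<cdot> k) (mneg A (i2 \<cdot> f))"
  have m: "m \<in> arrs A" "src A m = src A k" "tgt A m = S"
    using B KP assms by (auto simp: m_def)
  have p1m: "p1 \<cdot> m = k"
    using B KP assms biproduct_cmp[OF b] by (simp add: m_def)
  have "is_mono A m"
  proof (rule monoI[OF m(1)])
    fix u assume u: "u \<in> arrs A" "tgt A u = src A m" "m \<cdot> u = mzero A (src A u) (tgt A m)"
    have "k \<cdot> u = p1 \<cdot> (m \<cdot> u)"
      by (rule cmp_expand_left[OF p1m]) (use u m B in simp_all)
    also have "\<dots> = mzero A (src A u) (tgt A k)" using u m B by simp
    finally show "u = mzero A (src A u) (src A m)" using mono_zero[OF KP(5) u(1)] u m by simp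
  qed
  moreover obtain c where c: "is_coker A c m" using ex_coker m by blast
  ultimately have mc: "is_ker A m c" by (rule mono_is_ker_coker)
  note C = cokerD[OF c]
  define i where "i = c \<cdot> i2"
  define h where "h = c \<cdot> i1"
  have i: "i \<in> arrs A" "src A i = tgt A f" "tgt A i = tgt A c"
    and h: "h \<in> arrs A" "src A h = tgt A k" "tgt A h = tgt A c"
    using B C m by (simp_all add: i_def h_def)
  have "madd A (h \<cdot> k) (mneg A (i \<cdot> f)) = c \<cdot> m"
    using B C m KP assms by (simp add: m_def i_def h_def)
  then have hk: "h \<cdot> k = i \<cdot> f"
    using i h C m KP assms by (subst eq_iff_diff) simp_all
  have "(p \<cdot> p1) \<cdot> m = mzero A (src A m) (tgt A p)"
    using m B KP p1m by simp
  then obtain p' where p': "p' \<in> arrs A" "src A p' = tgt A c" "tgt A p' = tgt A p" "p' \<cdot> c = p \<cdot> p1"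
    using coker_desc[OF c, of "p \<cdot> p1"] m B KP by auto
  have p'h: "p' \<cdot> h = p" and p'i: "p' \<cdot> i = mzero A (tgt A f) (tgt A p)"
    using cmp_reduce[OF p'(4)] p' C B KP m assms by (simp_all add: h_def i_def)
  have "is_mono A i"
  proof (rule monoI[OF i(1)])
    fix u assume u: "u \<in> arrs A" "tgt A u = src A i" "i \<cdot> u = mzero A (src A u) (tgt A i)"
    then obtain t where t: "t \<in> arrs A" "src A t = src A u" "tgt A t = src A m" "m \<cdot> t = i2 \<cdot> u"
      using ker_lift[OF mc, of "i2 \<cdot> u"] B i C m by (auto simp: i_def)
    have "k \<cdot> t = p1 \<cdot> (m \<cdot> t)"
      by (rule cmp_expand_left[OF p1m]) (use t m B in simp_all)
    also have "\<dots> = mzero A (src A u) (tgt A k)" unfolding t(4) using u i B biproduct_cmp[OF b] by simp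
    finally have "t = mzero A (src A u) (src A m)" using mono_zero[OF KP(5) t(1)] t m by simp
    then have "i2 \<cdot> u = mzero A (src A u) S" unfolding t(4)[symmetric] using m u(1) by simp
    then have "p2 \<cdot> (i2 \<cdot> u) = mzero A (src A u) (tgt A f)" using B u by simp
    then show "u = mzero A (src A u) (src A i)" using biproduct_cmp[OF b u(1)] u i by simp
  qed
  moreover have "is_coker A p' i"
  proof (rule is_cokerI)
    show "is_epi A p'"
    proof (rule epiI[OF p'(1)])
      fix u assume u: "u \<in> arrs A" "src A u = tgt A p'" "u \<cdot> p' = mzero A (src A p') (tgt A u)"
      have "u \<cdot> p = (u \<cdot> p') \<cdot> h"
        by (rule cmp_expand_right[OF p'h]) (use u p' h in simp_all)
      also have "\<dots> = mzero A (src A p) (tgt A u)" unfolding u(3) using u p' h KP by simp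
      finally show "u = mzero A (tgt A p') (tgt A u)" using epi_zero[OF KP(6) u(1)] u p' by simp
    qed
    fix t assume t: "t \<in> arrs A" "src A t = tgt A i" "t \<cdot> i = mzero A (src A i) (tgt A t)"
    have "(t \<cdot> h) \<cdot> k = mzero A (src A k) (tgt A t)"
      using t h i KP assms hk cmp_reduce[OF t(3)] by simp
    then obtain u where u: "u \<in> arrs A" "src A u = tgt A p" "tgt A u = tgt A t" "u \<cdot> p = t \<cdot> h"
      using coker_desc[OF short_exactD(2)[OF assms(1)], of "t \<cdot> h"] t h i by auto
    have "(u \<cdot> p') \<cdot> c = t \<cdot> c"
    proof (rule biproduct_eq_out[OF b])
      have "((u \<cdot> p') \<cdot> c) \<cdot> i1 = u \<cdot> (p' \<cdot> h)"
        using u(1-3) p'(1-3) C(1,3) B m by (simp add: h_def)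
      also have "\<dots> = (t \<cdot> c) \<cdot> i1"
        unfolding p'h u(4) using C(1,3) B m i t(1,2) by (simp add: h_def)
      finally show "((u \<cdot> p') \<cdot> c) \<cdot> i1 = (t \<cdot> c) \<cdot> i1" .
      have "((u \<cdot> p') \<cdot> c) \<cdot> i2 = u \<cdot> (p' \<cdot> i)"
        using u(1-3) p'(1-3) C(1,3) B m by (simp add: i_def)
      also have "\<dots> = t \<cdot> i"
        unfolding p'i t(3) using u(1-3) i assms by simp
      also have "\<dots> = (t \<cdot> c) \<cdot> i2"
        using C(1,3) B m i t(1,2) by (simp add: i_def)
      finally show "((u \<cdot> p') \<cdot> c) \<cdot> i2 = (t \<cdot> c) \<cdot> i2" .
    qed (use u(1-3) p'(1-3) C t i m in auto)
    then have "u \<cdot> p' = t"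
      by (rule epi_cancel[OF coker_epi[OF c], rotated -1]) (use u p' t i in auto)
    then show "\<exists>u. u \<in> arrs A \<and> src A u = tgt A p' \<and> tgt A u = tgt A t \<and> u \<cdot> p' = t"
      using u p' by auto
  qed (use i p' p'i in auto)
  ultimately have "short_exact A i p'"
    using mono_is_ker_coker by (simp add: short_exact_def)
  then show thesis by (rule that) (use i h p' hk p'h in auto)
qed

text \<open>The difference \<open>w\<close> vanishes on \<open>i\<close>, so
  \<open>w = x \<cdot> p'\<close>; it also vanishes on \<open>h\<close>, so
  \<open>x \<cdot> p = x \<cdot> p' \<cdot> h = 0\<close>, and \<open>x = 0\<close> because
  \<open>p\<close> is epi.\<close>

lemma pushout_joint_epi:
  assumes "short_exact A k p" "short_exact A i p'" "h \<in> arrs A" "src A h = tgt A k"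
    "tgt A h = tgt A i" "p' \<cdot> h = p"
    "u \<in> arrs A" "v \<in> arrs A" "src A u = tgt A i" "src A v = tgt A i" "tgt A u = tgt A v"
    "u \<cdot> h = v \<cdot> h" "u \<cdot> i = v \<cdot> i"
  shows "u = v"
proof -
  note P = short_exact_arr[OF assms(1)] short_exact_mono_epi[OF assms(1)]
  note P' = short_exact_arr[OF assms(2)] short_exact_mono_epi[OF assms(2)]
  define w where "w = madd A u (mneg A v)"
  have w: "w \<in> arrs A" "src A w = tgt A i" "tgt A w = tgt A v" using assms by (simp_all add: w_def)
  have wi: "w \<cdot> i = mzero A (src A i) (tgt A w)" and wh: "w \<cdot> h = mzero A (tgt A k) (tgt A w)"
    unfolding w(3) using assms(3-5,7-13) P' by (simp_all add: w_def)
  obtain x where x: "x \<in> arrs A" "src A x = tgt A p'" "tgt A x = tgt A w" "x \<cdot> p' = w"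
    using coker_desc[OF short_exactD(2)[OF assms(2)] w(1,2) wi] by metis
  have pp: "tgt A p' = tgt A p" using assms P' by auto
  have "x \<cdot> p = (x \<cdot> p') \<cdot> h"
    by (rule cmp_expand_right[OF assms(6)]) (use x P' assms(3-5) in simp_all)
  then have "x \<cdot> p = w \<cdot> h" using x(4) by simp
  then have "x = mzero A (tgt A p) (tgt A w)" using epi_zero[OF P(6) x(1)] x P pp wh by simp
  then have "w = mzero A (tgt A i) (tgt A v)" using x w P' P pp assms(8) by auto
  then show ?thesis using assms(7-11) w_def eq_iff_diff[of u v] by simp
qed

text \<open>Any morphism of short exact sequences that is the identity on the right is a pushout
  square. The map \<open>e = (h, i)\<close> from the biproduct is epi by
  \<open>pushout_joint_epi\<close>, hence the cokernel of its kernel \<open>c\<close>, and it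
  suffices that \<open>t = (b, a)\<close> kills \<open>c\<close>.\<close>

lemma pushout_univ:
  assumes "short_exact A k p" "short_exact A i p'" "h \<in> arrs A" "src A h = tgt A k"
    "tgt A h = tgt A i" "p' \<cdot> h = p" "f \<in> arrs A" "src A f = src A k" "tgt A f = src A i"
    "h \<cdot> k = i \<cdot> f"
    "b \<in> arrs A" "src A b = tgt A k" "a \<in> arrs A" "src A a = src A i" "tgt A b = tgt A a"
    "b \<cdot> k = a \<cdot> f"
  obtains u where "u \<in> arrs A" "src A u = tgt A i" "tgt A u = tgt A a" "u \<cdot> h = b" "u \<cdot> i = a"
proof -
  note P = short_exact_arr[OF assms(1)] short_exact_mono_epi[OF assms(1)]
  note P' = short_exact_arr[OF assms(2)] short_exact_mono_epi[OF assms(2)]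
  obtain S i1 i2 p1 p2 where bp: "is_biproduct A (tgt A k) (src A i) S i1 i2 p1 p2"
    using ex_biproduct P P' assms by (meson arr_objs)
  note B = biproductD[OF bp]
  define e where "e = madd A (h \<cdot> p1) (i \<cdot> p2)"
  define t where "t = madd A (b \<cdot> p1) (a \<cdot> p2)"
  have e: "e \<in> arrs A" "src A e = S" "tgt A e = tgt A i" "e \<cdot> i1 = h" "e \<cdot> i2 = i"
    using B P P' assms by (simp_all add: e_def)
  have t: "t \<in> arrs A" "src A t = S" "tgt A t = tgt A a" "t \<cdot> i1 = b" "t \<cdot> i2 = a"
    using B P P' assms by (simp_all add: t_def)
  have "is_epi A e"
  proof (rule epiI[OF e(1)])
    fix v assume v: "v \<in> arrs A" "src A v = tgt A e" "v \<cdot> e = mzero A (src A e) (tgt A v)"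
    have "v \<cdot> h = (v \<cdot> e) \<cdot> i1"
      by (rule cmp_expand_right[OF e(4)]) (use v e B in simp_all)
    moreover have "v \<cdot> i = (v \<cdot> e) \<cdot> i2"
      by (rule cmp_expand_right[OF e(5)]) (use v e B in simp_all)
    ultimately have vhi: "v \<cdot> h = mzero A (tgt A k) (tgt A v)" "v \<cdot> i = mzero A (src A i) (tgt A v)"
      unfolding v(3) using v e B by simp_all
    show "v = mzero A (tgt A e) (tgt A v)"
      by (rule pushout_joint_epi[OF assms(1-6)]) (use v e vhi P P' assms(3-5) in simp_all)
  qed
  moreover obtain c where c: "is_ker A c e" using ex_ker e by blast
  ultimately have ec: "is_coker A e c" by (rule epi_is_coker_ker)
  note C = kerD[OF c]
  define x where "x = p1 \<cdot> c"
  define y where "y = p2 \<cdot> c"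
  have x: "x \<in> arrs A" "src A x = src A c" "tgt A x = tgt A k"
    and y: "y \<in> arrs A" "src A y = src A c" "tgt A y = src A i"
    using C e B by (simp_all add: x_def y_def)
  have "e \<cdot> c = madd A (h \<cdot> x) (i \<cdot> y)"
    using C e(2) B P P' assms(3-5) by (simp add: e_def x_def y_def)
  then have hx: "madd A (h \<cdot> x) (i \<cdot> y) = mzero A (src A c) (tgt A i)" using C e by simp
  have tp: "tgt A p' = tgt A p" using assms(3,5,6) P' by auto
  have "p' \<cdot> (h \<cdot> x) = p \<cdot> x"
    by (rule cmp_reduce[OF assms(6)]) (use x P' assms(3-5) in simp_all)
  moreover have "p' \<cdot> (i \<cdot> y) = mzero A (src A i) (tgt A p') \<cdot> y"
    by (rule cmp_reduce[OF P'(4)]) (use y P' in simp_all)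
  ultimately have "p' \<cdot> madd A (h \<cdot> x) (i \<cdot> y) = p \<cdot> x"
    using x y P P'(1-3) assms(3-5) tp by simp
  \<comment> \<open>With components \<open>x\<close> and \<open>y\<close> of \<open>c\<close>,
    exactness gives \<open>x = k \<cdot> s\<close>, and cancelling \<open>i\<close> gives
    \<open>y = - f \<cdot> s\<close>; then \<open>b \<cdot> k = a \<cdot> f\<close> yields
    \<open>t \<cdot> c = 0\<close>.\<close>
  then have "p \<cdot> x = mzero A (src A x) (tgt A p)"
    unfolding hx using x P P'(1-3) C tp by simp
  then obtain s where s: "s \<in> arrs A" "src A s = src A x" "tgt A s = src A k" "k \<cdot> s = x"
    using ker_lift[OF short_exactD(1)[OF assms(1)], of x] x P by auto
  have "h \<cdot> x = (h \<cdot> k) \<cdot> s" using s(1,3) s(4)[symmetric] P assms(3,4) by simp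
  then have "h \<cdot> x = i \<cdot> (f \<cdot> s)" using s(1-3) x P P' assms(7-10) by simp
  then have "i \<cdot> madd A (f \<cdot> s) y = mzero A (src A c) (tgt A i)"
    using hx x y s P P' assms(7-9) by simp
  then have "madd A (f \<cdot> s) y = mzero A (src A c) (src A i)"
    using mono_zero[OF P'(5), of "madd A (f \<cdot> s) y"] x y s assms(7-9) by simp
  then have "a \<cdot> madd A (f \<cdot> s) y = mzero A (src A c) (tgt A a)"
    using assms(13,14) x y C by simp
  moreover have "t \<cdot> c = madd A (b \<cdot> x) (a \<cdot> y)"
    using C e(2) B P P' assms(11-15) by (simp add: t_def x_def y_def)
  moreover have "b \<cdot> x = (b \<cdot> k) \<cdot> s" using s(1,3) s(4)[symmetric] P assms(11,12) by simp
  then have "b \<cdot> x = a \<cdot> (f \<cdot> s)" using s(1-3) x P P' assms(7-9,11-16) by simp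
  ultimately have "t \<cdot> c = mzero A (src A c) (tgt A t)"
    using assms(7-9,11-15) x y s t by simp
  then obtain u where u: "u \<in> arrs A" "src A u = tgt A e" "tgt A u = tgt A t" "u \<cdot> e = t"
    using coker_desc[OF ec, of t] t e C by auto
  have "u \<cdot> h = b" "u \<cdot> i = a"
    using u e t B cmp_reduce[OF u(4)] by (metis assoc)+
  then show thesis using that[of u] u t e by simp
qed

text \<open>Dually, the pullback is the kernel \<open>c\<close> of \<open>e = (p, -g)\<close>. Since
  \<open>p\<close> is epi, so is \<open>e\<close>, and \<open>e\<close> is the cokernel of
  \<open>c\<close>; this is what makes \<open>p'\<close> epi.\<close>

lemma pullback_exists:
  assumes "short_exact A k p" "g \<in> arrs A" "tgt A g = tgt A p"
  obtains i p' h where "short_exact A i p'" "src A i = src A k" "tgt A p' = src A g"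
    "h \<in> arrs A" "src A h = tgt A i" "tgt A h = tgt A k" "h \<cdot> i = k" "p \<cdot> h = g \<cdot> p'"
proof -
  note P = short_exact_arr[OF assms(1)] short_exact_mono_epi[OF assms(1)]
  obtain S i1 i2 p1 p2 where b: "is_biproduct A (tgt A k) (src A g) S i1 i2 p1 p2"
    using ex_biproduct P assms by (meson arr_objs)
  note B = biproductD[OF b]
  define e where "e = madd A (p \<cdot> p1) (mneg A (g \<cdot> p2))"
  have e: "e \<in> arrs A" "src A e = S" "tgt A e = tgt A p" "e \<cdot> i1 = p"
    using B P assms by (simp_all add: e_def)
  have "is_epi A e"
  proof (rule epiI[OF e(1)])
    fix v assume v: "v \<in> arrs A" "src A v = tgt A e" "v \<cdot> e = mzero A (src A e) (tgt A v)"
    have "v \<cdot> p = (v \<cdot> e) \<cdot> i1"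
      by (rule cmp_expand_right[OF e(4)]) (use v e B in simp_all)
    also have "\<dots> = mzero A (src A p) (tgt A v)" unfolding v(3) using v e B P by simp
    finally show "v = mzero A (tgt A e) (tgt A v)" using epi_zero[OF P(6) v(1)] v e by simp
  qed
  moreover obtain c where c: "is_ker A c e" using ex_ker e by blast
  ultimately have ec: "is_coker A e c" by (rule epi_is_coker_ker)
  note C = kerD[OF c]
  have tc: "tgt A c = S" using C e by simp
  define p' where "p' = p2 \<cdot> c"
  define h where "h = p1 \<cdot> c"
  have h: "h \<in> arrs A" "src A h = src A c" "tgt A h = tgt A k"
    and p': "p' \<in> arrs A" "src A p' = src A c" "tgt A p' = src A g"
    using C tc B by (simp_all add: h_def p'_def)
  have "madd A (p \<cdot> h) (mneg A (g \<cdot> p')) = e \<cdot> c"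
    using B C tc P assms by (simp add: e_def h_def p'_def)
  then have ph: "p \<cdot> h = g \<cdot> p'"
    using C e h p' P assms by (subst eq_iff_diff) simp_all
  have "e \<cdot> (i1 \<cdot> k) = mzero A (src A (i1 \<cdot> k)) (tgt A e)"
    using e B P cmp_reduce[OF e(4)] by simp
  then obtain i where i: "i \<in> arrs A" "src A i = src A k" "tgt A i = src A c" "c \<cdot> i = i1 \<cdot> k"
    using ker_lift[OF c, of "i1 \<cdot> k"] e B P by auto
  have hi: "h \<cdot> i = k" and p'i: "p' \<cdot> i = mzero A (src A i) (tgt A p')"
    using i C tc B P biproduct_cmp[OF b] by (simp_all add: h_def p'_def)
  have "is_epi A p'"
  proof (rule epiI[OF p'(1)])
    fix u assume u: "u \<in> arrs A" "src A u = tgt A p'" "u \<cdot> p' = mzero A (src A p') (tgt A u)"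
    then obtain t where t: "t \<in> arrs A" "src A t = tgt A e" "tgt A t = tgt A u" "t \<cdot> e = u \<cdot> p2"
      using coker_desc[OF ec, of "u \<cdot> p2"] p' C tc B by (auto simp: p'_def)
    have "t \<cdot> p = (t \<cdot> e) \<cdot> i1"
      by (rule cmp_expand_right[OF e(4)]) (use t e B in simp_all)
    also have "\<dots> = mzero A (src A p) (tgt A u)" unfolding t(4) using u B P p' by simp
    finally have "t = mzero A (tgt A p) (tgt A u)" using epi_zero[OF P(6) t(1)] t e by simp
    then have "u \<cdot> p2 = mzero A S (tgt A u)" unfolding t(4)[symmetric] using e u(1) by simp
    then have "(u \<cdot> p2) \<cdot> i2 = mzero A (src A g) (tgt A u)" using B u p' by simp
    then show "u = mzero A (tgt A p') (tgt A u)" using B u p' by simp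
  qed
  moreover have "is_ker A i p'"
  proof (rule is_kerI)
    show "is_mono A i"
    proof (rule monoI[OF i(1)])
      fix u assume u: "u \<in> arrs A" "tgt A u = src A i" "i \<cdot> u = mzero A (src A u) (tgt A i)"
      have "k \<cdot> u = h \<cdot> (i \<cdot> u)"
        by (rule cmp_expand_left[OF hi]) (use u h i in simp_all)
      also have "\<dots> = mzero A (src A u) (tgt A k)" unfolding u(3) using u i h by simp
      finally show "u = mzero A (src A u) (src A i)" using mono_zero[OF P(5) u(1)] u i by simp
    qed
    fix t assume t: "t \<in> arrs A" "tgt A t = src A p'" "p' \<cdot> t = mzero A (src A t) (tgt A p')"
    have "p \<cdot> (h \<cdot> t) = mzero A (src A t) (tgt A p)"
      using t h p' P assms cmp_reduce[OF ph] by simp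
    then obtain u where u: "u \<in> arrs A" "src A u = src A t" "tgt A u = src A k" "k \<cdot> u = h \<cdot> t"
      using ker_lift[OF short_exactD(1)[OF assms(1)], of "h \<cdot> t"] t h p' P by auto
    have "c \<cdot> (i \<cdot> u) = c \<cdot> t"
    proof (rule biproduct_eq_in[OF b])
      have "p1 \<cdot> (c \<cdot> (i \<cdot> u)) = h \<cdot> (i \<cdot> u)"
        using u(1-3) i(1-3) C tc B by (simp add: h_def)
      also have "\<dots> = k \<cdot> u" by (rule cmp_reduce[OF hi]) (use u(1-3) i(1-3) h in simp_all)
      also have "\<dots> = p1 \<cdot> (c \<cdot> t)"
        unfolding u(4) using t p' C tc B by (simp add: h_def)
      finally show "p1 \<cdot> (c \<cdot> (i \<cdot> u)) = p1 \<cdot> (c \<cdot> t)" .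
      have "p2 \<cdot> (c \<cdot> (i \<cdot> u)) = (p' \<cdot> i) \<cdot> u" "p2 \<cdot> (c \<cdot> t) = p' \<cdot> t"
        using u(1-3) t(1,2) p' i(1-3) C tc B by (simp_all add: p'_def)
      then show "p2 \<cdot> (c \<cdot> (i \<cdot> u)) = p2 \<cdot> (c \<cdot> t)"
        using p'i t i u p' assms(2) by simp
    qed (use C tc u i t p' in simp_all)
    then have "i \<cdot> u = t"
      by (rule mono_cancel[OF ker_mono[OF c], rotated -1]) (use u i t p' in simp_all)
    then show "\<exists>u. u \<in> arrs A \<and> src A u = src A t \<and> tgt A u = src A i \<and> i \<cdot> u = t"
      using u i by auto
  qed (use p' i p'i in simp_all)
  ultimately have "short_exact A i p'"
    using epi_is_coker_ker by (simp add: short_exact_def)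
  then show thesis by (rule that) (use i h p' hi ph in simp_all)
qed

end

section \<open>Extensions\<close>

lemma (in comm_group) coset_eq_iff:
  assumes "subgroup H G" "x \<in> carrier G" "y \<in> carrier G"
  shows "H #> x = H #> y \<longleftrightarrow> x \<otimes> inv y \<in> H"
proof
  assume "H #> x = H #> y"
  then have "x \<in> H #> y" using rcos_self[OF assms(2,1)] by simp
  then show "x \<otimes> inv y \<in> H"
    using assms by (auto simp: r_coset_def m_assoc subgroup.mem_carrier)
next
  assume *: "x \<otimes> inv y \<in> H"
  have "x = (x \<otimes> inv y) \<otimes> y" using assms by (simp add: m_assoc)
  then have "x \<in> H #> y" using * unfolding r_coset_def by blast
  then show "H #> x = H #> y" using repr_independence[OF _ assms(3,1)] by simp
qed

context abelian_category
begin

lemma idm_iso [simp]: "X \<in> objs A \<Longrightarrow> is_iso A (idm A X)"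
  by (auto simp: is_iso_def intro!: bexI[of _ "idm A X"])

text \<open>Vanishing of \<open>Ext1\<close> in the form of a lifting property: the pullback of the
  extension along \<open>a\<close> splits, and its section followed by the projection
  \<open>h\<close> is the lift. This is the form in which the right orthogonal is used
  throughout.\<close>

lemma ext_lift:
  assumes "K \<in> right_perp A W" "V \<in> W" "short_exact A k p" "src A k = K"
    "a \<in> arrs A" "src A a = V" "tgt A a = tgt A p"
  obtains t where "t \<in> arrs A" "src A t = V" "tgt A t = tgt A k" "p \<cdot> t = a"
proof -
  note P = short_exact_arr[OF assms(3)]
  obtain i q h where ih: "short_exact A i q" "src A i = src A k" "tgt A q = src A a"
    "h \<in> arrs A" "src A h = tgt A i" "tgt A h = tgt A k" "h \<cdot> i = k" "p \<cdot> h = a \<cdot> q"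
    using pullback_exists[OF assms(3,5,7)] .
  note Q = short_exact_arr[OF ih(1)]
  have ext: "(i, q) \<in> extensions A V K" using ih assms by (simp add: extensions_def)
  have "q \<cdot> idm A (tgt A i) = q" "idm A (tgt A i) \<cdot> i = i" "is_iso A (idm A (tgt A i))"
    using Q by simp_all
  then have "((i, q), (i, q)) \<in> ext_equiv A V K"
    using ext Q unfolding ext_equiv_def by (auto intro!: bexI[of _ "idm A (tgt A i)"])
  moreover have "ext_equiv A V K `` {(i, q)} \<in> Ext1 A V K"
    using ext unfolding Ext1_def by (rule quotientI)
  moreover have "Ext1 A V K = {split_class A V K}"
    using assms(1,2) by (simp add: right_perp_def)
  ultimately have "(i, q) \<in> split_class A V K" by auto
  then obtain s where s: "s \<in> arrs A" "src A s = V" "tgt A s = src A q" "q \<cdot> s = idm A V"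
    by (auto simp: split_class_def)
  have "p \<cdot> (h \<cdot> s) = a \<cdot> (q \<cdot> s)"
    using s(1-3) Q(1-3) ih(3-6) P assms(5-7) cmp_reduce[OF ih(8)] by simp
  then have "p \<cdot> (h \<cdot> s) = a" using s(4) assms(5,6) by simp
  then show thesis using that[of "h \<cdot> s"] s ih Q by simp
qed

lemma ext_push_iff:
  "(i, q) \<in> ext_push A (k, p) f \<longleftrightarrow> short_exact A i q \<and> src A i = tgt A f \<and> tgt A q = tgt A p \<and>
     (\<exists>h. h \<in> arrs A \<and> src A h = src A p \<and> tgt A h = src A q \<and> h \<cdot> k = i \<cdot> f \<and> q \<cdot> h = p)"
  by (auto simp: ext_push_def extensions_def)

lemma ext_pull_iff:
  "(i, q) \<in> ext_pull A (k, p) g \<longleftrightarrow> short_exact A i q \<and> src A i = src A k \<and> tgt A q = src A g \<and>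
     (\<exists>h. h \<in> arrs A \<and> src A h = src A q \<and> tgt A h = src A p \<and> h \<cdot> i = k \<and> p \<cdot> h = g \<cdot> q)"
  by (auto simp: ext_pull_def extensions_def)

lemma push_equiv:
  assumes "short_exact A k p" "f \<in> arrs A" "src A f = src A k"
    "(i, q) \<in> ext_push A (k, p) f" "(i', q') \<in> ext_push A (k, p) f"
  obtains u where "u \<in> arrs A" "src A u = tgt A i" "tgt A u = tgt A i'" "u \<cdot> i = i'" "q' \<cdot> u = q"
proof -
  note P = short_exact_arr[OF assms(1)]
  obtain h where h: "short_exact A i q" "src A i = tgt A f" "tgt A q = tgt A p"
    "h \<in> arrs A" "src A h = tgt A k" "tgt A h = src A q" "h \<cdot> k = i \<cdot> f" "q \<cdot> h = p"
    using assms(4) P unfolding ext_push_iff by auto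
  obtain h' where h': "short_exact A i' q'" "src A i' = tgt A f" "tgt A q' = tgt A p"
    "h' \<in> arrs A" "src A h' = tgt A k" "tgt A h' = src A q'" "h' \<cdot> k = i' \<cdot> f" "q' \<cdot> h' = p"
    using assms(5) P unfolding ext_push_iff by auto
  note Q = short_exact_arr[OF h(1)] and Q' = short_exact_arr[OF h'(1)]
  obtain u where u: "u \<in> arrs A" "src A u = tgt A i" "tgt A u = tgt A i'" "u \<cdot> h = h'" "u \<cdot> i = i'"
    by (rule pushout_univ[OF assms(1) h(1,4,5) _ h(8) assms(2,3) _ h(7), of h' i'])
      (use h h' Q Q' in simp_all)
  have "q' \<cdot> u = q"
  proof (rule pushout_joint_epi[OF assms(1) h(1,4,5) _ h(8)])
    show "(q' \<cdot> u) \<cdot> h = q \<cdot> h" using u h h' Q Q' by simp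
    show "(q' \<cdot> u) \<cdot> i = q \<cdot> i" using u h h' Q Q' by simp
  qed (use u h h' Q Q' in simp_all)
  then show thesis using that u by blast
qed

text \<open>A mono \<open>u\<close> is the kernel of some \<open>g\<close>; if \<open>u\<close> is
  also epi then \<open>g = 0\<close>, so the identity lifts along \<open>u\<close> and yields the
  inverse.\<close>

lemma mono_epi_iso:
  assumes "is_mono A u" "is_epi A u"
  shows "is_iso A u"
proof -
  have u: "u \<in> arrs A" using assms by (simp add: is_mono_def)
  obtain g where g: "is_ker A u g" using mono_is_ker assms(1) by blast
  note G = kerD[OF g]
  have "g = mzero A (tgt A u) (tgt A g)" using epi_zero[OF assms(2) G(2,3,4)] .
  then have "g \<cdot> idm A (tgt A u) = mzero A (tgt A u) (tgt A g)" using G u by simp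
  then obtain s where s: "s \<in> arrs A" "src A s = tgt A u" "tgt A s = src A u" "u \<cdot> s = idm A (tgt A u)"
    using ker_lift[OF g, of "idm A (tgt A u)"] G u by auto
  have "u \<cdot> (s \<cdot> u) = u \<cdot> idm A (src A u)"
    using s u cmp_reduce[OF s(4)] by simp
  then have "s \<cdot> u = idm A (src A u)"
    by (rule mono_cancel[OF assms(1), rotated -1]) (use s u in simp_all)
  then show ?thesis using s u by (auto simp: is_iso_def intro!: bexI[of _ s])
qed

text \<open>The short five lemma with identities at both ends. It is needed because
  \<open>ext_equiv\<close> asks for an isomorphism of the middle terms, whereas universal properties
  only deliver a morphism.\<close>

lemma extension_morphism_iso:
  assumes "short_exact A i q" "short_exact A i' q'" "u \<in> arrs A" "src A u = tgt A i"
    "tgt A u = tgt A i'" "u \<cdot> i = i'" "q' \<cdot> u = q"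
  shows "is_iso A u"
proof (rule mono_epi_iso)
  note Q = short_exact_arr[OF assms(1)] short_exact_mono_epi[OF assms(1)]
  note Q' = short_exact_arr[OF assms(2)] short_exact_mono_epi[OF assms(2)]
  have si: "src A i' = src A i" "tgt A q' = tgt A q" using assms(3-7) Q Q' by auto
  show "is_mono A u"
  proof (rule monoI[OF assms(3)])
    fix z assume z: "z \<in> arrs A" "tgt A z = src A u" "u \<cdot> z = mzero A (src A z) (tgt A u)"
    have "q \<cdot> z = q' \<cdot> (u \<cdot> z)"
      by (rule cmp_expand_left[OF assms(7)]) (use z Q' assms(3-5) in simp_all)
    then have "q \<cdot> z = mzero A (src A z) (tgt A q)" using z Q' si assms(3-5) by simp
    then obtain s where s: "s \<in> arrs A" "src A s = src A z" "tgt A s = src A i" "i \<cdot> s = z"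
      using ker_lift[OF short_exactD(1)[OF assms(1)], of z] z assms(4) Q by auto
    have "i' \<cdot> s = u \<cdot> (i \<cdot> s)"
      by (rule cmp_expand_left[OF assms(6)]) (use s Q assms(3-5) in simp_all)
    then have "i' \<cdot> s = mzero A (src A s) (tgt A i')" using s z assms(5) by simp
    then have "s = mzero A (src A s) (src A i)" using mono_zero[OF Q'(5) s(1)] s si by simp
    then have "i \<cdot> s = i \<cdot> mzero A (src A s) (src A i)" by simp
    then show "z = mzero A (src A z) (src A u)" using s Q z assms(4) by simp
  qed
  show "is_epi A u"
  proof (rule epiI[OF assms(3)])
    fix z assume z: "z \<in> arrs A" "src A z = tgt A u" "z \<cdot> u = mzero A (src A u) (tgt A z)"
    have "z \<cdot> i' = (z \<cdot> u) \<cdot> i"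
      by (rule cmp_expand_right[OF assms(6)]) (use z Q assms(3-5) in simp_all)
    then have "z \<cdot> i' = mzero A (src A i') (tgt A z)" using z Q si assms(3-5) by simp
    then obtain s where s: "s \<in> arrs A" "src A s = tgt A q'" "tgt A s = tgt A z" "s \<cdot> q' = z"
      using coker_desc[OF short_exactD(2)[OF assms(2)], of z] z assms(5) Q' by auto
    have "s \<cdot> q = (s \<cdot> q') \<cdot> u"
      by (rule cmp_expand_right[OF assms(7)]) (use s Q' assms(3-5) in simp_all)
    then have "s \<cdot> q = mzero A (src A q) (tgt A s)" using s z Q assms(4) by simp
    then have "s = mzero A (tgt A q) (tgt A s)" using epi_zero[OF Q(6) s(1)] s si by simp
    then have "s \<cdot> q' = mzero A (tgt A q) (tgt A s) \<cdot> q'" by simp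
    then show "z = mzero A (tgt A u) (tgt A z)" using s Q' z(1,2) assms(5) si by simp
  qed
qed

lemma ext_push_eq_class:
  assumes "short_exact A k p" "f \<in> arrs A" "src A f = src A k" "(i, q) \<in> ext_push A (k, p) f"
  shows "ext_push A (k, p) f = ext_equiv A (tgt A p) (tgt A f) `` {(i, q)}"
proof (intro subset_antisym subsetI)
  note P = short_exact_arr[OF assms(1)]
  obtain h where h: "short_exact A i q" "src A i = tgt A f" "tgt A q = tgt A p"
    "h \<in> arrs A" "src A h = tgt A k" "tgt A h = tgt A i" "h \<cdot> k = i \<cdot> f" "q \<cdot> h = p"
    using assms(4) P unfolding ext_push_iff by (metis short_exact_arr(3))
  note Q = short_exact_arr[OF h(1)]
  {
    fix X assume X: "X \<in> ext_push A (k, p) f"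
    obtain i' q' where X_eq: "X = (i', q')" by (cases X)
    note X' = X[unfolded X_eq]
    have iq': "short_exact A i' q'" "src A i' = tgt A f" "tgt A q' = tgt A p"
      using X' unfolding ext_push_iff by auto
    obtain u where u: "u \<in> arrs A" "src A u = tgt A i" "tgt A u = tgt A i'" "u \<cdot> i = i'" "q' \<cdot> u = q"
      using push_equiv[OF assms X'] .
    have "is_iso A u" by (rule extension_morphism_iso[OF h(1) iq'(1) u])
    then show "X \<in> ext_equiv A (tgt A p) (tgt A f) `` {(i, q)}"
      using u h(1-3) iq' Q short_exact_arr[OF iq'(1)]
      by (auto simp: X_eq ext_equiv_def extensions_def)
  next
    fix X assume X: "X \<in> ext_equiv A (tgt A p) (tgt A f) `` {(i, q)}"
    obtain i' q' where X_eq: "X = (i', q')" by (cases X)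
    obtain u where u: "u \<in> arrs A" "src A u = src A q" "tgt A u = src A q'" "u \<cdot> i = i'" "q' \<cdot> u = q"
      and iq': "short_exact A i' q'" "src A i' = tgt A f" "tgt A q' = tgt A p"
      using X by (auto simp: X_eq ext_equiv_def extensions_def)
    note Q' = short_exact_arr[OF iq'(1)]
    have "(u \<cdot> h) \<cdot> k = i' \<cdot> f"
      using u h assms(2,3) P Q Q' cmp_reduce[OF u(4)] by simp
    moreover have "q' \<cdot> (u \<cdot> h) = p"
      using u h P Q Q' cmp_reduce[OF u(5)] by simp
    ultimately show "X \<in> ext_push A (k, p) f"
      unfolding X_eq ext_push_iff using iq' u h Q P by (auto intro!: exI[of _ "u \<cdot> h"])
  }
qed

text \<open>Mac Lane's rule for a morphism \<open>(f, b, g)\<close> of extensions: pushing the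
  source along \<open>f\<close> and pulling the target back along \<open>g\<close> give the same
  class. One inclusion uses the universal property of the pushout; in the other the orthogonality
  hypothesis produces the required map.\<close>

lemma pull_eq_push:
  assumes "short_exact A k p" "short_exact A k' p'" "src A p \<in> W" "src A k' \<in> right_perp A W"
    and f: "f \<in> arrs A" "src A f = src A k" "tgt A f = src A k'"
    and b: "b \<in> arrs A" "src A b = tgt A k" "tgt A b = tgt A k'"
    and g: "g \<in> arrs A" "src A g = tgt A p" "tgt A g = tgt A p'"
    and bk: "b \<cdot> k = k' \<cdot> f" and pb: "p' \<cdot> b = g \<cdot> p"
  shows "ext_pull A (k', p') g = ext_push A (k, p) f"
proof (intro subset_antisym subsetI)
  note P = short_exact_arr[OF assms(1)] and P' = short_exact_arr[OF assms(2)]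
  note mono' = short_exact_mono_epi(1)[OF assms(2)]
  {
    fix X assume X: "X \<in> ext_pull A (k', p') g"
    obtain i q where X_eq: "X = (i, q)" by (cases X)
    obtain h where h: "short_exact A i q" "src A i = src A k'" "tgt A q = src A g"
      "h \<in> arrs A" "src A h = tgt A i" "tgt A h = tgt A k'" "h \<cdot> i = k'" "p' \<cdot> h = g \<cdot> q"
      using X P' unfolding X_eq ext_pull_iff by (metis short_exact_arr(3))
    note Q = short_exact_arr[OF h(1)]
    \<comment> \<open>A lift \<open>t\<close> of \<open>p\<close> exists by orthogonality, but
      \<open>h \<cdot> t\<close> agrees with \<open>b\<close> only up to a map
      \<open>k' \<cdot> r\<close>; subtracting \<open>i \<cdot> r\<close> corrects this and leaves
      \<open>q \<cdot> t\<close> unchanged.\<close>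
    obtain t where t: "t \<in> arrs A" "src A t = src A p" "tgt A t = tgt A i" "q \<cdot> t = p"
      by (rule ext_lift[OF assms(4,3) h(1), of p]) (use h g P in simp_all)
    define d where "d = madd A (h \<cdot> t) (mneg A b)"
    have d: "d \<in> arrs A" "src A d = tgt A k" "tgt A d = tgt A k'"
      using t h b P by (simp_all add: d_def)
    have "p' \<cdot> (h \<cdot> t) = (g \<cdot> q) \<cdot> t" by (rule cmp_reduce[OF h(8)]) (use h t P' in simp_all)
    also have "\<dots> = p' \<cdot> b" unfolding pb using t Q h g by simp
    finally have "p' \<cdot> d = mzero A (src A d) (tgt A p')"
      using d t h b P P' g by (simp add: d_def)
    then obtain r where r: "r \<in> arrs A" "src A r = tgt A k" "tgt A r = src A k'" "k' \<cdot> r = d"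
      using ker_lift[OF short_exactD(1)[OF assms(2)], of d] d P' by auto
    define h' where "h' = madd A t (mneg A (i \<cdot> r))"
    have h': "h' \<in> arrs A" "src A h' = tgt A k" "tgt A h' = tgt A i"
      using t r h Q P by (simp_all add: h'_def)
    have qi: "q \<cdot> (i \<cdot> x) = mzero A (src A x) (tgt A q)" if "x \<in> arrs A" "tgt A x = src A i" for x
      using that Q cmp_reduce[OF Q(4)] by simp
    have qh': "q \<cdot> h' = p"
      using t r h Q P g qi[of r] by (simp add: h'_def)
    have "h \<cdot> h' = madd A (h \<cdot> t) (mneg A (k' \<cdot> r))"
      using t r h Q P cmp_reduce[OF h(7)] by (simp add: h'_def)
    also have "\<dots> = b" unfolding r(4) d_def using t h b P
      by (simp flip: madd_assoc)
    finally have hh': "h \<cdot> h' = b" .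
    \<comment> \<open>The defect \<open>w\<close> of the left square is killed by \<open>q\<close>,
      hence of the form \<open>i \<cdot> s\<close>; applying \<open>h\<close> gives
      \<open>k' \<cdot> s = 0\<close>, so \<open>s = 0\<close>.\<close>
    define w where "w = madd A (h' \<cdot> k) (mneg A (i \<cdot> f))"
    have w: "w \<in> arrs A" "src A w = src A k" "tgt A w = tgt A i"
      using h' f h Q P by (simp_all add: w_def)
    have "q \<cdot> w = madd A (q \<cdot> (h' \<cdot> k)) (mneg A (q \<cdot> (i \<cdot> f)))"
      using h'(1-3) Q P f h(2) by (simp add: w_def)
    also have "q \<cdot> (h' \<cdot> k) = p \<cdot> k" by (rule cmp_reduce[OF qh']) (use h' Q P in simp_all)
    finally have "q \<cdot> w = mzero A (src A w) (tgt A q)"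
      using w P Q f h(2,3) g qi[of f] by simp
    then obtain s where s: "s \<in> arrs A" "src A s = src A k" "tgt A s = src A i" "i \<cdot> s = w"
      using ker_lift[OF short_exactD(1)[OF h(1)], of w] w Q by auto
    have "k' \<cdot> s = h \<cdot> (i \<cdot> s)" by (rule cmp_expand_left[OF h(7)]) (use s h Q in simp_all)
    also have "\<dots> = madd A (h \<cdot> (h' \<cdot> k)) (mneg A (h \<cdot> (i \<cdot> f)))"
      unfolding s(4) using h'(1-3) Q P f h(2-6) by (simp add: w_def)
    also have "h \<cdot> (h' \<cdot> k) = b \<cdot> k" by (rule cmp_reduce[OF hh']) (use h' h(2-6) P in simp_all)
    also have "h \<cdot> (i \<cdot> f) = k' \<cdot> f" by (rule cmp_reduce[OF h(7)]) (use h Q f in simp_all)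
    finally have "k' \<cdot> s = mzero A (src A s) (tgt A k')" using bk P' f s by simp
    then have "s = mzero A (src A s) (src A k')" using mono_zero[OF mono' s(1)] s h by simp
    then have "i \<cdot> s = i \<cdot> mzero A (src A k) (src A i)" using s h by simp
    then have "w = mzero A (src A k) (tgt A i)" using s Q P by simp
    then have "h' \<cdot> k = i \<cdot> f" using h' f h Q P unfolding w_def by (subst eq_iff_diff) simp_all
    then show "X \<in> ext_push A (k, p) f"
      unfolding X_eq ext_push_iff using h h' qh' f g P Q by auto
  next
    fix X assume X: "X \<in> ext_push A (k, p) f"
    obtain i q where X_eq: "X = (i, q)" by (cases X)
    obtain h where h: "short_exact A i q" "src A i = tgt A f" "tgt A q = tgt A p"
      "h \<in> arrs A" "src A h = tgt A k" "tgt A h = tgt A i" "h \<cdot> k = i \<cdot> f" "q \<cdot> h = p"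
      using X P unfolding X_eq ext_push_iff by (metis short_exact_arr(3))
    note Q = short_exact_arr[OF h(1)]
    obtain u where u: "u \<in> arrs A" "src A u = tgt A i" "tgt A u = tgt A k'" "u \<cdot> h = b" "u \<cdot> i = k'"
      by (rule pushout_univ[OF assms(1) h(1,4-6,8) f(1,2) _ h(7) b(1,2), of k'])
        (use h f b bk P' in simp_all)
    have "p' \<cdot> u = g \<cdot> q"
    proof (rule pushout_joint_epi[OF assms(1) h(1,4-6,8)])
      show "(p' \<cdot> u) \<cdot> h = (g \<cdot> q) \<cdot> h"
        using u h g P' Q pb by simp
      show "(p' \<cdot> u) \<cdot> i = (g \<cdot> q) \<cdot> i"
        using u h g f P' Q by simp
    qed (use u h g P' Q in simp_all)
    then show "X \<in> ext_pull A (k', p') g"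
      unfolding X_eq ext_pull_iff using h u f g P' Q by auto
  }
qed

end

section \<open>Stable morphisms and the transition maps\<close>

locale additive_subcategory_of = abelian_category +
  fixes W :: "'a set"
  assumes additive: "additive_subcategory A W"
begin

lemma W_objs: "V \<in> W \<Longrightarrow> V \<in> objs A"
  using additive unfolding additive_subcategory_def by blast

lemma Hom_group_inv [simp]: "f \<in> Hom A X Y \<Longrightarrow> inv\<^bsub>Hom_group A X Y\<^esub> f = mneg A f"
  by (simp add: mneg_def)

lemma factoringE:
  assumes "f \<in> factoring A W X Y"
  obtains V a b where "V \<in> W" "a \<in> arrs A" "src A a = X" "tgt A a = V"
    "b \<in> arrs A" "src A b = V" "tgt A b = Y" "f = b \<cdot> a"
  using assms by (auto simp: factoring_def)

lemma factoringI:
  assumes "tgt A a \<in> W" "a \<in> arrs A" "b \<in> arrs A" "src A b = tgt A a"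
  shows "b \<cdot> a \<in> factoring A W (src A a) (tgt A b)"
proof -
  have "a \<in> Hom A (src A a) (tgt A a)" "b \<in> Hom A (tgt A a) (tgt A b)" using assms by simp_all
  then show ?thesis using assms(1) unfolding factoring_def by blast
qed

lemma factoring_arr: "f \<in> factoring A W X Y \<Longrightarrow> f \<in> arrs A \<and> src A f = X \<and> tgt A f = Y"
  by (auto elim!: factoringE)

lemma zero_factoring:
  assumes "X \<in> objs A" "Y \<in> objs A"
  shows "mzero A X Y \<in> factoring A W X Y"
proof -
  obtain Z where Z: "is_zero_obj A Z" using ex_zero_obj by blast
  then have "Z \<in> W" using additive unfolding additive_subcategory_def by blast
  moreover have "mzero A X Y = mzero A Z Y \<cdot> mzero A X Z" using assms Z by (simp add: is_zero_obj_def)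
  ultimately show ?thesis
    using factoringI[of "mzero A X Z" "mzero A Z Y"] assms Z by (simp add: is_zero_obj_def)
qed

text \<open>The sum \<open>b \<cdot> a + b' \<cdot> a'\<close> factors through the biproduct of the
  two middle objects, which again lies in \<open>W\<close>.\<close>

lemma madd_factoring:
  assumes "f \<in> factoring A W X Y" "g \<in> factoring A W X Y"
  shows "madd A f g \<in> factoring A W X Y"
proof -
  obtain V a b where f: "V \<in> W" "a \<in> arrs A" "src A a = X" "tgt A a = V"
    "b \<in> arrs A" "src A b = V" "tgt A b = Y" "f = b \<cdot> a" using factoringE[OF assms(1)] .
  obtain V' a' b' where g: "V' \<in> W" "a' \<in> arrs A" "src A a' = X" "tgt A a' = V'"
    "b' \<in> arrs A" "src A b' = V'" "tgt A b' = Y" "g = b' \<cdot> a'" using factoringE[OF assms(2)] .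
  obtain S i j p q where S: "is_biproduct A V V' S i j p q"
    using ex_biproduct W_objs f(1) g(1) by blast
  note B = biproductD[OF S]
  have SW: "S \<in> W" using additive S f(1) g(1) unfolding additive_subcategory_def by blast
  define c where "c = madd A (i \<cdot> a) (j \<cdot> a')"
  define d where "d = madd A (b \<cdot> p) (b' \<cdot> q)"
  have c: "c \<in> arrs A" "src A c = X" "tgt A c = S" using B f g by (simp_all add: c_def)
  have d: "d \<in> arrs A" "src A d = S" "tgt A d = Y" using B f g by (simp_all add: d_def)
  have pc: "p \<cdot> c = a" and qc: "q \<cdot> c = a'"
    using B f g biproduct_cmp[OF S] by (simp_all add: c_def)
  have "d \<cdot> c = madd A (b \<cdot> (p \<cdot> c)) (b' \<cdot> (q \<cdot> c))"
    using B(1-15) f g c by (simp add: d_def)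
  then have "madd A f g = d \<cdot> c" unfolding pc qc using f g by simp
  then show ?thesis using factoringI[of c d] c d SW by simp
qed

lemma mneg_factoring:
  assumes "f \<in> factoring A W X Y"
  shows "mneg A f \<in> factoring A W X Y"
proof -
  obtain V a b where f: "V \<in> W" "a \<in> arrs A" "src A a = X" "tgt A a = V"
    "b \<in> arrs A" "src A b = V" "tgt A b = Y" "f = b \<cdot> a" using factoringE[OF assms] .
  then show ?thesis using factoringI[of a "mneg A b"] by simp
qed

lemma factoring_subgroup:
  assumes "X \<in> objs A" "Y \<in> objs A"
  shows "subgroup (factoring A W X Y) (Hom_group A X Y)"
proof
  show "factoring A W X Y \<subseteq> carrier (Hom_group A X Y)" using factoring_arr by auto
  show "inv\<^bsub>Hom_group A X Y\<^esub> f \<in> factoring A W X Y" if "f \<in> factoring A W X Y" for f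
    using mneg_factoring[OF that] factoring_arr[OF that] by simp
qed (use madd_factoring zero_factoring[OF assms] in auto)

lemma stable_class_eq_iff:
  assumes "f \<in> arrs A" "g \<in> arrs A" "src A g = src A f" "tgt A g = tgt A f"
  shows "stable_class A W f = stable_class A W g \<longleftrightarrow>
    madd A f (mneg A g) \<in> factoring A W (src A f) (tgt A f)"
proof -
  interpret comm_group "Hom_group A (src A f) (tgt A f)" by (rule Hom_group_arr[OF assms(1)])
  show ?thesis
    using coset_eq_iff[OF factoring_subgroup, of f g] assms by (simp add: stable_class_def)
qed

lemma stable_class_mem_iff:
  assumes "f \<in> arrs A"
  shows "g \<in> stable_class A W f \<longleftrightarrow> g \<in> arrs A \<and> src A g = src A f \<and> tgt A g = tgt A f \<and>
    stable_class A W g = stable_class A W f"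
proof -
  interpret comm_group "Hom_group A (src A f) (tgt A f)" by (rule Hom_group_arr[OF assms(1)])
  have sub: "subgroup (factoring A W (src A f) (tgt A f)) (Hom_group A (src A f) (tgt A f))"
    using factoring_subgroup assms by simp
  show ?thesis
  proof
    assume g: "g \<in> stable_class A W f"
    then have "g \<in> carrier (Hom_group A (src A f) (tgt A f))"
      using r_coset_subset_G[OF subgroup.subset[OF sub], of f] assms by (auto simp: stable_class_def)
    then show "g \<in> arrs A \<and> src A g = src A f \<and> tgt A g = tgt A f \<and>
        stable_class A W g = stable_class A W f"
      using g repr_independence[OF _ _ sub, of g f] assms by (simp add: stable_class_def)
  next
    assume g: "g \<in> arrs A \<and> src A g = src A f \<and> tgt A g = tgt A f \<and>
        stable_class A W g = stable_class A W f"
    then have "g \<in> stable_class A W g"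
      using rcos_self[of g, OF _ sub] by (simp add: stable_class_def)
    then show "g \<in> stable_class A W f" using g by simp
  qed
qed

lemma stable_class_self: "f \<in> arrs A \<Longrightarrow> f \<in> stable_class A W f"
  by (simp add: stable_class_mem_iff)

lemma stable_class_memE:
  assumes "f \<in> arrs A" "g \<in> stable_class A W f"
  obtains x where "x \<in> factoring A W (src A f) (tgt A f)" "g = madd A x f"
  using assms by (auto simp: stable_class_def r_coset_def)

lemma stable_Hom_carrier:
  "carrier (stable_Hom A W X Y) = stable_class A W ` Hom A X Y"
  by (auto simp: stable_Hom_def FactGroup_def RCOSETS_def stable_class_def)

lemma stable_Hom_mult:
  assumes "f \<in> arrs A" "g \<in> arrs A" "src A f = X" "src A g = X" "tgt A f = Y" "tgt A g = Y"
  shows "stable_class A W f \<otimes>\<^bsub>stable_Hom A W X Y\<^esub> stable_class A W g = stable_class A W (madd A f g)"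
proof -
  interpret comm_group "Hom_group A X Y" using Hom_group_arr[OF assms(1)] assms by simp
  have "subgroup (factoring A W X Y) (Hom_group A X Y)"
    using factoring_subgroup arr_objs[OF assms(1)] assms by simp
  then interpret normal "factoring A W X Y" "Hom_group A X Y"
    using normal_iff_subgroup by blast
  show ?thesis
    using rcos_sum[of f g] assms by (simp add: stable_Hom_def FactGroup_def stable_class_def)
qed

lemma factoring_cmp:
  assumes "f \<in> factoring A W X Y" "g \<in> arrs A"
  shows "src A g = Y \<Longrightarrow> g \<cdot> f \<in> factoring A W X (tgt A g)"
    "tgt A g = X \<Longrightarrow> f \<cdot> g \<in> factoring A W (src A g) Y"
proof -
  obtain V a b where f: "V \<in> W" "a \<in> arrs A" "src A a = X" "tgt A a = V"
    "b \<in> arrs A" "src A b = V" "tgt A b = Y" "f = b \<cdot> a" using factoringE[OF assms(1)] .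
  show "src A g = Y \<Longrightarrow> g \<cdot> f \<in> factoring A W X (tgt A g)"
    using f assms(2) factoringI[of a "g \<cdot> b"] by simp
  show "tgt A g = X \<Longrightarrow> f \<cdot> g \<in> factoring A W (src A g) Y"
    using f assms(2) factoringI[of "a \<cdot> g" b] by simp
qed

text \<open>The difference \<open>(x + g) \<cdot> (y + f) - g \<cdot> f\<close> equals
  \<open>x \<cdot> y + g \<cdot> y + x \<cdot> f\<close>, and each summand factors through
  \<open>W\<close>.\<close>

lemma stable_class_cmp:
  assumes "g \<in> arrs A" "f \<in> arrs A" "src A g = tgt A f" "g' \<in> stable_class A W g" "f' \<in> stable_class A W f"
  shows "stable_class A W (g' \<cdot> f') = stable_class A W (g \<cdot> f)"
proof -
  obtain x where x: "x \<in> factoring A W (src A g) (tgt A g)" "g' = madd A x g"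
    using stable_class_memE[OF assms(1,4)] .
  obtain y where y: "y \<in> factoring A W (src A f) (tgt A f)" "f' = madd A y f"
    using stable_class_memE[OF assms(2,5)] .
  note X = factoring_arr[OF x(1)] and Y = factoring_arr[OF y(1)]
  have "madd A (g' \<cdot> f') (mneg A (g \<cdot> f)) =
      madd A (madd A (x \<cdot> y) (g \<cdot> y)) (x \<cdot> f)"
    using X Y assms(1-3) by (simp add: x y madd_assoc)
  moreover have "x \<cdot> y \<in> factoring A W (src A f) (tgt A g)" "g \<cdot> y \<in> factoring A W (src A f) (tgt A g)"
    "x \<cdot> f \<in> factoring A W (src A f) (tgt A g)"
    using factoring_cmp[OF x(1), of y] factoring_cmp[OF x(1), of f] factoring_cmp[OF y(1), of g] X Y assms
    by auto
  ultimately have "madd A (g' \<cdot> f') (mneg A (g \<cdot> f)) \<in> factoring A W (src A f) (tgt A g)"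
    using madd_factoring by simp
  then show ?thesis
    using X Y assms(1-3) x y by (subst stable_class_eq_iff) simp_all
qed

lemma stable_comp_class:
  assumes "g \<in> arrs A" "f \<in> arrs A" "src A g = tgt A f"
  shows "stable_comp A W (stable_class A W g) (stable_class A W f) = stable_class A W (g \<cdot> f)"
proof -
  have "(g, f) \<in> stable_class A W g \<times> stable_class A W f" using stable_class_self assms by blast
  moreover have "(\<lambda>(g, f). stable_class A W (g \<cdot> f)) x = stable_class A W (g \<cdot> f)"
    if "x \<in> stable_class A W g \<times> stable_class A W f" for x
    using that stable_class_cmp[OF assms] by auto
  ultimately have "(\<lambda>(g, f). stable_class A W (g \<cdot> f)) ` (stable_class A W g \<times> stable_class A W f) =
      {stable_class A W (g \<cdot> f)}"
    by blast
  then show ?thesis by (simp add: stable_comp_def induced_def)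
qed

section \<open>The connecting maps and the transition map \<open>Lam\<close>\<close>

lemma ext_push_in_Ext1:
  assumes "short_exact A k p" "f \<in> arrs A" "src A f = src A k"
  shows "ext_push A (k, p) f \<in> Ext1 A (tgt A p) (tgt A f)"
proof -
  note P = short_exact_arr[OF assms(1)]
  obtain i q h where h: "short_exact A i q" "src A i = tgt A f" "tgt A q = tgt A p"
    "h \<in> arrs A" "src A h = tgt A k" "tgt A h = tgt A i" "h \<cdot> k = i \<cdot> f" "q \<cdot> h = p"
    using pushout_exists[OF assms] .
  have "(i, q) \<in> ext_push A (k, p) f"
    unfolding ext_push_iff using h P short_exact_arr[OF h(1)] by auto
  then have "ext_push A (k, p) f = ext_equiv A (tgt A p) (tgt A f) `` {(i, q)}"
    by (rule ext_push_eq_class[OF assms])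
  moreover have "(i, q) \<in> extensions A (tgt A p) (tgt A f)" using h(1-3) by (simp add: extensions_def)
  ultimately show ?thesis unfolding Ext1_def by (simp only: quotientI)
qed

text \<open>One extension receives two morphisms, with middle maps \<open>h\<close> and
  \<open>h'\<close>. Their difference is killed by \<open>q\<close>, so it is
  \<open>i \<cdot> r\<close>, and \<open>f - g = r \<cdot> k\<close> factors through the middle
  object of the precover, which lies in \<open>W\<close>.\<close>

lemma ext_push_stable:
  assumes "short_exact A k p" "src A p \<in> W" "f \<in> arrs A" "src A f = src A k"
    "g \<in> arrs A" "src A g = src A k" "tgt A g = tgt A f" "ext_push A (k, p) f = ext_push A (k, p) g"
  shows "stable_class A W f = stable_class A W g"
proof -
  note P = short_exact_arr[OF assms(1)]
  obtain i q h where h: "short_exact A i q" "src A i = tgt A f" "tgt A q = tgt A p"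
    "h \<in> arrs A" "src A h = tgt A k" "tgt A h = tgt A i" "h \<cdot> k = i \<cdot> f" "q \<cdot> h = p"
    using pushout_exists[OF assms(1,3,4)] .
  note Q = short_exact_arr[OF h(1)]
  have "(i, q) \<in> ext_push A (k, p) f"
    unfolding ext_push_iff using h P Q by auto
  then have "(i, q) \<in> ext_push A (k, p) g" using assms(8) by simp
  then obtain h' where h': "h' \<in> arrs A" "src A h' = tgt A k" "tgt A h' = tgt A i"
    "h' \<cdot> k = i \<cdot> g" "q \<cdot> h' = p"
    unfolding ext_push_iff using P Q by auto
  define d where "d = madd A h (mneg A h')"
  have d: "d \<in> arrs A" "src A d = tgt A k" "tgt A d = tgt A i" using h h' by (simp_all add: d_def)
  have "q \<cdot> d = mzero A (src A d) (tgt A q)"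
    using h h' Q P d by (simp add: d_def)
  then obtain r where r: "r \<in> arrs A" "src A r = tgt A k" "tgt A r = src A i" "i \<cdot> r = d"
    using ker_lift[OF short_exactD(1)[OF h(1)], of d] d Q by auto
  have "i \<cdot> (r \<cdot> k) = d \<cdot> k" by (rule cmp_reduce[OF r(4)]) (use r Q P in simp_all)
  also have "\<dots> = i \<cdot> madd A f (mneg A g)"
    using h h' P Q assms(3-7) by (simp add: d_def)
  finally have "r \<cdot> k = madd A f (mneg A g)"
    by (rule mono_cancel[OF short_exact_mono_epi(1)[OF h(1)], rotated -1])
      (use r P h Q assms(3-7) in simp_all)
  moreover have "r \<cdot> k \<in> factoring A W (src A k) (tgt A f)"
    using factoringI[of k r] r P h assms(2) by simp
  ultimately show ?thesis using assms(3-7) by (subst stable_class_eq_iff) simp_all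
qed

text \<open>Orthogonality lifts \<open>p\<close> along \<open>q\<close>; restricting the lift to the
  kernels gives the preimage \<open>f\<close>.\<close>

lemma ext_push_surj:
  assumes "short_exact A k p" "src A p \<in> W" "K' \<in> right_perp A W" "e \<in> Ext1 A (tgt A p) K'"
  obtains f where "f \<in> arrs A" "src A f = src A k" "tgt A f = K'" "ext_push A (k, p) f = e"
proof -
  note P = short_exact_arr[OF assms(1)]
  obtain X where "e = ext_equiv A (tgt A p) K' `` {X}" "X \<in> extensions A (tgt A p) K'"
    using assms(4) unfolding Ext1_def by (auto elim!: quotientE)
  then obtain i q where e: "e = ext_equiv A (tgt A p) K' `` {(i, q)}"
    and iq: "short_exact A i q" "src A i = K'" "tgt A q = tgt A p"
    by (auto simp: extensions_def)
  note Q = short_exact_arr[OF iq(1)]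
  obtain h where h: "h \<in> arrs A" "src A h = tgt A k" "tgt A h = tgt A i" "q \<cdot> h = p"
    by (rule ext_lift[OF assms(3,2) iq(1,2), of p]) (use P iq in simp_all)
  have "q \<cdot> (h \<cdot> k) = p \<cdot> k" by (rule cmp_reduce[OF h(4)]) (use h P Q in simp_all)
  then have "q \<cdot> (h \<cdot> k) = mzero A (src A (h \<cdot> k)) (tgt A q)" using P h iq by simp
  then obtain f where f: "f \<in> arrs A" "src A f = src A k" "tgt A f = src A i" "i \<cdot> f = h \<cdot> k"
    using ker_lift[OF short_exactD(1)[OF iq(1)], of "h \<cdot> k"] h P Q by auto
  have "(i, q) \<in> ext_push A (k, p) f"
    unfolding ext_push_iff using iq f h P Q by auto
  then have "ext_push A (k, p) f = e" using ext_push_eq_class[OF assms(1) f(1,2)] f iq e by simp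
  then show thesis using that f iq by blast
qed

text \<open>Justifies the definite description in \<open>beta\<close>: the connecting map is onto,
  which gives uniqueness, and its fibres lie in single stable classes, which gives
  existence.\<close>

lemma beta_push:
  assumes "short_exact A k p" "src A p \<in> W" "src A k' \<in> right_perp A W"
    and f: "f \<in> arrs A" "src A f = src A k" "tgt A f = src A k'"
  shows "beta A W (k, p) (k', p') (ext_push A (k, p) f) = stable_class A W f"
proof -
  define D where "D = Ext1 A (tgt A p) (src A k')"
  define H where "H = Hom A (src A k) (src A k')"
  define is_beta where "is_beta b \<longleftrightarrow> b \<in> D \<rightarrow>\<^sub>E carrier (stable_Hom A W (src A k) (src A k')) \<and>
    (\<forall>f \<in> H. b (ext_push A (k, p) f) = stable_class A W f)" for b
  \<comment> \<open>A preimage under the connecting map is chosen arbitrarily; by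
    \<open>ext_push_stable\<close> its stable class does not depend on the choice.\<close>
  define b0 where "b0 = (\<lambda>e \<in> D. stable_class A W (SOME f. f \<in> H \<and> ext_push A (k, p) f = e))"
  have surj: "\<exists>f. f \<in> H \<and> ext_push A (k, p) f = e" if "e \<in> D" for e
    using ext_push_surj[OF assms(1-3)] that unfolding D_def H_def in_Hom by metis
  have b0: "is_beta b0"
    unfolding is_beta_def
  proof (intro conjI ballI)
    show "b0 \<in> D \<rightarrow>\<^sub>E carrier (stable_Hom A W (src A k) (src A k'))"
      using someI_ex[OF surj] by (auto simp: b0_def stable_Hom_carrier H_def)
    fix f assume f: "f \<in> H"
    then have D: "ext_push A (k, p) f \<in> D"
      using ext_push_in_Ext1[OF assms(1), of f] by (simp add: D_def H_def)
    show "b0 (ext_push A (k, p) f) = stable_class A W f"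
      using someI_ex[OF surj[OF D]] ext_push_stable[OF assms(1,2)] f D by (simp add: b0_def H_def)
  qed
  have uniq: "b = b0" if b: "is_beta b" for b
  proof (rule extensionalityI[of _ D])
    show "b \<in> extensional D" "b0 \<in> extensional D" using b b0 by (auto simp: is_beta_def PiE_def)
    fix e assume "e \<in> D"
    then obtain f where "f \<in> H" "ext_push A (k, p) f = e" using surj by blast
    then show "b e = b0 e" using b b0 by (auto simp: is_beta_def)
  qed
  have "beta A W (k, p) (k', p') = b0"
    unfolding beta_def fst_conv snd_conv
    using the_equality[of is_beta b0, OF b0 uniq] unfolding is_beta_def D_def H_def .
  then show ?thesis using b0 f by (simp add: is_beta_def H_def)
qed

text \<open>Eliminates \<open>Ext1\<close>: by \<open>pull_eq_push\<close> the class that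
  \<open>delta_bar\<close> assigns to \<open>g\<close> is the push along \<open>f\<close>, and
  \<open>beta\<close> sends that back to the class of \<open>f\<close>. All transition maps are
  evaluated by this rule.\<close>

lemma Lam_class:
  assumes "special_precover A W M (k, p)" "special_precover A W N (k', p')"
    and f: "f \<in> arrs A" "src A f = src A k" "tgt A f = src A k'"
    and b: "b \<in> arrs A" "src A b = tgt A k" "tgt A b = tgt A k'"
    and g: "g \<in> arrs A" "src A g = tgt A p" "tgt A g = tgt A p'"
    and bk: "b \<cdot> k = k' \<cdot> f" and pb: "p' \<cdot> b = g \<cdot> p"
  shows "Lam A W (k, p) (k', p') (stable_class A W g) = stable_class A W f"
proof -
  have E: "short_exact A k p" "src A p \<in> W" and E': "short_exact A k' p'" "src A k' \<in> right_perp A W"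
    using assms(1,2) by (simp_all add: special_precover_def)
  note P = short_exact_arr[OF E(1)] and P' = short_exact_arr[OF E'(1)]
  have "ext_pull A (k', p') g' = ext_push A (k, p) f" if g': "g' \<in> stable_class A W g" for g'
  proof -
    obtain x where x: "x \<in> factoring A W (src A g) (tgt A g)" "g' = madd A x g"
      using stable_class_memE[OF g(1) g'] .
    obtain V a c where V: "V \<in> W" "a \<in> arrs A" "src A a = src A g" "tgt A a = V"
      "c \<in> arrs A" "src A c = V" "tgt A c = tgt A g" "x = c \<cdot> a" using factoringE[OF x(1)] .
    obtain t where t: "t \<in> arrs A" "src A t = V" "tgt A t = tgt A k'" "p' \<cdot> t = c"
      by (rule ext_lift[OF E'(2) V(1) E'(1), of c]) (use V g in simp_all)
    \<comment> \<open>Another representative of the class is \<open>x + g\<close> with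
      \<open>x = c \<cdot> a\<close> through \<open>W\<close>. Lifting \<open>c\<close> along
      \<open>p'\<close> changes the middle map by \<open>t \<cdot> a \<cdot> p\<close>, which
      vanishes on \<open>k\<close>, so the same \<open>f\<close> serves every
      representative.\<close>
    define b' where "b' = madd A (t \<cdot> (a \<cdot> p)) b"
    have b': "b' \<in> arrs A" "src A b' = tgt A k" "tgt A b' = tgt A k'"
      using t V b g P by (simp_all add: b'_def)
    have "b' \<cdot> k = k' \<cdot> f"
      using t V b g P P' f bk by (simp add: b'_def)
    moreover have "p' \<cdot> (t \<cdot> (a \<cdot> p)) = c \<cdot> (a \<cdot> p)"
      by (rule cmp_reduce[OF t(4)]) (use t V g P P' in simp_all)
    then have "p' \<cdot> b' = g' \<cdot> p"
      using t(1-3) V b g P P' pb by (simp add: b'_def x)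
    ultimately show ?thesis
      by (intro pull_eq_push[OF E(1) E'(1) E(2) E'(2) f b']) (use x V g in simp_all)
  qed
  then have "ext_pull A (k', p') ` stable_class A W g = {ext_push A (k, p) f}"
    using stable_class_self[OF g(1)] by blast
  then have "delta_bar A (k', p') (stable_class A W g) = ext_push A (k, p) f"
    by (simp add: delta_bar_def induced_def)
  then show ?thesis using beta_push[OF E E'(2) f] by (simp add: Lam_def)
qed

lemma precover_lift:
  assumes "special_precover A W N (k', p')" "V \<in> W" "a \<in> arrs A" "src A a = V" "tgt A a = tgt A p'"
  obtains t where "t \<in> arrs A" "src A t = V" "tgt A t = tgt A k'" "p' \<cdot> t = a"
  using ext_lift[OF _ assms(2) _ refl assms(3-5), of k'] assms(1) by (auto simp: special_precover_def)

text \<open>Supplies the squares that \<open>Lam_class\<close> evaluates.\<close>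

lemma precover_morphism:
  assumes "special_precover A W M (k, p)" "special_precover A W N (k', p')"
    and g: "g \<in> arrs A" "src A g = tgt A p" "tgt A g = tgt A p'"
  obtains f b where "f \<in> arrs A" "src A f = src A k" "tgt A f = src A k'"
    "b \<in> arrs A" "src A b = tgt A k" "tgt A b = tgt A k'" "b \<cdot> k = k' \<cdot> f" "p' \<cdot> b = g \<cdot> p"
proof -
  have E: "short_exact A k p" "src A p \<in> W" and E': "short_exact A k' p'" "src A k' \<in> right_perp A W"
    using assms(1,2) by (simp_all add: special_precover_def)
  note P = short_exact_arr[OF E(1)] and P' = short_exact_arr[OF E'(1)]
  obtain b where b: "b \<in> arrs A" "src A b = src A p" "tgt A b = tgt A k'" "p' \<cdot> b = g \<cdot> p"
    by (rule precover_lift[OF assms(2) E(2), of "g \<cdot> p"]) (use g P in simp_all)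
  have "p' \<cdot> (b \<cdot> k) = (g \<cdot> p) \<cdot> k" by (rule cmp_reduce[OF b(4)]) (use b P P' in simp_all)
  then have "p' \<cdot> (b \<cdot> k) = mzero A (src A (b \<cdot> k)) (tgt A p')" using g P b by simp
  then obtain f where "f \<in> arrs A" "src A f = src A k" "tgt A f = src A k'" "k' \<cdot> f = b \<cdot> k"
    using ker_lift[OF short_exactD(1)[OF E'(1)], of "b \<cdot> k"] b P P' by auto
  then show thesis using that[of f b] b P by simp
qed

end

section \<open>Comparison of proper resolutions\<close>

text \<open>The nonnegative part of a complex: \<open>dn P i\<close> is the differential from degree \<open>i + 1\<close> to degree \<open>i\<close>,
  and \<open>bnd P e i\<close> is the map leaving degree \<open>i\<close> in the complex augmented by \<open>e\<close>.\<close>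

definition ch :: "('o, 'm, 'y) cplx_scheme \<Rightarrow> nat \<Rightarrow> 'o" where
  "ch P i = cob P (int i)"

definition dn :: "('o, 'm, 'y) cplx_scheme \<Rightarrow> nat \<Rightarrow> 'm" where
  "dn P i = dif P (int i + 1)"

primrec bnd :: "('o, 'm, 'y) cplx_scheme \<Rightarrow> 'm \<Rightarrow> nat \<Rightarrow> 'm" where
  "bnd P e 0 = e"
| "bnd P e (Suc i) = dn P i"

text \<open>A chain map over \<open>f\<close> restricted to nonnegative degrees, as a proper
  resolution has zero objects below. Indexing by natural numbers permits construction by dependent
  choice.\<close>

definition is_lift :: "('o, 'm, 'z) cat_scheme \<Rightarrow> ('o, 'm, 'x) cplx_scheme \<Rightarrow> 'm
    \<Rightarrow> ('o, 'm, 'y) cplx_scheme \<Rightarrow> 'm \<Rightarrow> 'm \<Rightarrow> (nat \<Rightarrow> 'm) \<Rightarrow> bool" where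
  "is_lift A P e P' e' f u \<longleftrightarrow> (\<forall>i. u i \<in> Hom A (ch P i) (ch P' i)) \<and>
     e' \<cdot>\<^bsub>A\<^esub> u 0 = f \<cdot>\<^bsub>A\<^esub> e \<and> (\<forall>i. dn P' i \<cdot>\<^bsub>A\<^esub> u (Suc i) = u i \<cdot>\<^bsub>A\<^esub> dn P i)"

lemma is_liftD:
  assumes "is_lift A P e P' e' f u"
  shows "u i \<in> arrs A" "src A (u i) = ch P i" "tgt A (u i) = ch P' i"
    "e' \<cdot>\<^bsub>A\<^esub> u 0 = f \<cdot>\<^bsub>A\<^esub> e" "dn P' i \<cdot>\<^bsub>A\<^esub> u (Suc i) = u i \<cdot>\<^bsub>A\<^esub> dn P i"
  using assms by (auto simp: is_lift_def)

lemma complex_dif: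
  assumes "is_complex A X"
  shows "dif X n \<in> arrs A" "src A (dif X n) = cob X n" "tgt A (dif X n) = cob X (n - 1)"
    "dif X n \<cdot>\<^bsub>A\<^esub> dif X (n + 1) = mzero A (cob X (n + 1)) (cob X (n - 1))" "cob X n \<in> objs A"
  using assms by (auto simp: is_complex_def)

lemma complex_dn:
  assumes "is_complex A X"
  shows "dn X i \<in> arrs A" "src A (dn X i) = ch X (Suc i)" "tgt A (dn X i) = ch X i"
    "dn X i \<cdot>\<^bsub>A\<^esub> dn X (Suc i) = mzero A (ch X (Suc (Suc i))) (ch X i)" "ch X i \<in> objs A"
  using complex_dif[OF assms, of "int i + 1"] complex_dif(5)[OF assms]
  by (simp_all add: dn_def ch_def algebra_simps)

context additive_subcategory_of
begin

lemma proper_resolutionD: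
  assumes "proper_resolution A W P e M"
  shows "is_complex A P" "ch P i \<in> W" "e \<in> arrs A" "src A e = ch P 0" "tgt A e = M" "is_epi A e"
    "exact_at A (dn P (Suc i)) (dn P i)" "exact_at A (dn P 0) e"
proof -
  have "exact_at A (dif P (int (Suc i) + 1)) (dif P (int (Suc i)))"
    using assms unfolding proper_resolution_def by (metis of_nat_0_le_iff int_ops(4) le_add_same_cancel2)
  then show "exact_at A (dn P (Suc i)) (dn P i)" by (simp add: dn_def add.commute)
qed (use assms in \<open>auto simp: proper_resolution_def ch_def dn_def\<close>)

lemma proper_lift_augmentation:
  assumes "proper_resolution A W P e M" "a \<in> arrs A" "src A a \<in> W" "tgt A a = M"
  obtains t where "t \<in> arrs A" "src A t = src A a" "tgt A t = ch P 0" "e \<cdot> t = a"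
proof -
  have "(\<lambda>h. e \<cdot> h) ` Hom A (src A a) (cob P 0) = Hom A (src A a) M"
    using assms by (auto simp: proper_resolution_def simp del: in_Hom)
  moreover have "a \<in> Hom A (src A a) M" using assms by simp
  ultimately obtain t where t: "t \<in> Hom A (src A a) (cob P 0)" "a = e \<cdot> t"
    by blast
  then show thesis using that[of t, OF _ _ _ t(2)[symmetric]] t(1) by (simp add: ch_def)
qed

text \<open>Exactness under Hom from objects of \<open>W\<close>; the notation \<open>bnd\<close>
  treats degree 0, where the augmentation replaces the differential, together with the higher
  degrees.\<close>

lemma proper_lift_boundary:
  assumes P: "proper_resolution A W P e M" and a: "a \<in> arrs A" "src A a \<in> W" "tgt A a = ch P i"
    and "bnd P e i \<cdot> a = mzero A (src A a) (tgt A (bnd P e i))"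
  obtains t where "t \<in> arrs A" "src A t = src A a" "tgt A t = ch P (Suc i)" "dn P i \<cdot> t = a"
proof -
  note C = complex_dn[OF proper_resolutionD(1)[OF P]]
  have "Hom_from_exact_at A (src A a) (dn P i) (bnd P e i)"
  proof (cases i)
    case 0
    then show ?thesis using P a(2) by (auto simp: proper_resolution_def dn_def)
  next
    case (Suc j)
    have "int (Suc j) \<ge> 1" by simp
    then have "Hom_from_exact_at A (src A a) (dif P (int (Suc j) + 1)) (dif P (int (Suc j)))"
      using P a(2) unfolding proper_resolution_def by blast
    then show ?thesis by (simp add: Suc dn_def add.commute)
  qed
  moreover have "src A (bnd P e i) = ch P i"
    using C(2) proper_resolutionD(4)[OF P] by (cases i) auto
  ultimately have "(\<lambda>h. dn P i \<cdot> h) ` Hom A (src A a) (ch P (Suc i)) =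
      {h \<in> Hom A (src A a) (ch P i). bnd P e i \<cdot> h = mzero A (src A a) (tgt A (bnd P e i))}"
    using C by (auto simp: Hom_from_exact_at_def kernel_def simp del: in_Hom)
  moreover have "a \<in> {h \<in> Hom A (src A a) (ch P i). bnd P e i \<cdot> h = mzero A (src A a) (tgt A (bnd P e i))}"
    using assms by simp
  ultimately obtain t where t: "t \<in> Hom A (src A a) (ch P (Suc i))" "a = dn P i \<cdot> t"
    by blast
  then show thesis using that[of t, OF _ _ _ t(2)[symmetric]] t(1) by simp
qed

lemma exact_at_zero:
  assumes "exact_at A f g"
  shows "g \<cdot> f = mzero A (src A f) (tgt A g)"
proof -
  obtain c k where ck: "is_coker A c f" "is_ker A k c" "is_ker A k g"
    using assms by (auto simp: exact_at_def)
  note C = cokerD[OF ck(1)] and K = kerD[OF ck(3)]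
  have "tgt A f = tgt A k" using C kerD[OF ck(2)] by simp
  then obtain t where t: "t \<in> arrs A" "src A t = src A f" "tgt A t = src A k" "k \<cdot> t = f"
    using ker_lift[OF ck(2), of f] C by auto
  have "g \<cdot> f = (g \<cdot> k) \<cdot> t" by (rule cmp_expand_right[OF t(4)]) (use t K in simp_all)
  then show ?thesis using t K by simp
qed

lemma proper_bnd:
  assumes "proper_resolution A W P e M"
  shows "bnd P e i \<in> arrs A" "src A (bnd P e i) = ch P i"
    "bnd P e i \<cdot> dn P i = mzero A (ch P (Suc i)) (tgt A (bnd P e i))"
  using complex_dn[OF proper_resolutionD(1)[OF assms]] proper_resolutionD[OF assms]
    exact_at_zero[OF proper_resolutionD(8)[OF assms]]
  by (cases i; simp)+

text \<open>The comparison theorem. Objects of \<open>W\<close> need not be projective, but the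
  lifting problems that arise have sources in \<open>W\<close>, and properness solves exactly
  these.\<close>

lemma lift_exists:
  assumes P: "proper_resolution A W P e M" and P': "proper_resolution A W P' e' M'"
    and f: "f \<in> arrs A" "src A f = M" "tgt A f = M'"
  shows "\<exists>u. is_lift A P e P' e' f u"
proof -
  note C = complex_dn[OF proper_resolutionD(1)[OF P]] and C' = complex_dn[OF proper_resolutionD(1)[OF P']]
  note p = proper_resolutionD[OF P] and p' = proper_resolutionD[OF P']
  note b = proper_bnd[OF P] and b' = proper_bnd[OF P']
  \<comment> \<open>The invariant says that \<open>x \<cdot> dn P i\<close> is a cycle in the
    target, which is what the choice in the next degree requires.\<close>
  define ok where "ok i x \<longleftrightarrow> x \<in> arrs A \<and> src A x = ch P i \<and> tgt A x = ch P' i \<and>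
    (i = 0 \<longrightarrow> e' \<cdot> x = f \<cdot> e) \<and>
    bnd P' e' i \<cdot> (x \<cdot> dn P i) = mzero A (ch P (Suc i)) (tgt A (bnd P' e' i))" for i x
  have "\<exists>u. \<forall>i. ok i (u i) \<and> dn P' i \<cdot> u (Suc i) = u i \<cdot> dn P i"
  proof (rule dependent_nat_choice)
    obtain x where x: "x \<in> arrs A" "src A x = ch P 0" "tgt A x = ch P' 0" "e' \<cdot> x = f \<cdot> e"
      by (rule proper_lift_augmentation[OF P', of "f \<cdot> e"]) (use f p in simp_all)
    have "e' \<cdot> (x \<cdot> dn P 0) = (f \<cdot> e) \<cdot> dn P 0"
      by (rule cmp_reduce[OF x(4)]) (use x C p' in simp_all)
    also have "\<dots> = f \<cdot> (e \<cdot> dn P 0)" using p f C by simp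
    also have "\<dots> = mzero A (ch P 1) M'" using b(3)[of 0] p f C(5) by simp
    finally show "\<exists>x. ok 0 x" using x p' by (auto simp: ok_def)
  next
    fix x i assume "ok i x"
    then have x: "x \<in> arrs A" "src A x = ch P i" "tgt A x = ch P' i"
      "bnd P' e' i \<cdot> (x \<cdot> dn P i) = mzero A (ch P (Suc i)) (tgt A (bnd P' e' i))"
      by (auto simp: ok_def)
    obtain y where y: "y \<in> arrs A" "src A y = ch P (Suc i)" "tgt A y = ch P' (Suc i)"
      "dn P' i \<cdot> y = x \<cdot> dn P i"
      by (rule proper_lift_boundary[OF P', of "x \<cdot> dn P i" i]) (use x C p in simp_all)
    have "dn P' i \<cdot> (y \<cdot> dn P (Suc i)) = (x \<cdot> dn P i) \<cdot> dn P (Suc i)"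
      by (rule cmp_reduce[OF y(4)]) (use y C C' in simp_all)
    then have "dn P' i \<cdot> (y \<cdot> dn P (Suc i)) = mzero A (ch P (Suc (Suc i))) (ch P' i)"
      using x C by simp
    then show "\<exists>y. ok (Suc i) y \<and> dn P' i \<cdot> y = x \<cdot> dn P i"
      using y C' by (auto simp: ok_def)
  qed
  then obtain u where u: "\<And>i. ok i (u i)" "\<And>i. dn P' i \<cdot> u (Suc i) = u i \<cdot> dn P i" by blast
  have "is_lift A P e P' e' f u"
    using u(1) u(1)[of 0] u(2) unfolding is_lift_def ok_def by simp
  then show ?thesis by blast
qed

text \<open>The difference of two lifts is null-homotopic, again by lifting from objects of
  \<open>W\<close>. The formula is recorded in positive degrees, where both homotopy terms have the
  same shape.\<close>

lemma lift_homotopy: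
  assumes P: "proper_resolution A W P e M" and P': "proper_resolution A W P' e' M'"
    and u: "is_lift A P e P' e' f u" and v: "is_lift A P e P' e' f v"
  shows "\<exists>s. (\<forall>i. s i \<in> Hom A (ch P i) (ch P' (Suc i))) \<and>
    (\<forall>i. u (Suc i) = madd A (v (Suc i)) (madd A (dn P' (Suc i) \<cdot> s (Suc i)) (s i \<cdot> dn P i)))"
proof -
  note C = complex_dn[OF proper_resolutionD(1)[OF P]] and C' = complex_dn[OF proper_resolutionD(1)[OF P']]
  note p = proper_resolutionD[OF P] and p' = proper_resolutionD[OF P']
  note U = is_liftD[OF u] and V = is_liftD[OF v]
  define d where "d i = madd A (u i) (mneg A (v i))" for i
  have d: "d i \<in> arrs A" "src A (d i) = ch P i" "tgt A (d i) = ch P' i" for i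
    using U V by (simp_all add: d_def)
  have dd: "dn P' i \<cdot> d (Suc i) = d i \<cdot> dn P i" for i
    using U V C C' by (simp add: d_def)
  \<comment> \<open>The invariant makes \<open>d (Suc i) - x \<cdot> dn P i\<close> a cycle, so that
    the next component of the homotopy can be chosen with this as its boundary.\<close>
  define ok where "ok i x \<longleftrightarrow> x \<in> arrs A \<and> src A x = ch P i \<and> tgt A x = ch P' (Suc i) \<and>
    dn P' i \<cdot> (x \<cdot> dn P i) = dn P' i \<cdot> d (Suc i)" for i x
  have "\<exists>s. \<forall>i. ok i (s i) \<and> d (Suc i) = madd A (dn P' (Suc i) \<cdot> s (Suc i)) (s i \<cdot> dn P i)"
  proof (rule dependent_nat_choice)
    have "e' \<cdot> d 0 = mzero A (ch P 0) M'"
    proof -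
      have "f \<cdot> e \<in> arrs A" "src A (f \<cdot> e) = ch P 0" "tgt A (f \<cdot> e) = M'"
        using U(1-3)[of 0] p' cmp_arr[of e' "u 0"] U(4) by simp_all
      then have "e' \<cdot> d 0 = madd A (f \<cdot> e) (mneg A (f \<cdot> e))"
        using U(1-3)[of 0] V(1-3)[of 0] U(4) V(4) p' by (simp add: d_def)
      then show ?thesis using \<open>f \<cdot> e \<in> arrs A\<close> \<open>src A (f \<cdot> e) = ch P 0\<close> \<open>tgt A (f \<cdot> e) = M'\<close> by simp
    qed
    then obtain x where x: "x \<in> arrs A" "src A x = ch P 0" "tgt A x = ch P' (Suc 0)" "dn P' 0 \<cdot> x = d 0"
      using proper_lift_boundary[OF P', of "d 0" 0] d p p' by auto
    have "dn P' 0 \<cdot> (x \<cdot> dn P 0) = d 0 \<cdot> dn P 0"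
      by (rule cmp_reduce[OF x(4)]) (use x C C' in simp_all)
    then show "\<exists>x. ok 0 x" using x dd[of 0] by (auto simp: ok_def)
  next
    fix x i assume "ok i x"
    then have x: "x \<in> arrs A" "src A x = ch P i" "tgt A x = ch P' (Suc i)"
      "dn P' i \<cdot> (x \<cdot> dn P i) = dn P' i \<cdot> d (Suc i)"
      by (auto simp: ok_def)
    define r where "r = madd A (d (Suc i)) (mneg A (x \<cdot> dn P i))"
    have r: "r \<in> arrs A" "src A r = ch P (Suc i)" "tgt A r = ch P' (Suc i)"
      using x d C by (simp_all add: r_def)
    have "dn P' i \<cdot> r = madd A (dn P' i \<cdot> d (Suc i)) (mneg A (dn P' i \<cdot> (x \<cdot> dn P i)))"
      using x(1-3) d C C' by (simp add: r_def)
    also have "\<dots> = mzero A (ch P (Suc i)) (ch P' i)"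
      unfolding x(4) using d C' by simp
    finally obtain y where y: "y \<in> arrs A" "src A y = ch P (Suc i)" "tgt A y = ch P' (Suc (Suc i))"
      "dn P' (Suc i) \<cdot> y = r"
      using proper_lift_boundary[OF P', of r "Suc i"] r C' p by auto
    have "dn P' (Suc i) \<cdot> (y \<cdot> dn P (Suc i)) = r \<cdot> dn P (Suc i)"
      by (rule cmp_reduce[OF y(4)]) (use y C C' in simp_all)
    also have "\<dots> = dn P' (Suc i) \<cdot> d (Suc (Suc i))"
      using x(1-3) d C C'(5) dd[of "Suc i"] by (simp add: r_def)
    finally have "ok (Suc i) y" using y by (simp add: ok_def)
    moreover have "d (Suc i) = madd A (dn P' (Suc i) \<cdot> y) (x \<cdot> dn P i)"
      unfolding y(4) using r_def x d C r by (subst (asm) eq_commute, subst (asm) diff_eq_iff) simp_all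
    ultimately show "\<exists>y. ok (Suc i) y \<and> d (Suc i) = madd A (dn P' (Suc i) \<cdot> y) (x \<cdot> dn P i)"
      by blast
  qed
  then obtain s where s: "\<And>i. ok i (s i)"
    "\<And>i. d (Suc i) = madd A (dn P' (Suc i) \<cdot> s (Suc i)) (s i \<cdot> dn P i)" by blast
  have s_arr: "s i \<in> arrs A" "src A (s i) = ch P i" "tgt A (s i) = ch P' (Suc i)" for i
    using s(1)[of i] by (auto simp: ok_def)
  have "u (Suc i) = madd A (v (Suc i)) (madd A (dn P' (Suc i) \<cdot> s (Suc i)) (s i \<cdot> dn P i))" for i
  proof -
    have "madd A (v (Suc i)) (d (Suc i)) = u (Suc i)"
      using U(1-3) V(1-3) by (simp add: d_def madd_left_comm[of "v (Suc i)" "u (Suc i)"])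
    then show ?thesis using s(2) by simp
  qed
  then show ?thesis using s_arr by (intro exI[of _ s]) simp
qed

lemma lift_cmp:
  assumes P: "is_complex A P" and P': "is_complex A P'" and P'': "is_complex A P''"
    and "is_lift A P e P' e' f u" "is_lift A P' e' P'' e'' g v"
    and e: "e \<in> arrs A" "e' \<in> arrs A" "src A e' = ch P' 0" "e'' \<in> arrs A" "src A e'' = ch P'' 0"
    and f: "f \<in> arrs A" "src A f = tgt A e" "tgt A f = tgt A e'" "g \<in> arrs A" "src A g = tgt A e'"
  shows "is_lift A P e P'' e'' (g \<cdot> f) (\<lambda>i. v i \<cdot> u i)"
  unfolding is_lift_def
proof (intro conjI allI)
  note C = complex_dn[OF P] and C' = complex_dn[OF P'] and C'' = complex_dn[OF P'']
  note U = is_liftD[OF assms(4)] and V = is_liftD[OF assms(5)]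
  show "v i \<cdot> u i \<in> Hom A (ch P i) (ch P'' i)" for i using U V by simp
  have "e'' \<cdot> (v 0 \<cdot> u 0) = (g \<cdot> e') \<cdot> u 0"
    by (rule cmp_reduce[OF V(4)]) (use U V e in simp_all)
  also have "\<dots> = g \<cdot> (f \<cdot> e)" using U(1-3)[of 0] e f by (simp add: U(4))
  finally show "e'' \<cdot> (v 0 \<cdot> u 0) = (g \<cdot> f) \<cdot> e" using e f by simp
  fix i
  have "dn P'' i \<cdot> (v (Suc i) \<cdot> u (Suc i)) = (v i \<cdot> dn P' i) \<cdot> u (Suc i)"
    by (rule cmp_reduce[OF V(5)]) (use U V C'' in simp_all)
  also have "\<dots> = v i \<cdot> (u i \<cdot> dn P i)" using U(1-3) V(1-3) C' by (simp add: U(5))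
  finally show "dn P'' i \<cdot> (v (Suc i) \<cdot> u (Suc i)) = (v i \<cdot> u i) \<cdot> dn P i"
    using U(1-3) V(1-3) C by simp
qed

lemma lift_idm:
  assumes "is_complex A P" "e \<in> arrs A" "src A e = ch P 0"
  shows "is_lift A P e P e (idm A (tgt A e)) (\<lambda>i. idm A (ch P i))"
  unfolding is_lift_def using complex_dn[OF assms(1)] assms by simp

text \<open>The cokernel in \<open>exact_at\<close> is existentially bound; this exchanges it for
  the chosen one.\<close>

lemma ker_coker_unique:
  assumes "is_coker A c f" "is_coker A c' f" "is_ker A k c"
  shows "is_ker A k c'"
proof (rule is_kerI[OF ker_mono[OF assms(3)]])
  note C = cokerD[OF assms(1)] and C' = cokerD[OF assms(2)] and K = kerD[OF assms(3)]
  show "c' \<in> arrs A" "src A c' = tgt A k" using C C' K by simp_all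
  obtain v where v: "v \<in> arrs A" "src A v = tgt A c" "tgt A v = tgt A c'" "v \<cdot> c = c'"
    using coker_desc[OF assms(1), of c'] C C' by auto
  obtain u where u: "u \<in> arrs A" "src A u = tgt A c'" "tgt A u = tgt A c" "u \<cdot> c' = c"
    using coker_desc[OF assms(2), of c] C C' by auto
  have "c' \<cdot> k = v \<cdot> (c \<cdot> k)" by (rule cmp_expand_left[OF v(4)]) (use v C K in simp_all)
  then show "c' \<cdot> k = mzero A (src A k) (tgt A c')" using v K by simp
  fix t assume t: "t \<in> arrs A" "tgt A t = src A c'" "c' \<cdot> t = mzero A (src A t) (tgt A c')"
  have "c \<cdot> t = u \<cdot> (c' \<cdot> t)" by (rule cmp_expand_left[OF u(4)]) (use u C' t in simp_all)
  then have "c \<cdot> t = mzero A (src A t) (tgt A c)" using u t by simp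
  moreover have "tgt A t = src A c" using t C C' by simp
  ultimately obtain x where "x \<in> arrs A" "src A x = src A t" "tgt A x = src A k" "k \<cdot> x = t"
    using ker_lift[OF assms(3) t(1)] by blast
  then show "\<exists>x. x \<in> arrs A \<and> src A x = src A t \<and> tgt A x = src A k \<and> k \<cdot> x = t" by blast
qed

end

section \<open>Syzygies as iterated special precovers\<close>

locale syzygies = additive_subcategory_of +
  fixes R :: "'a \<Rightarrow> ('a, 'b) syzygy_resolution"
  assumes choice: "syzygy_choice A W R"
begin

definition inc :: "'a \<Rightarrow> nat \<Rightarrow> 'b" where
  "inc M i = fst (syz_seq A (R M) i)"

lemma resolution:
  assumes "M \<in> objs A"
  shows "proper_resolution A W (R M) (cok (R M) 0) M" "is_coker A (cok (R M) i) (dn (R M) i)"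
    "syz A (R M) (Suc i) \<in> right_perp A W" "syz A (R M) 0 = M"
proof -
  have *: "special_proper_resolution A W (R M) (cok (R M) 0) M"
    and **: "is_coker A (cok (R M) i) (dn (R M) i)" for i
    using choice assms by (auto simp: syzygy_choice_def dn_def)
  show "proper_resolution A W (R M) (cok (R M) 0) M" "is_coker A (cok (R M) i) (dn (R M) i)"
    using * ** by (auto simp: special_proper_resolution_def)
  have "int (Suc i) \<ge> 1" by simp
  then show "syz A (R M) (Suc i) \<in> right_perp A W"
    using * **[of "Suc i"] unfolding special_proper_resolution_def dn_def syz_def by blast
  show "syz A (R M) 0 = M"
    using * by (simp add: special_proper_resolution_def proper_resolution_def syz_def)
qed

lemma cok_arr:
  assumes "M \<in> objs A"
  shows "cok (R M) i \<in> arrs A" "src A (cok (R M) i) = ch (R M) i"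
    "tgt A (cok (R M) i) = syz A (R M) i" "is_epi A (cok (R M) i)"
    "cok (R M) i \<cdot> dn (R M) i = mzero A (ch (R M) (Suc i)) (syz A (R M) i)"
  using cokerD[OF resolution(2)[OF assms]] complex_dn[OF proper_resolutionD(1)[OF resolution(1)[OF assms]]]
    coker_epi[OF resolution(2)[OF assms]]
  by (simp_all add: syz_def)

text \<open>The definite description in \<open>syz_seq\<close> is legitimate because
  \<open>cok\<close> is epi. The map is mono as the coimage map of the differential, and
  \<open>cok (R M) i\<close> is its cokernel because composing with an epi does not change what
  kills an arrow.\<close>

lemma inc:
  assumes "M \<in> objs A"
  shows "inc M i \<in> arrs A" "src A (inc M i) = syz A (R M) (Suc i)" "tgt A (inc M i) = ch (R M) i"
    "inc M i \<cdot> cok (R M) (Suc i) = dn (R M) i" "short_exact A (inc M i) (cok (R M) i)"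
    "syz_seq A (R M) i = (inc M i, cok (R M) i)"
proof -
  let ?P = "R M"
  note p = proper_resolutionD[OF resolution(1)[OF assms]]
  note C = complex_dn[OF p(1)] and c = cok_arr[OF assms] and r = resolution[OF assms]
  obtain j where j: "j \<in> arrs A" "src A j = syz A ?P (Suc i)" "tgt A j = ch ?P i"
    "j \<cdot> cok ?P (Suc i) = dn ?P i"
    using coker_desc[OF r(2)[of "Suc i"], of "dn ?P i"] C c(3) by auto
  have "(THE j. j \<in> Hom A (syz A ?P (Suc i)) (cob ?P (int i)) \<and> j \<cdot> cok ?P (Suc i) = dif ?P (int i + 1)) = j"
  proof (rule the_equality)
    show "j \<in> Hom A (syz A ?P (Suc i)) (cob ?P (int i)) \<and> j \<cdot> cok ?P (Suc i) = dif ?P (int i + 1)"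
      using j by (simp add: ch_def dn_def)
    fix j' assume "j' \<in> Hom A (syz A ?P (Suc i)) (cob ?P (int i)) \<and> j' \<cdot> cok ?P (Suc i) = dif ?P (int i + 1)"
    then have j': "j' \<in> arrs A" "src A j' = syz A ?P (Suc i)" "tgt A j' = ch ?P i"
      "j' \<cdot> cok ?P (Suc i) = dn ?P i"
      by (simp_all add: ch_def dn_def)
    show "j' = j"
      by (rule epi_cancel[OF c(4)[of "Suc i"]]) (use j j' c(3) in simp_all)
  qed
  then have eq: "inc M i = j" by (simp add: inc_def syz_seq_def)
  show "inc M i \<in> arrs A" "src A (inc M i) = syz A ?P (Suc i)" "tgt A (inc M i) = ch ?P i"
    "inc M i \<cdot> cok ?P (Suc i) = dn ?P i"
    using j eq by simp_all
  show "syz_seq A ?P i = (inc M i, cok ?P i)" by (simp add: inc_def syz_seq_def)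
  obtain q k where "is_coker A q (dn ?P (Suc i))" "is_ker A k q" and k: "is_ker A k (dn ?P i)"
    using p(7)[of i] by (auto simp: exact_at_def)
  \<comment> \<open>Exactness in degree \<open>i + 1\<close> identifies the kernel of
    \<open>dn\<close> with that of the next cokernel, so this cokernel is the coimage of
    \<open>dn\<close>.\<close>
  then have "is_ker A k (cok ?P (Suc i))" using ker_coker_unique r(2) by blast
  then have "is_coker A (cok ?P (Suc i)) k" using epi_is_coker_ker c(4) by blast
  then have "is_mono A j" using coimage_mono[OF k _ j(1)] j c(3) by simp
  moreover have "is_coker A (cok ?P i) j"
  proof (rule is_cokerI[OF c(4) j(1)])
    show "src A (cok ?P i) = tgt A j" using c j by simp
    have zero: "t \<cdot> j = mzero A (src A j) (tgt A t) \<longleftrightarrow> t \<cdot> dn ?P i = mzero A (ch ?P (Suc i)) (tgt A t)"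
      if t: "t \<in> arrs A" "src A t = ch ?P i" for t
    proof
      have *: "t \<cdot> dn ?P i = (t \<cdot> j) \<cdot> cok ?P (Suc i)"
        by (rule cmp_expand_right[OF j(4)]) (use t c j in simp_all)
      show "t \<cdot> dn ?P i = mzero A (ch ?P (Suc i)) (tgt A t)" if "t \<cdot> j = mzero A (src A j) (tgt A t)"
        unfolding * that using t c(1-3)[of "Suc i"] j by simp
      show "t \<cdot> j = mzero A (src A j) (tgt A t)" if "t \<cdot> dn ?P i = mzero A (ch ?P (Suc i)) (tgt A t)"
      proof -
        have "t \<cdot> j = mzero A (tgt A (cok ?P (Suc i))) (tgt A (t \<cdot> j))"
          by (rule epi_zero[OF c(4)[of "Suc i"]])
            (use *[symmetric] that t c(1-3)[of "Suc i"] j(1-3) in \<open>simp_all del: assoc\<close>)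
        then show ?thesis using t c(3)[of "Suc i"] j(1-3) by simp
      qed
    qed
    show "cok ?P i \<cdot> j = mzero A (src A j) (tgt A (cok ?P i))"
      using zero[of "cok ?P i"] c by simp
    fix t assume t: "t \<in> arrs A" "src A t = tgt A j" "t \<cdot> j = mzero A (src A j) (tgt A t)"
    then have "t \<cdot> dn ?P i = mzero A (src A (dn ?P i)) (tgt A t)" using zero[of t] j C by simp
    then obtain u where "u \<in> arrs A" "src A u = tgt A (cok ?P i)" "tgt A u = tgt A t" "u \<cdot> cok ?P i = t"
      using coker_desc[OF r(2)[of i], of t] t j C by auto
    then show "\<exists>u. u \<in> arrs A \<and> src A u = tgt A (cok ?P i) \<and> tgt A u = tgt A t \<and> u \<cdot> cok ?P i = t"
      by blast
  qed
  ultimately show "short_exact A (inc M i) (cok ?P i)"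
    unfolding eq short_exact_def using mono_is_ker_coker by blast
qed

lemma syz_precover:
  assumes "M \<in> objs A"
  shows "special_precover A W (syz A (R M) i) (inc M i, cok (R M) i)"
  using inc[OF assms] cok_arr[OF assms] resolution[OF assms] proper_resolutionD[OF resolution(1)[OF assms]]
  by (simp add: special_precover_def)

lemma syz_objs: "M \<in> objs A \<Longrightarrow> syz A (R M) i \<in> objs A"
  using cok_arr(1,3) arr_objs(2) by metis

end

section \<open>Dimension shifting\<close>

text \<open>
  For an extension \<open>0 \<rightarrow> K \<rightarrow> E \<rightarrow> N \<rightarrow> 0\<close> given by \<open>(k, p)\<close>, this is the graph on cocycles of the connecting
  map from \<open>H\<^sup>m(Hom(H, N))\<close> to \<open>H\<^sup>m\<^sup>+\<^sup>1(Hom(H, K))\<close>. Using the relation avoids choosing the lift \<open>b\<close>.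
\<close>

definition shift_rel :: "('o, 'm, 'z) cat_scheme \<Rightarrow> ('o, 'm, 'y) cplx_scheme \<Rightarrow> 'm \<Rightarrow> 'm \<Rightarrow> int
    \<Rightarrow> 'm \<Rightarrow> 'm \<Rightarrow> bool" where
  "shift_rel A H k p m c c' \<longleftrightarrow> c \<in> cocycles A H (tgt A p) m \<and> c' \<in> cocycles A H (src A k) (m + 1) \<and>
     (\<exists>b \<in> Hom A (cob H m) (tgt A k). p \<cdot>\<^bsub>A\<^esub> b = c \<and> b \<cdot>\<^bsub>A\<^esub> dif H (m + 1) = k \<cdot>\<^bsub>A\<^esub> c')"

lemma cocycles_iff:
  "f \<in> cocycles A H X m \<longleftrightarrow> f \<in> arrs A \<and> src A f = cob H m \<and> tgt A f = X \<and>
    f \<cdot>\<^bsub>A\<^esub> dif H (m + 1) = mzero A (cob H (m + 1)) X"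
  by (auto simp: cocycles_def kernel_def)

lemma coboundaries_iff:
  "f \<in> coboundaries A H X m \<longleftrightarrow>
    (\<exists>g. g \<in> arrs A \<and> src A g = cob H (m - 1) \<and> tgt A g = X \<and> f = g \<cdot>\<^bsub>A\<^esub> dif H m)"
  by (auto simp: coboundaries_def)

context additive_subcategory_of
begin

lemma acyclic_complex: "totally_acyclic A W H \<Longrightarrow> is_complex A H"
  by (simp add: totally_acyclic_def)

lemma acyclic_W: "totally_acyclic A W H \<Longrightarrow> cob H n \<in> W"
  by (simp add: totally_acyclic_def)

lemma acyclic_cocycle:
  assumes "totally_acyclic A W H" "X \<in> W" "f \<in> cocycles A H X m"
  shows "f \<in> coboundaries A H X m"
proof -
  note C = complex_dif[OF acyclic_complex[OF assms(1)]]
  have "Hom_to_exact_at A X (dif H (m + 1)) (dif H m)"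
    using assms(1,2) by (simp add: totally_acyclic_def)
  then show ?thesis
    using assms(3) C unfolding Hom_to_exact_at_def coboundaries_def cocycles_def by simp
qed

section \<open>Cocycles, coboundaries and cohomology classes of Hom complexes\<close>

context
  fixes H :: "('a, 'b, 'y) cplx_scheme"
  assumes H: "is_complex A H"
begin

lemma cobdryD:
  assumes "f \<in> coboundaries A H X m"
  shows "f \<in> cocycles A H X m"
proof -
  note C = complex_dif[OF H]
  obtain g where g: "g \<in> arrs A" "src A g = cob H (m - 1)" "tgt A g = X" "f = g \<cdot> dif H m"
    using assms unfolding coboundaries_iff by blast
  have "X \<in> objs A" using g arr_objs by blast
  then show ?thesis using g C by (simp add: cocycles_iff)
qed

lemma madd_cocycles:
  assumes "f \<in> cocycles A H X m" "g \<in> cocycles A H X m"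
  shows "madd A f g \<in> cocycles A H X m"
proof -
  have "X \<in> objs A" using assms arr_objs by (auto simp: cocycles_iff)
  then show ?thesis using assms complex_dif[OF H] by (simp add: cocycles_iff)
qed

lemma mneg_cocycles:
  assumes "f \<in> cocycles A H X m"
  shows "mneg A f \<in> cocycles A H X m"
proof -
  have "X \<in> objs A" using assms arr_objs by (auto simp: cocycles_iff)
  then show ?thesis using assms complex_dif[OF H] by (simp add: cocycles_iff)
qed

lemma madd_coboundaries:
  assumes "f \<in> coboundaries A H X m" "g \<in> coboundaries A H X m"
  shows "madd A f g \<in> coboundaries A H X m"
proof -
  obtain a where a: "a \<in> arrs A" "src A a = cob H (m - 1)" "tgt A a = X" "f = a \<cdot> dif H m"
    using assms(1) unfolding coboundaries_iff by blast
  obtain b where b: "b \<in> arrs A" "src A b = cob H (m - 1)" "tgt A b = X" "g = b \<cdot> dif H m"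
    using assms(2) unfolding coboundaries_iff by blast
  show ?thesis
    unfolding coboundaries_iff using a b complex_dif[OF H] by (intro exI[of _ "madd A a b"]) simp
qed

lemma mneg_coboundaries:
  assumes "f \<in> coboundaries A H X m"
  shows "mneg A f \<in> coboundaries A H X m"
proof -
  obtain a where a: "a \<in> arrs A" "src A a = cob H (m - 1)" "tgt A a = X" "f = a \<cdot> dif H m"
    using assms(1) unfolding coboundaries_iff by blast
  show ?thesis
    unfolding coboundaries_iff using a complex_dif[OF H] by (intro exI[of _ "mneg A a"]) simp
qed

lemma coboundaries_subgroup:
  assumes "X \<in> objs A"
  shows "subgroup (coboundaries A H X m) (Hom_group A (cob H m) X)"
proof
  note C = complex_dif[OF H]
  show "coboundaries A H X m \<subseteq> carrier (Hom_group A (cob H m) X)"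
    using cobdryD by (auto simp: cocycles_iff)
  show "\<one>\<^bsub>Hom_group A (cob H m) X\<^esub> \<in> coboundaries A H X m"
    unfolding coboundaries_iff using assms C by (intro exI[of _ "mzero A (cob H (m - 1)) X"]) simp
  show "inv\<^bsub>Hom_group A (cob H m) X\<^esub> f \<in> coboundaries A H X m" if "f \<in> coboundaries A H X m" for f
    using mneg_coboundaries[OF that] cobdryD[OF that] by (simp add: cocycles_iff)
qed (use madd_coboundaries in auto)

lemma zero_coboundary:
  assumes "X \<in> objs A"
  shows "mzero A (cob H m) X \<in> coboundaries A H X m"
  using subgroup.one_closed[OF coboundaries_subgroup[OF assms]] by simp

lemma coboundaries_cmp:
  assumes "f \<in> coboundaries A H X m" "g \<in> arrs A" "src A g = X"
  shows "g \<cdot> f \<in> coboundaries A H (tgt A g) m"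
proof -
  obtain a where a: "a \<in> arrs A" "src A a = cob H (m - 1)" "tgt A a = X" "f = a \<cdot> dif H m"
    using assms(1) unfolding coboundaries_iff by blast
  show ?thesis
    unfolding coboundaries_iff using a assms(2,3) complex_dif[OF H] by (intro exI[of _ "g \<cdot> a"]) simp
qed

lemma cocycles_cmp:
  assumes "f \<in> cocycles A H X m" "g \<in> arrs A" "src A g = X"
  shows "g \<cdot> f \<in> cocycles A H (tgt A g) m"
  using assms complex_dif[OF H] by (simp add: cocycles_iff)

lemma cohomology_class_eq_iff:
  assumes "f \<in> cocycles A H X m" "g \<in> cocycles A H X m"
  shows "cohomology_class A H X m f = cohomology_class A H X m g \<longleftrightarrow>
    madd A f (mneg A g) \<in> coboundaries A H X m"
proof -
  have fg: "f \<in> arrs A" "src A f = cob H m" "tgt A f = X" "g \<in> arrs A" "src A g = cob H m" "tgt A g = X"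
    using assms by (auto simp: cocycles_iff)
  then interpret comm_group "Hom_group A (cob H m) X" using Hom_group_arr[of f] by simp
  have "X \<in> objs A" using fg arr_objs by blast
  then show ?thesis
    using coset_eq_iff[OF coboundaries_subgroup, where x = f and y = g] fg by (simp add: cohomology_class_def)
qed

lemma cohomology_class_mem:
  assumes "f \<in> cocycles A H X m"
  shows "f \<in> cohomology_class A H X m f"
    "g \<in> cohomology_class A H X m f \<Longrightarrow> g \<in> cocycles A H X m \<and>
      cohomology_class A H X m g = cohomology_class A H X m f"
proof -
  have f: "f \<in> arrs A" "src A f = cob H m" "tgt A f = X"
    using assms by (auto simp: cocycles_iff)
  then interpret comm_group "Hom_group A (cob H m) X" using Hom_group_arr[of f] by simp
  have "X \<in> objs A" using f arr_objs by blast
  note sub = coboundaries_subgroup[OF this, of m]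
  show "f \<in> cohomology_class A H X m f"
    using rcos_self[OF _ sub] f by (simp add: cohomology_class_def)
  assume g: "g \<in> cohomology_class A H X m f"
  then obtain x where x: "x \<in> coboundaries A H X m" "g = madd A x f"
    by (auto simp: cohomology_class_def r_coset_def)
  then have "g \<in> cocycles A H X m" using assms cobdryD madd_cocycles by blast
  moreover have "coboundaries A H X m #>\<^bsub>Hom_group A (cob H m) X\<^esub> g =
      coboundaries A H X m #>\<^bsub>Hom_group A (cob H m) X\<^esub> f"
    using repr_independence[OF _ _ sub, of g f] g f by (simp add: cohomology_class_def)
  ultimately show "g \<in> cocycles A H X m \<and> cohomology_class A H X m g = cohomology_class A H X m f"
    by (simp add: cohomology_class_def)
qed

lemma Hom_cohomology_carrier:
  "carrier (Hom_cohomology A H X m) = cohomology_class A H X m ` cocycles A H X m"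
  by (auto simp: Hom_cohomology_def FactGroup_def RCOSETS_def cohomology_class_def r_coset_def)

lemma Hom_cohomology_mult:
  assumes "f \<in> cocycles A H X m" "g \<in> cocycles A H X m"
  shows "cohomology_class A H X m f \<otimes>\<^bsub>Hom_cohomology A H X m\<^esub> cohomology_class A H X m g =
    cohomology_class A H X m (madd A f g)"
proof -
  have fg: "f \<in> arrs A" "src A f = cob H m" "tgt A f = X" "g \<in> arrs A" "src A g = cob H m" "tgt A g = X"
    using assms by (auto simp: cocycles_iff)
  then interpret comm_group "Hom_group A (cob H m) X" using Hom_group_arr[of f] by simp
  have "X \<in> objs A" using fg arr_objs by blast
  then interpret normal "coboundaries A H X m" "Hom_group A (cob H m) X"
    using normal_iff_subgroup coboundaries_subgroup by blast
  show ?thesis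
    using rcos_sum[of f g] fg
    by (simp add: Hom_cohomology_def FactGroup_def cohomology_class_def set_mult_def)
qed

end

section \<open>The connecting isomorphism attached to a special precover\<close>

lemma shift_rel_madd:
  assumes H: "is_complex A H" and "short_exact A k p"
    "shift_rel A H k p m c c'" "shift_rel A H k p m d d'"
  shows "shift_rel A H k p m (madd A c d) (madd A c' d')"
proof -
  note P = short_exact_arr[OF assms(2)]
  obtain b where b: "b \<in> arrs A" "src A b = cob H m" "tgt A b = tgt A k" "p \<cdot> b = c"
    "b \<cdot> dif H (m + 1) = k \<cdot> c'" using assms(3) by (auto simp: shift_rel_def)
  obtain e where e: "e \<in> arrs A" "src A e = cob H m" "tgt A e = tgt A k" "p \<cdot> e = d"
    "e \<cdot> dif H (m + 1) = k \<cdot> d'" using assms(4) by (auto simp: shift_rel_def)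
  have cd: "c' \<in> arrs A" "src A c' = cob H (m + 1)" "tgt A c' = src A k"
    "d' \<in> arrs A" "src A d' = cob H (m + 1)" "tgt A d' = src A k"
    using assms(3,4) by (auto simp: shift_rel_def cocycles_iff)
  have "\<exists>x \<in> Hom A (cob H m) (tgt A k). p \<cdot> x = madd A c d \<and> x \<cdot> dif H (m + 1) = k \<cdot> madd A c' d'"
    using b e P cd complex_dif[OF H] by (intro bexI[of _ "madd A b e"]) simp_all
  then show ?thesis using assms madd_cocycles[OF H] by (simp add: shift_rel_def)
qed

lemma shift_rel_mneg:
  assumes H: "is_complex A H" and "short_exact A k p" "shift_rel A H k p m c c'"
  shows "shift_rel A H k p m (mneg A c) (mneg A c')"
proof -
  note P = short_exact_arr[OF assms(2)]
  obtain b where b: "b \<in> arrs A" "src A b = cob H m" "tgt A b = tgt A k" "p \<cdot> b = c"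
    "b \<cdot> dif H (m + 1) = k \<cdot> c'" using assms(3) by (auto simp: shift_rel_def)
  have c: "c' \<in> arrs A" "src A c' = cob H (m + 1)" "tgt A c' = src A k"
    using assms(3) by (auto simp: shift_rel_def cocycles_iff)
  have "\<exists>x \<in> Hom A (cob H m) (tgt A k). p \<cdot> x = mneg A c \<and> x \<cdot> dif H (m + 1) = k \<cdot> mneg A c'"
    using b P c complex_dif[OF H] by (intro bexI[of _ "mneg A b"]) simp_all
  then show ?thesis using assms mneg_cocycles[OF H] by (simp add: shift_rel_def)
qed

context
  fixes H :: "('a, 'b, 'y) cplx_scheme" and N k p
  assumes acyclic: "totally_acyclic A W H" and precover: "special_precover A W N (k, p)"
begin

text \<open>The usual construction of a connecting map: orthogonality lifts \<open>c\<close> to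
  \<open>b\<close> along \<open>p\<close>, and the differential of \<open>b\<close> lands in the
  kernel because \<open>c\<close> is a cocycle.\<close>

lemma shift_rel_total:
  assumes c: "c \<in> cocycles A H (tgt A p) m"
  shows "\<exists>c'. shift_rel A H k p m c c'"
proof -
  have E: "short_exact A k p" using precover by (simp add: special_precover_def)
  note P = short_exact_arr[OF E] and C = complex_dif[OF acyclic_complex[OF acyclic]]
  note c' = c[unfolded cocycles_iff]
  obtain b where b: "b \<in> arrs A" "src A b = cob H m" "tgt A b = tgt A k" "p \<cdot> b = c"
    by (rule precover_lift[OF precover acyclic_W[OF acyclic], of c m]) (use c' in simp_all)
  have "p \<cdot> (b \<cdot> dif H (m + 1)) = c \<cdot> dif H (m + 1)"
    by (rule cmp_reduce[OF b(4)]) (use b C P in simp_all)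
  then obtain x where x: "x \<in> arrs A" "src A x = cob H (m + 1)" "tgt A x = src A k"
    "k \<cdot> x = b \<cdot> dif H (m + 1)"
    using ker_lift[OF short_exactD(1)[OF E], of "b \<cdot> dif H (m + 1)"] b C P c' by auto
  have d: "tgt A (dif H (m + 1 + 1)) = cob H (m + 1)" using C(3)[of "m + 1 + 1"] by (simp add: add.commute)
  have "k \<cdot> (x \<cdot> dif H (m + 1 + 1)) = (b \<cdot> dif H (m + 1)) \<cdot> dif H (m + 1 + 1)"
    by (rule cmp_reduce[OF x(4)]) (use x d C(1,2,5) P in simp_all)
  also have "\<dots> = b \<cdot> (dif H (m + 1) \<cdot> dif H (m + 1 + 1))"
    using b d C(1,2,5) C(3)[of "m + 1"] by simp
  also have "\<dots> = mzero A (cob H (m + 1 + 1)) (tgt A k)"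
    unfolding C(4) using b C(5) by simp
  finally have "x \<cdot> dif H (m + 1 + 1) = mzero A (src A (x \<cdot> dif H (m + 1 + 1))) (src A k)"
    using x d C(1,2,5) by (intro mono_zero[OF short_exact_mono_epi(1)[OF E]]) simp_all
  then have "x \<in> cocycles A H (src A k) (m + 1)" using x d C(1,2,5) by (simp add: cocycles_iff)
  then show ?thesis
    unfolding shift_rel_def using c b x by (intro exI[of _ x] conjI bexI[of _ b]) simp_all
qed

text \<open>Here the middle object of the precover enters: \<open>k \<cdot> c'\<close> is a cocycle
  with values in \<open>W\<close>, hence a coboundary \<open>b \<cdot> dif H (m + 1)\<close>, and
  \<open>p \<cdot> b\<close> is the preimage.\<close>

lemma shift_rel_surj:
  assumes c: "c' \<in> cocycles A H (src A k) (m + 1)"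
  shows "\<exists>c. shift_rel A H k p m c c'"
proof -
  have E: "short_exact A k p" "src A p \<in> W" using precover by (simp_all add: special_precover_def)
  note P = short_exact_arr[OF E(1)] and C = complex_dif[OF acyclic_complex[OF acyclic]]
  have "k \<cdot> c' \<in> cocycles A H (src A p) (m + 1)"
    using cocycles_cmp[OF acyclic_complex[OF acyclic] c, of k] P by simp
  then have "k \<cdot> c' \<in> coboundaries A H (src A p) (m + 1)" by (rule acyclic_cocycle[OF acyclic E(2)])
  then obtain b where b: "b \<in> arrs A" "src A b = cob H m" "tgt A b = tgt A k"
    "k \<cdot> c' = b \<cdot> dif H (m + 1)" using P by (auto simp: coboundaries_iff)
  have "p \<cdot> (b \<cdot> dif H (m + 1)) = (p \<cdot> k) \<cdot> c'"
    unfolding b(4)[symmetric] using P(1-3) c by (simp add: cocycles_iff)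
  also have "\<dots> = mzero A (cob H (m + 1)) (tgt A p)"
    unfolding P(4) using c P(2) by (simp add: cocycles_iff)
  finally have "p \<cdot> b \<in> cocycles A H (tgt A p) m" using b P C by (simp add: cocycles_iff)
  then show ?thesis using b c by (intro exI[of _ "p \<cdot> b"]) (auto simp: shift_rel_def)
qed

text \<open>One direction makes the connecting map well defined on cohomology, by lifting a bounding
  map \<open>g\<close> along \<open>p\<close>. The other makes it injective:
  \<open>b - k \<cdot> r\<close> is a cocycle with values in \<open>W\<close>, so it bounds, and
  \<open>p\<close> carries this over to \<open>c\<close>.\<close>

lemma shift_rel_coboundaries:
  assumes "shift_rel A H k p m c c'"
  shows "c \<in> coboundaries A H (tgt A p) m \<longleftrightarrow> c' \<in> coboundaries A H (src A k) (m + 1)"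
proof
  have E: "short_exact A k p" "src A p \<in> W" using precover by (simp_all add: special_precover_def)
  note P = short_exact_arr[OF E(1)] and C = complex_dif[OF acyclic_complex[OF acyclic]]
  obtain b where b: "b \<in> arrs A" "src A b = cob H m" "tgt A b = tgt A k" "p \<cdot> b = c"
    "b \<cdot> dif H (m + 1) = k \<cdot> c'" using assms by (auto simp: shift_rel_def)
  have c: "c \<in> arrs A" "src A c = cob H m" "tgt A c = tgt A p"
    and c': "c' \<in> arrs A" "src A c' = cob H (m + 1)" "tgt A c' = src A k"
    using assms by (auto simp: shift_rel_def cocycles_iff)
  {
    assume "c \<in> coboundaries A H (tgt A p) m"
    then obtain g where g: "g \<in> arrs A" "src A g = cob H (m - 1)" "tgt A g = tgt A p"
      "c = g \<cdot> dif H m" unfolding coboundaries_iff by blast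
    obtain e where e: "e \<in> arrs A" "src A e = cob H (m - 1)" "tgt A e = tgt A k" "p \<cdot> e = g"
      by (rule precover_lift[OF precover acyclic_W[OF acyclic], of g "m - 1"]) (use g in simp_all)
    define x where "x = madd A b (mneg A (e \<cdot> dif H m))"
    have x: "x \<in> arrs A" "src A x = cob H m" "tgt A x = tgt A k"
      using b e C by (simp_all add: x_def)
    have "p \<cdot> (e \<cdot> dif H m) = c"
      unfolding g(4) by (rule cmp_reduce[OF e(4)]) (use e P C in simp_all)
    then have "p \<cdot> x = mzero A (src A x) (tgt A p)"
      using b e C P c x by (simp add: x_def)
    then obtain r where r: "r \<in> arrs A" "src A r = cob H m" "tgt A r = src A k" "k \<cdot> r = x"
      using ker_lift[OF short_exactD(1)[OF E(1)], of x] x P by auto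
    have "k \<cdot> (r \<cdot> dif H (m + 1)) = x \<cdot> dif H (m + 1)"
      by (rule cmp_reduce[OF r(4)]) (use r P C in simp_all)
    also have "\<dots> = k \<cdot> c'"
      using b e C c' P C(5)[of "m + 1"] by (simp add: x_def)
    finally have "r \<cdot> dif H (m + 1) = c'"
      by (rule mono_cancel[OF short_exact_mono_epi(1)[OF E(1)], rotated -1])
        (use r P C c' in simp_all)
    then show "c' \<in> coboundaries A H (src A k) (m + 1)"
      unfolding coboundaries_iff using r by auto
  next
    assume "c' \<in> coboundaries A H (src A k) (m + 1)"
    then obtain r where r: "r \<in> arrs A" "src A r = cob H m" "tgt A r = src A k"
      "c' = r \<cdot> dif H (m + 1)" by (auto simp: coboundaries_iff)
    define x where "x = madd A b (mneg A (k \<cdot> r))"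
    have x: "x \<in> arrs A" "src A x = cob H m" "tgt A x = src A p"
      using b r P by (simp_all add: x_def)
    have "x \<cdot> dif H (m + 1) = madd A (k \<cdot> c') (mneg A (k \<cdot> c'))"
      using b r(1-3) P C by (simp add: x_def r(4))
    then have "x \<in> cocycles A H (src A p) m"
      using x c' P by (simp add: cocycles_iff)
    then obtain e where e: "e \<in> arrs A" "src A e = cob H (m - 1)" "tgt A e = src A p" "x = e \<cdot> dif H m"
      using acyclic_cocycle[OF acyclic E(2)] unfolding coboundaries_iff by blast
    have "p \<cdot> (k \<cdot> r) = (p \<cdot> k) \<cdot> r" using P(1-3) r(1-3) by simp
    then have "p \<cdot> x = c"
      using b r(1-3) P c C(5) by (simp add: x_def)
    then have "c = (p \<cdot> e) \<cdot> dif H m" using e P C by simp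
    then show "c \<in> coboundaries A H (tgt A p) m"
      unfolding coboundaries_iff using e P by (intro exI[of _ "p \<cdot> e"]) simp
  }
qed

end

end

context syzygies
begin

text \<open>The composite of \<open>i\<close> connecting relations, from degree \<open>m\<close> to
  degree \<open>m + i\<close>. The cocycle condition at 0 keeps it a relation between
  cocycles.\<close>

primrec shift_iter where
  "shift_iter H N m 0 c c' \<longleftrightarrow> c = c' \<and> c \<in> cocycles A H (syz A (R N) 0) m"
| "shift_iter H N m (Suc i) c c' \<longleftrightarrow>
    (\<exists>d. shift_iter H N m i c d \<and> shift_rel A H (inc N i) (cok (R N) i) (m + int i) d c')"

lemma shift_iter_cocycles:
  assumes "N \<in> objs A" "shift_iter H N m i c c'"
  shows "c \<in> cocycles A H N m" "c' \<in> cocycles A H (syz A (R N) i) (m + int i)"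
  using assms(2)
proof (induction i arbitrary: c')
  case 0
  { case 1 then show ?case using resolution(4)[OF assms(1)] by auto
  next case 2 then show ?case by auto }
next
  case (Suc i)
  have deg: "m + int (Suc i) = m + int i + 1" by simp
  { case 1 then show ?case using Suc by auto
  next case 2 then show ?case unfolding deg using inc[OF assms(1)] by (auto simp: shift_rel_def) }
qed

lemma shift_iter_madd:
  assumes "is_complex A H" "N \<in> objs A" "shift_iter H N m i c c'" "shift_iter H N m i d d'"
  shows "shift_iter H N m i (madd A c d) (madd A c' d')"
  using assms(3,4)
proof (induction i arbitrary: c' d')
  case 0 then show ?case using madd_cocycles[OF assms(1)] by auto
next
  case (Suc i) then show ?case using shift_rel_madd[OF assms(1) inc(5)[OF assms(2)]] by auto blast
qed

lemma shift_iter_mneg: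
  assumes "is_complex A H" "N \<in> objs A" "shift_iter H N m i c c'"
  shows "shift_iter H N m i (mneg A c) (mneg A c')"
  using assms(3)
proof (induction i arbitrary: c')
  case 0 then show ?case using mneg_cocycles[OF assms(1)] by auto
next
  case (Suc i) then show ?case using shift_rel_mneg[OF assms(1) inc(5)[OF assms(2)]] by auto blast
qed

lemma shift_iter_total:
  assumes "totally_acyclic A W H" "N \<in> objs A" "c \<in> cocycles A H N m"
  shows "\<exists>c'. shift_iter H N m i c c'"
proof (induction i)
  case 0 then show ?case using assms resolution(4) by simp
next
  case (Suc i)
  then obtain c' where c': "shift_iter H N m i c c'" by blast
  have "c' \<in> cocycles A H (tgt A (cok (R N) i)) (m + int i)"
    using shift_iter_cocycles(2)[OF assms(2) c'] cok_arr(3)[OF assms(2)] by simp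
  then show ?case
    using shift_rel_total[OF assms(1) syz_precover[OF assms(2)]] c' by auto blast
qed

lemma shift_iter_surj:
  assumes "totally_acyclic A W H" "N \<in> objs A" "c' \<in> cocycles A H (syz A (R N) i) (m + int i)"
  shows "\<exists>c. shift_iter H N m i c c'"
  using assms(3)
proof (induction i arbitrary: c')
  case 0 then show ?case by auto
next
  case (Suc i)
  have deg: "m + int (Suc i) = m + int i + 1" by simp
  have "c' \<in> cocycles A H (src A (inc N i)) (m + int i + 1)"
    using Suc.prems inc(2)[OF assms(2)] unfolding deg by simp
  then obtain d where d: "shift_rel A H (inc N i) (cok (R N) i) (m + int i) d c'"
    using shift_rel_surj[OF assms(1) syz_precover[OF assms(2)]] by blast
  then have "d \<in> cocycles A H (syz A (R N) i) (m + int i)"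
    using cok_arr(3)[OF assms(2)] by (simp add: shift_rel_def)
  then show ?case using Suc.IH d by auto blast
qed

lemma shift_iter_coboundaries:
  assumes "totally_acyclic A W H" "N \<in> objs A" "shift_iter H N m i c c'"
  shows "c \<in> coboundaries A H N m \<longleftrightarrow> c' \<in> coboundaries A H (syz A (R N) i) (m + int i)"
  using assms(3)
proof (induction i arbitrary: c')
  case 0 then show ?case using resolution(4)[OF assms(2)] by auto
next
  case (Suc i)
  have deg: "m + int (Suc i) = m + int i + 1" by simp
  obtain d where d: "shift_iter H N m i c d" "shift_rel A H (inc N i) (cok (R N) i) (m + int i) d c'"
    using Suc.prems by auto
  show ?case
    using Suc.IH[OF d(1)] shift_rel_coboundaries[OF assms(1) syz_precover[OF assms(2)] d(2)]
      cok_arr(3)[OF assms(2)] inc(2)[OF assms(2)] unfolding deg by simp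
qed

end

section \<open>Sequential colimits and functoriality of syzygies\<close>

text \<open>A criterion for recognising a colimit: \<open>\<Phi>\<close> is a multiplicative cocone
  into \<open>H\<close> whose components are bijections from some stage on. Earlier components may
  be neither injective nor surjective.\<close>

locale sequential_target =
  fixes s :: nat and G :: "nat \<Rightarrow> 'a monoid" and t :: "nat \<Rightarrow> 'a \<Rightarrow> 'a"
    and H :: "('b, 'c) monoid_scheme" and \<Phi> :: "nat \<Rightarrow> 'a \<Rightarrow> 'b"
  assumes mult_closed: "\<lbrakk>s \<le> i; x \<in> carrier (G i); y \<in> carrier (G i)\<rbrakk> \<Longrightarrow> x \<otimes>\<^bsub>G i\<^esub> y \<in> carrier (G i)"
    and step: "\<lbrakk>s \<le> i; x \<in> carrier (G i)\<rbrakk> \<Longrightarrow> t i x \<in> carrier (G (Suc i)) \<and> \<Phi> (Suc i) (t i x) = \<Phi> i x"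
    and hom_mult: "\<lbrakk>s \<le> i; x \<in> carrier (G i); y \<in> carrier (G i)\<rbrakk> \<Longrightarrow>
      \<Phi> i (x \<otimes>\<^bsub>G i\<^esub> y) = \<Phi> i x \<otimes>\<^bsub>H\<^esub> \<Phi> i y"
    and hom_closed: "\<lbrakk>s \<le> i; x \<in> carrier (G i)\<rbrakk> \<Longrightarrow> \<Phi> i x \<in> carrier H"
    and eventually_bij: "\<exists>K. \<forall>i\<ge>K. inj_on (\<Phi> i) (carrier (G i)) \<and> carrier H \<subseteq> \<Phi> i ` carrier (G i)"
begin

definition colim_map :: "(nat \<times> 'a) set \<Rightarrow> 'b" where
  "colim_map = induced (\<lambda>(i, x). \<Phi> i x)"

lemma seq_map_step:
  assumes "s \<le> i" "x \<in> carrier (G i)"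
  shows "seq_map t i m x \<in> carrier (G (i + m)) \<and> \<Phi> (i + m) (seq_map t i m x) = \<Phi> i x"
  using step assms by (induction m) auto

text \<open>Each colimit class is a whole fibre of \<open>\<Phi>\<close>: two elements with equal
  values coincide once both are moved to a stage where \<open>\<Phi>\<close> is injective.
  Everything else about the colimit is deduced from this.\<close>

lemma colim_class_eq:
  assumes "s \<le> i" "x \<in> carrier (G i)"
  shows "colim_class s G t i x = {(j, y). s \<le> j \<and> y \<in> carrier (G j) \<and> \<Phi> j y = \<Phi> i x}"
proof -
  have "(\<exists>k. i \<le> k \<and> j \<le> k \<and> seq_map t i (k - i) x = seq_map t j (k - j) y) \<longleftrightarrow> \<Phi> j y = \<Phi> i x"
    if "s \<le> j" "y \<in> carrier (G j)" for j y
  proof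
    assume "\<exists>k. i \<le> k \<and> j \<le> k \<and> seq_map t i (k - i) x = seq_map t j (k - j) y"
    then show "\<Phi> j y = \<Phi> i x"
      using seq_map_step[OF assms] seq_map_step[OF that] by (metis le_add_diff_inverse)
  next
    assume eq: "\<Phi> j y = \<Phi> i x"
    obtain K where K: "inj_on (\<Phi> k) (carrier (G k))" if "k \<ge> K" for k
      using eventually_bij by blast
    define k where "k = Max {i, j, K}"
    have k: "i \<le> k" "j \<le> k" "K \<le> k" by (simp_all add: k_def)
    have "seq_map t i (k - i) x = seq_map t j (k - j) y"
      using inj_onD[OF K[OF k(3)]] seq_map_step[OF assms, of "k - i"] seq_map_step[OF that, of "k - j"] k eq
      by simp
    then show "\<exists>k. i \<le> k \<and> j \<le> k \<and> seq_map t i (k - i) x = seq_map t j (k - j) y"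
      using k by blast
  qed
  then show ?thesis
    using assms unfolding colim_class_def colim_rel_def by auto
qed

lemma colim_class_mem: "s \<le> i \<Longrightarrow> x \<in> carrier (G i) \<Longrightarrow> (i, x) \<in> colim_class s G t i x"
  by (simp add: colim_class_eq)

lemma colim_map_class:
  assumes "s \<le> i" "x \<in> carrier (G i)"
  shows "colim_map (colim_class s G t i x) = \<Phi> i x"
proof -
  have "(\<lambda>(i, x). \<Phi> i x) ` colim_class s G t i x = {\<Phi> i x}"
    using colim_class_mem[OF assms] by (force simp: colim_class_eq[OF assms])
  then show ?thesis by (simp add: colim_map_def induced_def)
qed

lemma colim_carrierE:
  assumes "c \<in> carrier (seq_colim s G t)"
  obtains i x where "s \<le> i" "x \<in> carrier (G i)" "c = colim_class s G t i x"
    "c = {(j, y). s \<le> j \<and> y \<in> carrier (G j) \<and> \<Phi> j y = colim_map c}"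
proof -
  obtain i x where *: "s \<le> i" "x \<in> carrier (G i)" "c = colim_class s G t i x"
    using assms by (auto simp: seq_colim_def)
  have "colim_map c = \<Phi> i x" using colim_map_class[OF *(1,2)] *(3) by simp
  then have "c = {(j, y). s \<le> j \<and> y \<in> carrier (G j) \<and> \<Phi> j y = colim_map c}"
    using trans[OF *(3) colim_class_eq[OF *(1,2)]] by simp
  then show thesis by (rule that[OF *])
qed

lemma colim_map_closed:
  assumes "c \<in> carrier (seq_colim s G t)"
  shows "colim_map c \<in> carrier H"
proof -
  obtain i x where "s \<le> i" "x \<in> carrier (G i)" "c = colim_class s G t i x"
    using colim_carrierE[OF assms] .
  then show ?thesis using colim_map_class[of i x] hom_closed[of i x] by simp
qed

lemma colim_classI: "s \<le> i \<Longrightarrow> x \<in> carrier (G i) \<Longrightarrow> colim_class s G t i x \<in> carrier (seq_colim s G t)"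
  by (auto simp: seq_colim_def)

lemma colim_class_value:
  assumes "c \<in> carrier (seq_colim s G t)" "s \<le> i" "x \<in> carrier (G i)" "\<Phi> i x = colim_map c"
  shows "colim_class s G t i x = c"
  by (rule colim_carrierE[OF assms(1)]) (simp add: colim_class_eq[OF assms(2,3)] assms(4))

lemma colim_mult:
  assumes "c \<in> carrier (seq_colim s G t)" "d \<in> carrier (seq_colim s G t)"
  shows "c \<otimes>\<^bsub>seq_colim s G t\<^esub> d \<in> carrier (seq_colim s G t)"
    "colim_map (c \<otimes>\<^bsub>seq_colim s G t\<^esub> d) = colim_map c \<otimes>\<^bsub>H\<^esub> colim_map d"
proof -
  obtain i x where x: "s \<le> i" "x \<in> carrier (G i)" "c = colim_class s G t i x"
    and c: "c = {(j, y). s \<le> j \<and> y \<in> carrier (G j) \<and> \<Phi> j y = colim_map c}"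
    using colim_carrierE[OF assms(1)] .
  obtain j y where y: "s \<le> j" "y \<in> carrier (G j)" "d = colim_class s G t j y"
    and d: "d = {(j, y). s \<le> j \<and> y \<in> carrier (G j) \<and> \<Phi> j y = colim_map d}"
    using colim_carrierE[OF assms(2)] .
  \<comment> \<open>Stage \<open>i + j\<close> is reached from \<open>i\<close> in \<open>j\<close>
    steps and from \<open>j\<close> in \<open>i\<close> steps.\<close>
  define k where "k = i + j"
  define z where "z = seq_map t i j x \<otimes>\<^bsub>G k\<^esub> seq_map t j i y"
  have k: "s \<le> k" using x by (simp add: k_def)
  have xk: "seq_map t i j x \<in> carrier (G k)" "\<Phi> k (seq_map t i j x) = colim_map c"
    and yk: "seq_map t j i y \<in> carrier (G k)" "\<Phi> k (seq_map t j i y) = colim_map d"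
    using seq_map_step[OF x(1,2), of j] seq_map_step[OF y(1,2), of i] colim_map_class x y
    by (simp_all add: k_def add.commute)
  have z: "z \<in> carrier (G k)" "\<Phi> k z = colim_map c \<otimes>\<^bsub>H\<^esub> colim_map d"
    using mult_closed hom_mult xk yk k by (simp_all add: z_def)
  \<comment> \<open>The product in \<open>seq_colim\<close> is a union over all pairs of
    representatives with a common index; all of them yield the same class, so the union is that
    class.\<close>
  have "colim_class s G t l (a \<otimes>\<^bsub>G l\<^esub> b) = colim_class s G t k z" if "(l, a) \<in> c" "(l, b) \<in> d" for l a b
  proof -
    have "s \<le> l" "a \<in> carrier (G l)" "b \<in> carrier (G l)" "\<Phi> l a = colim_map c" "\<Phi> l b = colim_map d"
      using that c d by blast+
    then show ?thesis
      using z k mult_closed hom_mult by (simp add: colim_class_eq)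
  qed
  moreover have "(k, seq_map t i j x) \<in> c" using c xk k by blast
  moreover have "(k, seq_map t j i y) \<in> d" using d yk k by blast
  ultimately have "{colim_class s G t l (a \<otimes>\<^bsub>G l\<^esub> b) |l a b. (l, a) \<in> c \<and> (l, b) \<in> d} =
      {colim_class s G t k z}"
    by blast
  then have eq: "c \<otimes>\<^bsub>seq_colim s G t\<^esub> d = colim_class s G t k z"
    by (simp add: seq_colim_def)
  show "c \<otimes>\<^bsub>seq_colim s G t\<^esub> d \<in> carrier (seq_colim s G t)"
    unfolding eq using colim_classI k z(1) .
  show "colim_map (c \<otimes>\<^bsub>seq_colim s G t\<^esub> d) = colim_map c \<otimes>\<^bsub>H\<^esub> colim_map d"
    unfolding eq using colim_map_class[OF k z(1)] z(2) by simp
qed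

lemma colim_map_iso: "colim_map \<in> iso (seq_colim s G t) H"
proof (rule isoI)
  show "colim_map \<in> hom (seq_colim s G t) H"
    by (rule homI) (simp_all add: colim_map_closed colim_mult(2))
  show "bij_betw colim_map (carrier (seq_colim s G t)) (carrier H)"
    unfolding bij_betw_def
  proof (rule conjI[OF inj_onI subset_antisym[OF subsetI subsetI]])
    fix c d assume c: "c \<in> carrier (seq_colim s G t)" and d: "d \<in> carrier (seq_colim s G t)"
      and eq: "colim_map c = colim_map d"
    obtain i x where "s \<le> i" "x \<in> carrier (G i)" "c = colim_class s G t i x" using colim_carrierE[OF c] .
    then show "c = d" using colim_class_value[OF d] colim_map_class eq by metis
  next
    fix z assume "z \<in> colim_map ` carrier (seq_colim s G t)"
    then show "z \<in> carrier H" using colim_map_closed by blast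
  next
    fix z assume z: "z \<in> carrier H"
    obtain K where K: "\<forall>i\<ge>K. carrier H \<subseteq> \<Phi> i ` carrier (G i)" using eventually_bij by blast
    \<comment> \<open>The maximum with \<open>s\<close> keeps the stage inside the system.\<close>
    then have "carrier H \<subseteq> \<Phi> (max K s) ` carrier (G (max K s))" by simp
    then obtain x where "x \<in> carrier (G (max K s))" "\<Phi> (max K s) x = z" using z by blast
    then show "z \<in> colim_map ` carrier (seq_colim s G t)"
      using colim_map_class[of "max K s" x] colim_classI[of "max K s" x] by force
  qed
qed

end

text \<open>Since classes are fibres of \<open>\<Phi>'\<close>, the equation for its values both
  makes the induced map well defined and proves the naturality square.\<close>

lemma colim_map_natural:
  assumes "sequential_target s G t H \<Phi>" "sequential_target s' G' t' H' \<Phi>'"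
    and nat: "\<And>i y. \<lbrakk>s \<le> i; y \<in> carrier (G i)\<rbrakk> \<Longrightarrow>
      s' \<le> i \<and> q i y \<in> carrier (G' i) \<and> \<Phi>' i (q i y) = h (\<Phi> i y)"
    and x: "x \<in> carrier (seq_colim s G t)"
  shows "sequential_target.colim_map \<Phi>' (induced (\<lambda>(i, y). colim_class s' G' t' i (q i y)) x) =
    h (sequential_target.colim_map \<Phi> x)"
proof -
  interpret S: sequential_target s G t H \<Phi> by fact
  interpret S': sequential_target s' G' t' H' \<Phi>' by fact
  obtain i y where y: "s \<le> i" "y \<in> carrier (G i)" "x = colim_class s G t i y"
    and x_eq: "x = {(j, y). s \<le> j \<and> y \<in> carrier (G j) \<and> \<Phi> j y = S.colim_map x}"
    using S.colim_carrierE[OF x] .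
  have "colim_class s' G' t' j (q j z) = colim_class s' G' t' i (q i y)" if "(j, z) \<in> x" for j z
  proof -
    have z: "s \<le> j" "z \<in> carrier (G j)" "\<Phi> j z = \<Phi> i y"
      using that x_eq y S.colim_map_class[OF y(1,2)] by auto
    show ?thesis
      using nat[OF y(1,2)] nat[OF z(1,2)] z(3) by (simp add: S'.colim_class_eq)
  qed
  then have "(\<lambda>(i, y). colim_class s' G' t' i (q i y)) z = colim_class s' G' t' i (q i y)" if "z \<in> x" for z
    using that by (cases z) simp
  moreover have "(i, y) \<in> x" using S.colim_class_mem[OF y(1,2)] y(3) by simp
  ultimately have "(\<lambda>(i, y). colim_class s' G' t' i (q i y)) ` x = {colim_class s' G' t' i (q i y)}"
    by blast
  then have "induced (\<lambda>(i, y). colim_class s' G' t' i (q i y)) x = colim_class s' G' t' i (q i y)"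
    by (simp add: induced_def)
  then show ?thesis
    using S'.colim_map_class nat[OF y(1,2)] S.colim_map_class[OF y(1,2)] y(3) by simp
qed

section \<open>Naturality of dimension shifting and of syzygies\<close>

context syzygies
begin

text \<open>The maps \<open>g\<close> and \<open>G\<close> form morphisms of the syzygy sequences;
  the lift \<open>b\<close> behind each connecting step is replaced by
  \<open>G i \<cdot> b\<close>.\<close>

lemma shift_iter_right:
  assumes H: "is_complex A H" and N: "N \<in> objs A" "N' \<in> objs A"
    and g: "\<And>i. g i \<in> Hom A (syz A (R N) i) (syz A (R N') i)"
    and G: "\<And>i. G i \<in> Hom A (ch (R N) i) (ch (R N') i)"
    and cok: "\<And>i. cok (R N') i \<cdot> G i = g i \<cdot> cok (R N) i"
    and inc': "\<And>i. G i \<cdot> inc N i = inc N' i \<cdot> g (Suc i)"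
    and c: "shift_iter H N m i c c'"
  shows "shift_iter H N' m i (g 0 \<cdot> c) (g i \<cdot> c')"
  using c
proof (induction i arbitrary: c')
  case 0
  then show ?case using cocycles_cmp[OF H, of c "syz A (R N) 0" m "g 0"] g[of 0] by auto
next
  case (Suc i)
  note C = complex_dif[OF H]
  obtain d where d: "shift_iter H N m i c d" "shift_rel A H (inc N i) (cok (R N) i) (m + int i) d c'"
    using Suc.prems by auto
  obtain b where b: "b \<in> arrs A" "src A b = cob H (m + int i)" "tgt A b = ch (R N) i"
    "cok (R N) i \<cdot> b = d" "b \<cdot> dif H (m + int i + 1) = inc N i \<cdot> c'"
    using d(2) inc(3)[OF N(1)] by (auto simp: shift_rel_def)
  have d': "d \<in> cocycles A H (syz A (R N) i) (m + int i)"
    "c' \<in> cocycles A H (syz A (R N) (Suc i)) (m + int i + 1)"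
    using d(2) inc(2)[OF N(1)] cok_arr(3)[OF N(1)] by (auto simp: shift_rel_def)
  note c' = d'(2)[unfolded cocycles_iff]
  have "cok (R N') i \<cdot> (G i \<cdot> b) = (g i \<cdot> cok (R N) i) \<cdot> b"
    by (rule cmp_reduce[OF cok]) (use b G[of i] cok_arr[OF N(2)] in simp_all)
  then have 1: "cok (R N') i \<cdot> (G i \<cdot> b) = g i \<cdot> d"
    using b g[of i] cok_arr[OF N(1)] by simp
  have "(G i \<cdot> b) \<cdot> dif H (m + int i + 1) = G i \<cdot> (inc N i \<cdot> c')"
    using b G[of i] C by simp
  also have "\<dots> = (inc N' i \<cdot> g (Suc i)) \<cdot> c'"
    by (rule cmp_reduce[OF inc']) (use G[of i] inc[OF N(1)] c' in simp_all)
  finally have 2: "(G i \<cdot> b) \<cdot> dif H (m + int i + 1) = inc N' i \<cdot> (g (Suc i) \<cdot> c')"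
    using g[of "Suc i"] inc(1-3)[OF N(2)] c' by simp
  have "shift_rel A H (inc N' i) (cok (R N') i) (m + int i) (g i \<cdot> d) (g (Suc i) \<cdot> c')"
    unfolding shift_rel_def
  proof (intro conjI bexI[of _ "G i \<cdot> b"])
    show "g i \<cdot> d \<in> cocycles A H (tgt A (cok (R N') i)) (m + int i)"
      using cocycles_cmp[OF H d'(1), of "g i"] g[of i] cok_arr(3)[OF N(2)] by simp
    show "g (Suc i) \<cdot> c' \<in> cocycles A H (src A (inc N' i)) (m + int i + 1)"
      using cocycles_cmp[OF H d'(2), of "g (Suc i)"] g[of "Suc i"] inc(2)[OF N(2)] by simp
    show "G i \<cdot> b \<in> Hom A (cob H (m + int i)) (tgt A (inc N' i))"
      using b G[of i] inc(3)[OF N(2)] by simp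
  qed (use 1 2 in simp_all)
  then show ?case using Suc.IH[OF d(1)] by auto
qed

lemma chain_mapD:
  assumes "chain_map A X Y u"
  shows "u n \<in> arrs A" "src A (u n) = cob X n" "tgt A (u n) = cob Y n"
    "dif Y n \<cdot> u n = u (n - 1) \<cdot> dif X n"
  using assms by (auto simp: chain_map_def)

lemma cocycles_chain_map:
  assumes "is_complex A H" "is_complex A H'" "chain_map A H H' v" "f \<in> cocycles A H' X m"
  shows "f \<cdot> v m \<in> cocycles A H X m"
proof -
  note C = complex_dif[OF assms(1)] and C' = complex_dif[OF assms(2)] and v = chain_mapD[OF assms(3)]
  note f = assms(4)[unfolded cocycles_iff]
  have X: "X \<in> objs A" using f arr_objs by blast
  have "(f \<cdot> v m) \<cdot> dif H (m + 1) = f \<cdot> (dif H' (m + 1) \<cdot> v (m + 1))"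
    using f v C by simp
  also have "\<dots> = (f \<cdot> dif H' (m + 1)) \<cdot> v (m + 1)"
    by (rule assoc[symmetric]) (use f v(1-3) C' in simp_all)
  also have "\<dots> = mzero A (cob H (m + 1)) X" using f v(1-3) X by simp
  finally show ?thesis using f v by (simp add: cocycles_iff)
qed

lemma coboundaries_chain_map:
  assumes "is_complex A H" "is_complex A H'" "chain_map A H H' v" "f \<in> coboundaries A H' X m"
  shows "f \<cdot> v m \<in> coboundaries A H X m"
proof -
  note C = complex_dif[OF assms(1)] and C' = complex_dif[OF assms(2)] and v = chain_mapD[OF assms(3)]
  obtain g where g: "g \<in> arrs A" "src A g = cob H' (m - 1)" "tgt A g = X" "f = g \<cdot> dif H' m"
    using assms(4) unfolding coboundaries_iff by blast
  have "f \<cdot> v m = (g \<cdot> v (m - 1)) \<cdot> dif H m"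
    using g v C C' by simp
  then show ?thesis unfolding coboundaries_iff using g v by (intro exI[of _ "g \<cdot> v (m - 1)"]) simp
qed

text \<open>The lift \<open>b\<close> behind each connecting step is replaced by its composite with
  \<open>v\<close>, which is again a lift because \<open>v\<close> commutes with the
  differentials.\<close>

lemma shift_iter_left:
  assumes H: "is_complex A H" "is_complex A H'" and v: "chain_map A H H' v" and N: "N \<in> objs A"
    and c: "shift_iter H' N m i c c'"
  shows "shift_iter H N m i (c \<cdot> v m) (c' \<cdot> v (m + int i))"
  using c
proof (induction i arbitrary: c')
  case 0
  then show ?case using cocycles_chain_map[OF H v] by auto
next
  case (Suc i)
  note C = complex_dif[OF H(1)] and C' = complex_dif[OF H(2)] and V = chain_mapD[OF v]
  have deg: "m + int (Suc i) = m + int i + 1" by simp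
  obtain d where d: "shift_iter H' N m i c d" "shift_rel A H' (inc N i) (cok (R N) i) (m + int i) d c'"
    using Suc.prems by auto
  obtain b where b: "b \<in> arrs A" "src A b = cob H' (m + int i)" "tgt A b = ch (R N) i"
    "cok (R N) i \<cdot> b = d" "b \<cdot> dif H' (m + int i + 1) = inc N i \<cdot> c'"
    using d(2) inc(3)[OF N] by (auto simp: shift_rel_def)
  have d': "d \<in> cocycles A H' (tgt A (cok (R N) i)) (m + int i)"
    "c' \<in> cocycles A H' (src A (inc N i)) (m + int i + 1)"
    using d(2) by (auto simp: shift_rel_def)
  note c' = d'(2)[unfolded cocycles_iff]
  have "(b \<cdot> v (m + int i)) \<cdot> dif H (m + int i + 1) = b \<cdot> (dif H' (m + int i + 1) \<cdot> v (m + int i + 1))"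
    using b(1-3) V C by simp
  also have "\<dots> = (b \<cdot> dif H' (m + int i + 1)) \<cdot> v (m + int i + 1)"
    using b(1-3) V(1-3) C' by simp
  also have "\<dots> = inc N i \<cdot> (c' \<cdot> v (m + int i + 1))"
    unfolding b(5) using c' inc(1-3)[OF N] V(1-3) by simp
  finally have 2: "(b \<cdot> v (m + int i)) \<cdot> dif H (m + int i + 1) = inc N i \<cdot> (c' \<cdot> v (m + int i + 1))" .
  have 1: "cok (R N) i \<cdot> (b \<cdot> v (m + int i)) = d \<cdot> v (m + int i)"
    by (rule cmp_reduce[OF b(4)]) (use b(1-3) V cok_arr[OF N] in simp_all)
  have "shift_rel A H (inc N i) (cok (R N) i) (m + int i) (d \<cdot> v (m + int i)) (c' \<cdot> v (m + int i + 1))"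
    unfolding shift_rel_def
    using 1 2 b(1-3) V(1-3) inc(3)[OF N] cocycles_chain_map[OF H v] d'
    by (intro conjI bexI[of _ "b \<cdot> v (m + int i)"]) simp_all
  then show ?case unfolding deg using Suc.IH[OF d(1)] by auto
qed

text \<open>Iterating \<open>precover_morphism\<close> yields honest arrows \<open>g i\<close> that
  represent the stable classes \<open>Lam_iter\<close>, together with the middle maps
  \<open>F\<close> of the squares, which the naturality proofs need.\<close>

lemma syz_map_exists:
  assumes f: "f \<in> Hom A M M'"
  shows "\<exists>g F. g 0 = f \<and> (\<forall>i. g i \<in> Hom A (syz A (R M) i) (syz A (R M') i)) \<and>
    (\<forall>i. F i \<in> Hom A (ch (R M) i) (ch (R M') i)) \<and>
    (\<forall>i. cok (R M') i \<cdot> F i = g i \<cdot> cok (R M) i) \<and> (\<forall>i. F i \<cdot> inc M i = inc M' i \<cdot> g (Suc i)) \<and>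
    (\<forall>i. Lam_iter A W R M M' i (stable_class A W f) = stable_class A W (g i))"
proof -
  have M: "M \<in> objs A" "M' \<in> objs A" using f arr_objs by auto
  note i = inc[OF M(1)] and i' = inc[OF M(2)] and c = cok_arr[OF M(1)] and c' = cok_arr[OF M(2)]
  define sq where "sq n x y b \<longleftrightarrow> b \<in> Hom A (ch (R M) n) (ch (R M') n) \<and>
    cok (R M') n \<cdot> b = x \<cdot> cok (R M) n \<and> b \<cdot> inc M n = inc M' n \<cdot> y" for n x y b
  \<comment> \<open>The middle map in degree \<open>n\<close> depends on two consecutive values of
    \<open>g\<close>, so it is hidden in the step relation here and selected afterwards.\<close>
  have "\<exists>g. \<forall>n. (g n \<in> Hom A (syz A (R M) n) (syz A (R M') n) \<and> (n = 0 \<longrightarrow> g n = f)) \<and>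
      (\<exists>b. sq n (g n) (g (Suc n)) b)"
  proof (rule dependent_nat_choice)
    show "\<exists>x. x \<in> Hom A (syz A (R M) 0) (syz A (R M') 0) \<and> (0 = (0::nat) \<longrightarrow> x = f)"
      using f resolution(4) M by simp
    fix x n assume x: "x \<in> Hom A (syz A (R M) n) (syz A (R M') n) \<and> (n = 0 \<longrightarrow> x = f)"
    obtain y b where "y \<in> arrs A" "src A y = src A (inc M n)" "tgt A y = src A (inc M' n)"
      "b \<in> arrs A" "src A b = tgt A (inc M n)" "tgt A b = tgt A (inc M' n)"
      "b \<cdot> inc M n = inc M' n \<cdot> y" "cok (R M') n \<cdot> b = x \<cdot> cok (R M) n"
      by (rule precover_morphism[OF syz_precover[OF M(1)] syz_precover[OF M(2)], of x n n])
        (use x c c' in simp_all)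
    then show "\<exists>y. (y \<in> Hom A (syz A (R M) (Suc n)) (syz A (R M') (Suc n)) \<and> (Suc n = 0 \<longrightarrow> y = f)) \<and>
        (\<exists>b. sq n x y b)"
      using i i' by (auto simp: sq_def)
  qed
  then obtain g where g: "\<And>n. g n \<in> Hom A (syz A (R M) n) (syz A (R M') n)" "g 0 = f"
    "\<And>n. \<exists>b. sq n (g n) (g (Suc n)) b" by auto
  obtain F where F: "\<And>n. sq n (g n) (g (Suc n)) (F n)" using g(3) by metis
  have "Lam_iter A W R M M' n (stable_class A W f) = stable_class A W (g n)" for n
  proof (induction n)
    case 0 then show ?case by (simp add: g)
  next
    case (Suc n)
    have "Lam A W (inc M n, cok (R M) n) (inc M' n, cok (R M') n) (stable_class A W (g n)) =
        stable_class A W (g (Suc n))"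
      by (rule Lam_class[OF syz_precover[OF M(1)] syz_precover[OF M(2)], where b = "F n"])
        (use F[of n] g(1)[of n] g(1)[of "Suc n"] i i' c c' in \<open>simp_all add: sq_def\<close>)
    then show ?case using Suc i(6) i'(6) by simp
  qed
  then show ?thesis using g F unfolding sq_def by blast
qed

end

section \<open>Maps out of large syzygies\<close>

lemma ch_Suc: "ch X (Suc k) = cob X (int k + 1)"
  by (simp add: ch_def add.commute)

lemma cocycles_nat_iff:
  "f \<in> cocycles A H X (int k) \<longleftrightarrow> f \<in> arrs A \<and> src A f = ch H k \<and> tgt A f = X \<and>
    f \<cdot>\<^bsub>A\<^esub> dn H k = mzero A (ch H (Suc k)) X"
  unfolding cocycles_iff ch_Suc dn_def ch_def by (simp add: add.commute)

text \<open>Restricted to positive degrees: a coboundary in degree 0 comes from degree -1 of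
  \<open>H\<close>, which \<open>ch\<close> and \<open>dn\<close> do not see.\<close>

lemma coboundaries_nat_iff:
  "f \<in> coboundaries A H X (int (Suc j)) \<longleftrightarrow>
    (\<exists>g. g \<in> arrs A \<and> src A g = ch H j \<and> tgt A g = X \<and> f = g \<cdot>\<^bsub>A\<^esub> dn H j)"
proof -
  have "int (Suc j) - 1 = int j" "int (Suc j) = int j + 1" by simp_all
  then show ?thesis unfolding coboundaries_iff dn_def ch_def by (simp only:)
qed

context syzygies
begin

text \<open>The choice is fixed for each \<open>T\<close>, so that \<open>Phi\<close> becomes a
  function of \<open>T\<close> and different Tate resolutions can be compared.\<close>

definition lft :: "('a, 'b) tate \<Rightarrow> nat \<Rightarrow> 'b" where
  "lft T = (SOME l. is_lift A (tate_res T) (tate_aug T) (R (tate_obj T)) (cok (R (tate_obj T)) 0)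
     (idm A (tate_obj T)) l)"

definition gam :: "('a, 'b) tate \<Rightarrow> nat \<Rightarrow> 'b" where
  "gam T k = tate_map T (int k)"

text \<open>Composition of \<open>f\<close>, defined on the \<open>k\<close>-th syzygy, with \<open>H\<^sub>k \<rightarrow> P\<^sub>k \<rightarrow> R(M)\<^sub>k \<rightarrow> \<Omega>\<^sub>k M\<close>.\<close>

definition ev :: "('a, 'b) tate \<Rightarrow> nat \<Rightarrow> 'b \<Rightarrow> 'b" where
  "ev T k f = f \<cdot> (cok (R (tate_obj T)) k \<cdot> (lft T k \<cdot> gam T k))"

text \<open>The set is a singleton on the groups of the direct system, by \<open>Phi_eqI\<close> below.\<close>

definition Phi :: "('a, 'b) tate \<Rightarrow> int \<Rightarrow> 'a \<Rightarrow> nat \<Rightarrow> 'b set \<Rightarrow> 'b set" where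
  "Phi T n N i y = the_elem {cohomology_class A (tate_tac T) N n c |c f.
     f \<in> y \<and> shift_iter (tate_tac T) N n i c (ev T (nat (int i + n)) f)}"

end

section \<open>Evaluating maps out of syzygies on the totally acyclic complex\<close>

locale tate = syzygies +
  fixes T :: "('a, 'b) tate"
  assumes T: "tate_resolution A W T"
begin

abbreviation "M \<equiv> tate_obj T"
abbreviation "H \<equiv> tate_tac T"
abbreviation "P \<equiv> tate_res T"
abbreviation "e \<equiv> tate_aug T"

lemma tate:
  shows M: "M \<in> objs A" and acyclic: "totally_acyclic A W H" and proper: "proper_resolution A W P e M"
    and chain: "chain_map A H P (tate_map T)" and H: "is_complex A H"
  using T by (simp_all add: tate_resolution_def totally_acyclic_def)

lemma lft: "is_lift A P e (R M) (cok (R M) 0) (idm A M) (lft T)"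
proof -
  have "\<exists>l. is_lift A P e (R M) (cok (R M) 0) (idm A M) l"
    using lift_exists[OF proper resolution(1)[OF M], of "idm A M"] M by simp
  then show ?thesis unfolding lft_def by (rule someI_ex)
qed

lemma gam:
  "gam T k \<in> arrs A" "src A (gam T k) = ch H k" "tgt A (gam T k) = ch P k"
  "dn P k \<cdot> gam T (Suc k) = gam T k \<cdot> dn H k"
proof -
  note c = chain_mapD[OF chain]
  show "gam T k \<in> arrs A" "src A (gam T k) = ch H k" "tgt A (gam T k) = ch P k"
    using c by (simp_all add: gam_def ch_def)
  have "int (Suc k) = int k + 1" by simp
  then show "dn P k \<cdot> gam T (Suc k) = gam T k \<cdot> dn H k"
    unfolding gam_def dn_def using c(4)[of "int k + 1"] by (simp add: add.commute)
qed

lemmas dnH = complex_dn[OF H]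
lemmas dnP = complex_dn[OF proper_resolutionD(1)[OF proper]]
lemmas dnR = complex_dn[OF proper_resolutionD(1)[OF resolution(1)[OF M]]]
lemmas lft_arr = is_liftD[OF lft]
lemmas cokM = cok_arr[OF M]
lemmas incM = inc[OF M]

lemma ev_arr:
  assumes "f \<in> arrs A" "src A f = syz A (R M) k"
  shows "ev T k f \<in> arrs A" "src A (ev T k f) = ch H k" "tgt A (ev T k f) = tgt A f"
  using assms cokM lft_arr(1-3) gam(1-3) by (simp_all add: ev_def)

text \<open>In nonnegative degrees the composite of \<open>gam\<close> and \<open>lft\<close> is a
  chain map from \<open>H\<close> to the chosen resolution.\<close>

lemma comparison:
  "dn (R M) k \<cdot> (lft T (Suc k) \<cdot> gam T (Suc k)) = (lft T k \<cdot> gam T k) \<cdot> dn H k"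
proof -
  have "dn (R M) k \<cdot> (lft T (Suc k) \<cdot> gam T (Suc k)) = (lft T k \<cdot> dn P k) \<cdot> gam T (Suc k)"
    by (rule cmp_reduce[OF lft_arr(5)]) (use dnR lft_arr(1-3) gam(1-3) in simp_all)
  then show ?thesis using lft_arr(1-3) gam dnP dnH by simp
qed

lemma cok_comparison:
  "(cok (R M) k \<cdot> (lft T k \<cdot> gam T k)) \<cdot> dn H k = mzero A (ch H (Suc k)) (syz A (R M) k)"
proof -
  have "(cok (R M) k \<cdot> (lft T k \<cdot> gam T k)) \<cdot> dn H k =
      cok (R M) k \<cdot> (dn (R M) k \<cdot> (lft T (Suc k) \<cdot> gam T (Suc k)))"
    unfolding comparison using cokM lft_arr(1-3) gam(1-3) dnH by simp
  also have "\<dots> = mzero A (ch (R M) (Suc k)) (syz A (R M) k) \<cdot> (lft T (Suc k) \<cdot> gam T (Suc k))"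
    by (rule cmp_reduce[OF cokM(5)]) (use cokM lft_arr(1-3) gam(1-3) dnR in simp_all)
  finally show ?thesis using lft_arr(1-3) gam(1-3) syz_objs[OF M] by simp
qed

lemma ev_cocycle:
  assumes "f \<in> arrs A" "src A f = syz A (R M) k"
  shows "ev T k f \<in> cocycles A H (tgt A f) (int k)"
proof -
  have "ev T k f \<cdot> dn H k = f \<cdot> ((cok (R M) k \<cdot> (lft T k \<cdot> gam T k)) \<cdot> dn H k)"
    using assms cokM lft_arr(1-3) gam(1-3) dnH by (simp add: ev_def)
  then show ?thesis
    unfolding cocycles_nat_iff using ev_arr[OF assms] assms dnH by (simp add: cok_comparison)
qed

lemma ev_diff_self:
  assumes "f \<in> arrs A" "src A f = syz A (R M) k" "tgt A f = X"
  shows "madd A (ev T k f) (mneg A (ev T k f)) \<in> coboundaries A H X (int k)"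
proof -
  have "X \<in> objs A" using assms arr_objs(2)[OF assms(1)] by simp
  then show ?thesis using ev_arr[OF assms(1,2)] assms(3) zero_coboundary[OF H] by (simp add: ch_def)
qed

lemma ev_cmp:
  assumes "f \<in> arrs A" "src A f = syz A (R M) k" "g \<in> arrs A" "src A g = tgt A f"
  shows "ev T k (g \<cdot> f) = g \<cdot> ev T k f"
  using assms cokM lft_arr(1-3) gam(1-3) by (simp add: ev_def)

lemma ev_diff:
  assumes "f \<in> arrs A" "src A f = syz A (R M) k" "g \<in> arrs A" "src A g = syz A (R M) k" "tgt A g = tgt A f"
  shows "ev T k (madd A f (mneg A g)) = madd A (ev T k f) (mneg A (ev T k g))"
  using assms cokM lft_arr(1-3) gam(1-3) by (simp add: ev_def)

text \<open>The first factor of \<open>f\<close> yields a cocycle with values in an object of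
  \<open>W\<close>, which bounds by total acyclicity. Hence \<open>ev\<close> is constant on stable
  classes up to coboundaries.\<close>

lemma ev_factoring:
  assumes "f \<in> factoring A W (syz A (R M) k) X"
  shows "ev T k f \<in> coboundaries A H X (int k)"
proof -
  obtain V a b where f: "V \<in> W" "a \<in> arrs A" "src A a = syz A (R M) k" "tgt A a = V"
    "b \<in> arrs A" "src A b = V" "tgt A b = X" "f = b \<cdot> a" using factoringE[OF assms] .
  have "ev T k a \<in> coboundaries A H V (int k)"
    using acyclic_cocycle[OF acyclic f(1)] ev_cocycle[OF f(2,3)] f(4) by simp
  then show ?thesis
    using coboundaries_cmp[OF H _ f(5,6)] ev_cmp[OF f(2,3,5)] f by simp
qed

text \<open>The middle map \<open>b\<close>, preceded by the comparison map in degree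
  \<open>k\<close>, is the lift required by \<open>shift_rel\<close>. So one transition step matches
  one connecting step.\<close>

lemma ev_step:
  assumes N: "N \<in> objs A"
    and f: "f \<in> arrs A" "src A f = syz A (R M) k" "tgt A f = syz A (R N) i"
    and f': "f' \<in> arrs A" "src A f' = syz A (R M) (Suc k)" "tgt A f' = syz A (R N) (Suc i)"
    and b: "b \<in> arrs A" "src A b = ch (R M) k" "tgt A b = ch (R N) i"
    and bk: "b \<cdot> inc M k = inc N i \<cdot> f'" and pb: "cok (R N) i \<cdot> b = f \<cdot> cok (R M) k"
  shows "shift_rel A H (inc N i) (cok (R N) i) (int k) (ev T k f) (ev T (Suc k) f')"
proof -
  let ?w = "\<lambda>k. lft T k \<cdot> gam T k"
  have w: "?w k \<in> arrs A" "src A (?w k) = ch H k" "tgt A (?w k) = ch (R M) k" for k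
    using lft_arr(1-3) gam(1-3) by simp_all
  note c = cok_arr[OF N] and i = inc[OF N]
  have deg: "int (Suc k) = int k + 1" by simp
  have "cok (R N) i \<cdot> (b \<cdot> ?w k) = (f \<cdot> cok (R M) k) \<cdot> ?w k"
    by (rule cmp_reduce[OF pb]) (use b w c in simp_all)
  then have 1: "cok (R N) i \<cdot> (b \<cdot> ?w k) = ev T k f"
    using f cokM w by (simp add: ev_def del: assoc add: assoc[of f])
  have "(b \<cdot> ?w k) \<cdot> dn H k = b \<cdot> (dn (R M) k \<cdot> ?w (Suc k))"
    unfolding comparison using b w dnH by (simp del: assoc add: assoc[of b])
  also have "dn (R M) k \<cdot> ?w (Suc k) = inc M k \<cdot> (cok (R M) (Suc k) \<cdot> ?w (Suc k))"
    by (rule cmp_expand_left[OF incM(4)]) (use incM cokM w in simp_all)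
  also have "b \<cdot> \<dots> = (inc N i \<cdot> f') \<cdot> (cok (R M) (Suc k) \<cdot> ?w (Suc k))"
    by (rule cmp_reduce[OF bk]) (use b incM cokM w in simp_all)
  also have "\<dots> = inc N i \<cdot> ev T (Suc k) f'"
    unfolding ev_def by (rule assoc) (use f' i cokM w in simp_all)
  finally have 2: "(b \<cdot> ?w k) \<cdot> dn H k = inc N i \<cdot> ev T (Suc k) f'" .
  show ?thesis
    unfolding shift_rel_def
  proof (intro conjI bexI[of _ "b \<cdot> ?w k"])
    show "ev T k f \<in> cocycles A H (tgt A (cok (R N) i)) (int k)"
      using ev_cocycle[OF f(1,2)] f c by simp
    show "ev T (Suc k) f' \<in> cocycles A H (src A (inc N i)) (int k + 1)"
      using ev_cocycle[OF f'(1,2)] f' i unfolding deg by simp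
    show "b \<cdot> ?w k \<in> Hom A (cob H (int k)) (tgt A (inc N i))"
      using b w i by (simp add: ch_def)
  qed (use 1 2 in \<open>simp_all add: dn_def\<close>)
qed

text \<open>The complexes \<open>P\<close> and \<open>R M\<close> are homotopy equivalent, and in large degrees \<open>P\<close> agrees with
  \<open>H\<close>. Hence a map out of a large syzygy amounts to a cocycle.\<close>

lemma ev_eventually:
  "\<exists>K. \<forall>k\<ge>K.
    (\<forall>f X. f \<in> Hom A (syz A (R M) k) X \<and> ev T k f \<in> coboundaries A H X (int k) \<longrightarrow>
       f \<in> factoring A W (syz A (R M) k) X) \<and>
    (\<forall>X c. c \<in> cocycles A H X (int k) \<longrightarrow>
       (\<exists>f \<in> Hom A (syz A (R M) k) X. madd A (ev T k f) (mneg A c) \<in> coboundaries A H X (int k)))"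
proof -
  note res = resolution(1)[OF M]
  note p = proper_resolutionD[OF proper] and r = proper_resolutionD[OF res]
  obtain l' where l': "is_lift A (R M) (cok (R M) 0) P e (idm A M) l'"
    using lift_exists[OF res proper, of "idm A M"] M by auto
  note L' = is_liftD[OF l']
  have idmM: "idm A M \<cdot> idm A M = idm A M" using M by simp
  have "is_lift A P e P e (idm A M) (\<lambda>k. l' k \<cdot> lft T k)"
    using lift_cmp[OF p(1) r(1) p(1) lft l'] p cokM(1-3)[of 0] resolution(4)[OF M] M idmM by simp
  moreover have "is_lift A P e P e (idm A M) (\<lambda>k. idm A (ch P k))"
    using lift_idm[OF p(1,3,4)] p(5) by simp
  \<comment> \<open>A homotopy on \<open>P\<close> between the round trip through \<open>R M\<close>
    and the identity; it serves the existence claim.\<close>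
  ultimately obtain s where s: "\<And>k. s k \<in> Hom A (ch P k) (ch P (Suc k))"
    "\<And>k. l' (Suc k) \<cdot> lft T (Suc k) = madd A (idm A (ch P (Suc k)))
      (madd A (dn P (Suc k) \<cdot> s (Suc k)) (s k \<cdot> dn P k))"
    using lift_homotopy[OF proper proper] by blast
  have "is_lift A (R M) (cok (R M) 0) (R M) (cok (R M) 0) (idm A M) (\<lambda>k. lft T k \<cdot> l' k)"
    using lift_cmp[OF r(1) p(1) r(1) l' lft] p cokM(1-3)[of 0] resolution(4)[OF M] M idmM by simp
  moreover have "is_lift A (R M) (cok (R M) 0) (R M) (cok (R M) 0) (idm A M) (\<lambda>k. idm A (ch (R M) k))"
    using lift_idm[OF r(1,3,4)] r(5) by simp
  \<comment> \<open>The corresponding homotopy on \<open>R M\<close>; it serves the factorisation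
    claim.\<close>
  ultimately obtain z where z: "\<And>k. z k \<in> Hom A (ch (R M) k) (ch (R M) (Suc k))"
    "\<And>k. idm A (ch (R M) (Suc k)) = madd A (lft T (Suc k) \<cdot> l' (Suc k))
      (madd A (dn (R M) (Suc k) \<cdot> z (Suc k)) (z k \<cdot> dn (R M) k))"
    using lift_homotopy[OF res res] by blast
  obtain m where m: "\<And>n. n \<ge> m \<Longrightarrow> is_iso A (tate_map T n)" using T by (auto simp: tate_resolution_def)
  have "\<exists>g. g \<in> Hom A (ch P k) (ch H k) \<and> g \<cdot> gam T k = idm A (ch H k) \<and> gam T k \<cdot> g = idm A (ch P k)"
    if "k \<ge> nat m" for k
  proof -
    have "m \<le> int k" using that by simp
    then show ?thesis
      using m[of "int k"] gam(1-3)[of k] unfolding is_iso_def gam_def[symmetric] by auto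
  qed
  then obtain g where g: "\<And>k. k \<ge> nat m \<Longrightarrow> g k \<in> Hom A (ch P k) (ch H k) \<and>
      g k \<cdot> gam T k = idm A (ch H k) \<and> gam T k \<cdot> g k = idm A (ch P k)" by metis
  have g_dn: "g k \<cdot> dn P k = dn H k \<cdot> g (Suc k)" if k: "k \<ge> nat m" for k
  proof -
    have gk: "g k \<in> arrs A" "src A (g k) = ch P k" "tgt A (g k) = ch H k" "g k \<cdot> gam T k = idm A (ch H k)"
      and gk': "g (Suc k) \<in> arrs A" "src A (g (Suc k)) = ch P (Suc k)" "tgt A (g (Suc k)) = ch H (Suc k)"
        "gam T (Suc k) \<cdot> g (Suc k) = idm A (ch P (Suc k))"
      using g[of k] g[of "Suc k"] k by simp_all
    have "g k \<cdot> dn P k = g k \<cdot> (dn P k \<cdot> (gam T (Suc k) \<cdot> g (Suc k)))"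
      unfolding gk'(4) using gk(1-3) dnP by simp
    also have "dn P k \<cdot> (gam T (Suc k) \<cdot> g (Suc k)) = (gam T k \<cdot> dn H k) \<cdot> g (Suc k)"
      by (rule cmp_reduce[OF gam(4)]) (use gam(1-3) gk' dnP in simp_all)
    also have "\<dots> = gam T k \<cdot> (dn H k \<cdot> g (Suc k))"
      using gam(1-3) gk'(1-3) dnH by simp
    also have "g k \<cdot> \<dots> = idm A (ch H k) \<cdot> (dn H k \<cdot> g (Suc k))"
      by (rule cmp_reduce[OF gk(4)]) (use gam(1-3) gk(1-3) gk'(1-3) dnH in simp_all)
    finally show ?thesis using gk'(1-3) dnH by simp
  qed
  show ?thesis
  \<comment> \<open>One more than \<open>nat m\<close>, so that \<open>\<gamma>\<close> is
    invertible in degree \<open>k\<close> and also in degree \<open>j = k - 1\<close>, from which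
    coboundaries come.\<close>
  proof (intro exI[of _ "Suc (nat m)"] allI impI conjI)
    fix k assume "k \<ge> Suc (nat m)"
    then obtain j where k: "k = Suc j" and j: "j \<ge> nat m" by (cases k) auto
    have gj: "g j \<in> arrs A" "src A (g j) = ch P j" "tgt A (g j) = ch H j"
      and gk: "g k \<in> arrs A" "src A (g k) = ch P k" "tgt A (g k) = ch H k"
      and gg: "g k \<cdot> gam T k = idm A (ch H k)" "gam T k \<cdot> g k = idm A (ch P k)"
      using g[of j] g[of k] j k by simp_all
    note gdj = g_dn[OF j, folded k] and gdk = g_dn[of k]
    have s_arr: "s i \<in> arrs A" "src A (s i) = ch P i" "tgt A (s i) = ch P (Suc i)" for i
      using s(1)[of i] by simp_all
    have z_arr: "z i \<in> arrs A" "src A (z i) = ch (R M) i" "tgt A (z i) = ch (R M) (Suc i)" for i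
      using z(1)[of i] by simp_all
    note lam = lft_arr(1-3)[of k] and mu = L'(1-3)[of k] and ga = gam(1-3)[of k]
    {
      fix f X
      assume "f \<in> Hom A (syz A (R M) k) X \<and> ev T k f \<in> coboundaries A H X (int k)"
      then have f: "f \<in> arrs A" "src A f = syz A (R M) k" "tgt A f = X"
        and "ev T k f \<in> coboundaries A H X (int (Suc j))" by (simp_all add: k)
      then obtain a where a: "a \<in> arrs A" "src A a = ch H j" "tgt A a = X" "ev T k f = a \<cdot> dn H j"
        unfolding coboundaries_nat_iff by blast
      have X: "X \<in> objs A" using f arr_objs by blast
      define fc where "fc = f \<cdot> cok (R M) k"
      have fc: "fc \<in> arrs A" "src A fc = ch (R M) k" "tgt A fc = X"
        using f cokM by (simp_all add: fc_def)
      have ev_fc: "ev T k f = fc \<cdot> (lft T k \<cdot> gam T k)"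
        using f cokM lam ga by (simp add: fc_def ev_def)
      have fcd: "fc \<cdot> dn (R M) k = mzero A (ch (R M) (Suc k)) X"
        using f cokM dnR by (simp add: fc_def)
      \<comment> \<open>The bounding map \<open>a\<close> of \<open>ev T k f\<close> is transported
        to \<open>R M\<close> along the inverse of \<open>\<gamma>\<close> and
        \<open>l'\<close>.\<close>
      have "fc \<cdot> (lft T k \<cdot> l' k) = ev T k f \<cdot> (g k \<cdot> l' k)"
      proof -
        have "gam T k \<cdot> (g k \<cdot> l' k) = idm A (ch P k) \<cdot> l' k"
          by (rule cmp_reduce[OF gg(2)]) (use ga gk mu in simp_all)
        then show ?thesis unfolding ev_fc using fc lam ga gk mu by simp
      qed
      also have "\<dots> = a \<cdot> (dn H j \<cdot> (g k \<cdot> l' k))"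
        unfolding a(4) using a(1-3) dnH gk mu k by simp
      also have "dn H j \<cdot> (g k \<cdot> l' k) = (g j \<cdot> dn P j) \<cdot> l' k"
        by (rule cmp_reduce[OF gdj[symmetric]]) (use gk mu dnH k in simp_all)
      also have "\<dots> = g j \<cdot> (l' j \<cdot> dn (R M) j)"
        using gj mu L'(5)[of j] dnP k by simp
      also have "a \<cdot> \<dots> = (a \<cdot> (g j \<cdot> l' j)) \<cdot> dn (R M) j"
        using a(1-3) gj L'(1-3)[of j] dnR by simp
      finally have 1: "fc \<cdot> (lft T k \<cdot> l' k) = (a \<cdot> (g j \<cdot> l' j)) \<cdot> dn (R M) j" .
      have "fc \<cdot> (dn (R M) k \<cdot> z k) = mzero A (ch (R M) (Suc k)) X \<cdot> z k"
        by (rule cmp_reduce[OF fcd]) (use fc dnR z_arr in simp_all)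
      then have 2: "fc \<cdot> (dn (R M) k \<cdot> z k) = mzero A (ch (R M) k) X"
        using z_arr X by simp
      \<comment> \<open>Expanding \<open>fc\<close> by the homotopy \<open>z\<close>, the term with
        \<open>dn (R M) k\<close> vanishes and the other two end in \<open>dn (R M) j\<close>;
        \<open>y\<close> collects them.\<close>
      define y where "y = madd A (a \<cdot> (g j \<cdot> l' j)) (fc \<cdot> z j)"
      have y: "y \<in> arrs A" "src A y = ch (R M) j" "tgt A y = X"
        using a gj L'(1-3)[of j] fc z_arr k by (simp_all add: y_def)
      have "fc = fc \<cdot> idm A (ch (R M) k)" using fc by simp
      also have "\<dots> = madd A (fc \<cdot> (lft T k \<cdot> l' k)) (madd A (fc \<cdot> (dn (R M) k \<cdot> z k)) (fc \<cdot> (z j \<cdot> dn (R M) j)))"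
        unfolding k z(2) unfolding k[symmetric] using fc lam mu dnR z_arr k by simp
      also have "\<dots> = y \<cdot> dn (R M) j"
        unfolding 1 2 using a gj L'(1-3)[of j] fc z_arr k dnR by (simp add: y_def)
      also have "\<dots> = (y \<cdot> inc M j) \<cdot> cok (R M) k"
        unfolding k by (rule cmp_expand_right[OF incM(4)]) (use y incM cokM in simp_all)
      \<comment> \<open>As \<open>dn (R M) j\<close> is \<open>inc M j\<close> after the epi
        \<open>cok (R M) k\<close>, cancelling the epi shows that \<open>f\<close> factors through
        the object of \<open>W\<close> in degree \<open>j\<close>.\<close>
      finally have "f = y \<cdot> inc M j"
        unfolding fc_def
        by (rule epi_cancel[OF cokM(4), rotated -1]) (use f y incM cokM k in simp_all)
      moreover have "tgt A (inc M j) \<in> W" using incM r(2) by simp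
      ultimately show "f \<in> factoring A W (syz A (R M) k) X"
        using factoringI[of "inc M j" y] y incM k by simp
    next
      fix X c assume "c \<in> cocycles A H X (int k)"
      then have c: "c \<in> arrs A" "src A c = ch H k" "tgt A c = X" "c \<cdot> dn H k = mzero A (ch H (Suc k)) X"
        by (auto simp: cocycles_nat_iff)
      have X: "X \<in> objs A" using c arr_objs by blast
      \<comment> \<open>The cocycle transported to \<open>R M\<close>; it kills the incoming
        differential and thus descends to the syzygy.\<close>
      define c' where "c' = c \<cdot> (g k \<cdot> l' k)"
      have c': "c' \<in> arrs A" "src A c' = ch (R M) k" "tgt A c' = X"
        using c gk mu by (simp_all add: c'_def)
      have gk': "g (Suc k) \<in> arrs A" "src A (g (Suc k)) = ch P (Suc k)" "tgt A (g (Suc k)) = ch H (Suc k)"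
        using g[of "Suc k"] j k by simp_all
      have gdk: "g k \<cdot> dn P k = dn H k \<cdot> g (Suc k)" using g_dn[of k] j k by simp
      have cgd: "(c \<cdot> g k) \<cdot> dn P k = mzero A (ch P (Suc k)) X"
      proof -
        have "(c \<cdot> g k) \<cdot> dn P k = c \<cdot> (dn H k \<cdot> g (Suc k))" using c(1-3) gk dnP gdk by simp
        also have "\<dots> = mzero A (ch H (Suc k)) X \<cdot> g (Suc k)"
          by (rule cmp_reduce[OF c(4)]) (use c(1-3) gk' dnH in simp_all)
        finally show ?thesis using gk' X by simp
      qed
      have "c' \<cdot> dn (R M) k = (c \<cdot> g k) \<cdot> (dn P k \<cdot> l' (Suc k))"
        unfolding L'(5) using c(1-3) gk mu dnR by (simp add: c'_def)
      also have "\<dots> = mzero A (ch P (Suc k)) X \<cdot> l' (Suc k)"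
        by (rule cmp_reduce[OF cgd]) (use c(1-3) gk dnP L'(1-3) in simp_all)
      finally have "c' \<cdot> dn (R M) k = mzero A (src A (dn (R M) k)) (tgt A c')"
        using L'(1-3) X dnR c' by simp
      then obtain f where f: "f \<in> arrs A" "src A f = syz A (R M) k" "tgt A f = X" "f \<cdot> cok (R M) k = c'"
        using coker_desc[OF resolution(2)[OF M, of k], of c'] c' dnR cokM by auto
      have "ev T k f = c' \<cdot> (lft T k \<cdot> gam T k)"
        unfolding ev_def by (rule cmp_reduce[OF f(4)]) (use f cokM lam ga in simp_all)
      also have "\<dots> = (c \<cdot> g k) \<cdot> ((l' k \<cdot> lft T k) \<cdot> gam T k)"
        using c(1-3) gk mu lam ga by (simp add: c'_def)
      \<comment> \<open>In the homotopy formula the identity returns \<open>c\<close>, the next term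
        vanishes because \<open>c \<cdot> g k\<close> kills \<open>dn P k\<close>, and the last one
        is a coboundary.\<close>
      also have "l' k \<cdot> lft T k = madd A (idm A (ch P k)) (madd A (dn P k \<cdot> s k) (s j \<cdot> dn P j))"
        unfolding k by (rule s(2))
      also have "(c \<cdot> g k) \<cdot> (\<dots> \<cdot> gam T k) = madd A ((c \<cdot> g k) \<cdot> gam T k)
          (madd A ((c \<cdot> g k) \<cdot> (dn P k \<cdot> (s k \<cdot> gam T k))) ((c \<cdot> g k) \<cdot> (s j \<cdot> (dn P j \<cdot> gam T k))))"
        using c(1-3) gk ga s_arr dnP k by simp
      also have "(c \<cdot> g k) \<cdot> gam T k = c" using c(1-3) gk ga gg by simp
      also have "(c \<cdot> g k) \<cdot> (dn P k \<cdot> (s k \<cdot> gam T k)) = mzero A (ch P (Suc k)) X \<cdot> (s k \<cdot> gam T k)"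
        by (rule cmp_reduce[OF cgd]) (use c(1-3) gk ga s_arr dnP in simp_all)
      also have "\<dots> = mzero A (ch H k) X" using s_arr ga X by simp
      also have "dn P j \<cdot> gam T k = gam T j \<cdot> dn H j" unfolding k by (rule gam(4))
      also have "(c \<cdot> g k) \<cdot> (s j \<cdot> (gam T j \<cdot> dn H j)) = (c \<cdot> (g k \<cdot> (s j \<cdot> gam T j))) \<cdot> dn H j"
        using c(1-3) gk s_arr gam(1-3)[of j] dnH k by simp
      finally have "madd A (ev T k f) (mneg A c) = (c \<cdot> (g k \<cdot> (s j \<cdot> gam T j))) \<cdot> dn H j"
        using ev_arr[OF f(1,2)] f c(1-3) gk s_arr gam(1-3)[of j] dnH k X
        by (subst diff_eq_iff) (simp_all add: madd_comm)
      then have "madd A (ev T k f) (mneg A c) \<in> coboundaries A H X (int k)"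
        unfolding k coboundaries_nat_iff using c(1-3) gk s_arr gam(1-3)[of j] k
        by (intro exI[of _ "c \<cdot> (g k \<cdot> (s j \<cdot> gam T j))"]) simp
      then show "\<exists>f \<in> Hom A (syz A (R M) k) X. madd A (ev T k f) (mneg A c) \<in> coboundaries A H X (int k)"
        using f by auto
    }
  qed
qed

end

section \<open>The isomorphism\<close>

lemma (in additive_subcategory_of) cohomology_map_right_class:
  assumes "is_complex A H" "c \<in> cocycles A H N n" "g \<in> arrs A" "src A g = N"
  shows "cohomology_map_right A H g n (cohomology_class A H N n c) =
    cohomology_class A H (tgt A g) n (g \<cdot> c)"
proof -
  have eq: "cohomology_class A H (tgt A g) n (g \<cdot> f) = cohomology_class A H (tgt A g) n (g \<cdot> c)"
    if f: "f \<in> cohomology_class A H N n c" for f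
  proof -
    have f': "f \<in> cocycles A H N n" "cohomology_class A H N n f = cohomology_class A H N n c"
      using cohomology_class_mem(2)[OF assms(1,2) f] by simp_all
    then have "madd A f (mneg A c) \<in> coboundaries A H N n"
      using cohomology_class_eq_iff[OF assms(1) f'(1) assms(2)] by simp
    then have "g \<cdot> madd A f (mneg A c) \<in> coboundaries A H (tgt A g) n"
      using coboundaries_cmp[OF assms(1)] assms(3,4) by blast
    then show ?thesis
      using cohomology_class_eq_iff[OF assms(1) cocycles_cmp[OF assms(1) f'(1) assms(3,4)]
          cocycles_cmp[OF assms(1,2,3,4)]] f' assms by (simp add: cocycles_iff)
  qed
  have "c \<in> cohomology_class A H N n c" using cohomology_class_mem(1)[OF assms(1,2)] .
  then have "(\<lambda>f. cohomology_class A H (tgt A g) n (g \<cdot> f)) ` cohomology_class A H N n c =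
      {cohomology_class A H (tgt A g) n (g \<cdot> c)}" using eq by blast
  then show ?thesis by (simp add: cohomology_map_right_def induced_def)
qed

lemma (in syzygies) cohomology_map_left_class:
  assumes H: "is_complex A H" "is_complex A H'" and v: "chain_map A H H' v"
    and c: "c \<in> cocycles A H' N n"
  shows "cohomology_map_left A H v N n (cohomology_class A H' N n c) = cohomology_class A H N n (c \<cdot> v n)"
proof -
  note V = chain_mapD[OF v]
  have eq: "cohomology_class A H N n (f \<cdot> v n) = cohomology_class A H N n (c \<cdot> v n)"
    if f: "f \<in> cohomology_class A H' N n c" for f
  proof -
    have f': "f \<in> cocycles A H' N n" "cohomology_class A H' N n f = cohomology_class A H' N n c"
      using cohomology_class_mem(2)[OF H(2) c f] by simp_all
    then have "madd A f (mneg A c) \<in> coboundaries A H' N n"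
      using cohomology_class_eq_iff[OF H(2) f'(1) c] by simp
    then have "madd A f (mneg A c) \<cdot> v n \<in> coboundaries A H N n"
      using coboundaries_chain_map[OF H v] by blast
    then show ?thesis
      using cohomology_class_eq_iff[OF H(1) cocycles_chain_map[OF H v f'(1)]
          cocycles_chain_map[OF H v c]] f' c V by (simp add: cocycles_iff)
  qed
  have "c \<in> cohomology_class A H' N n c" using cohomology_class_mem(1)[OF H(2) c] .
  then have "(\<lambda>f. cohomology_class A H N n (f \<cdot> v n)) ` cohomology_class A H' N n c =
      {cohomology_class A H N n (c \<cdot> v n)}" using eq by blast
  then show ?thesis by (simp add: cohomology_map_left_def induced_def)
qed

context tate
begin

text \<open>Changing the representative of the class alters \<open>ev\<close> by a coboundary, and
  shifting reflects coboundaries, so only one cohomology class occurs in the set defining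
  \<open>Phi\<close>. Allowing \<open>z\<close> to differ from \<open>ev T k f\<close> by a
  coboundary is what surjectivity and naturality in \<open>M\<close> require.\<close>

lemma Phi_eqI:
  assumes N: "N \<in> objs A" and k: "int k = n + int i"
    and f: "f \<in> arrs A" "src A f = syz A (R M) k" "tgt A f = syz A (R N) i"
    and c: "shift_iter H N n i c z"
    and fz: "madd A (ev T k f) (mneg A z) \<in> coboundaries A H (syz A (R N) i) (int k)"
  shows "Phi T n N i (stable_class A W f) = cohomology_class A H N n c"
proof -
  have k': "nat (int i + n) = k" using k by simp
  have z: "z \<in> arrs A" "src A z = cob H (int k)" "tgt A z = syz A (R N) i"
    and c': "c \<in> cocycles A H N n"
    using shift_iter_cocycles[OF N c] unfolding k[symmetric] by (auto simp: cocycles_iff)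
  let ?S = "{cohomology_class A H N n c |c f'. f' \<in> stable_class A W f \<and> shift_iter H N n i c (ev T k f')}"
  have "x = cohomology_class A H N n c" if x_in: "x \<in> ?S" for x
  proof -
    obtain d f' where d: "f' \<in> stable_class A W f" "shift_iter H N n i d (ev T k f')"
      and x: "x = cohomology_class A H N n d" using x_in by blast
    have f': "f' \<in> arrs A" "src A f' = syz A (R M) k" "tgt A f' = syz A (R N) i"
      "stable_class A W f' = stable_class A W f"
      using d(1) f stable_class_mem_iff by auto
    have d': "d \<in> cocycles A H N n" using shift_iter_cocycles(1)[OF N d(2)] .
    have "madd A f' (mneg A f) \<in> factoring A W (syz A (R M) k) (syz A (R N) i)"
      using stable_class_eq_iff[of f' f] f f' by simp
    then have "ev T k (madd A f' (mneg A f)) \<in> coboundaries A H (syz A (R N) i) (int k)"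
      by (rule ev_factoring)
    then have 1: "madd A (ev T k f') (mneg A (ev T k f)) \<in> coboundaries A H (syz A (R N) i) (int k)"
      using ev_diff[of f' k f] f f' by simp
    note e = ev_arr[OF f(1,2)] ev_arr[OF f'(1,2)]
    have "madd A (madd A (ev T k f') (mneg A (ev T k f))) (madd A (ev T k f) (mneg A z)) =
        madd A (ev T k f') (mneg A z)"
      using e z f f' by (simp add: madd_assoc ch_def)
    then have 2: "madd A (ev T k f') (mneg A z) \<in> coboundaries A H (syz A (R N) i) (int k)"
      using madd_coboundaries[OF H 1 fz] by simp
    have "shift_iter H N n i (madd A d (mneg A c)) (madd A (ev T k f') (mneg A z))"
      using shift_iter_madd[OF H N d(2) shift_iter_mneg[OF H N c]] .
    then have "madd A d (mneg A c) \<in> coboundaries A H N n"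
      using shift_iter_coboundaries[OF acyclic N] 2 k by simp
    then show ?thesis using x cohomology_class_eq_iff[OF H d' c'] by simp
  qed
  moreover have "\<exists>x. x \<in> ?S"
  proof -
    have "ev T k f \<in> cocycles A H (syz A (R N) i) (n + int i)"
      using ev_cocycle[OF f(1,2)] f(3) k by simp
    then obtain d where "shift_iter H N n i d (ev T k f)" using shift_iter_surj[OF acyclic N] by blast
    then show ?thesis using stable_class_self[OF f(1)] by blast
  qed
  ultimately have "?S = {cohomology_class A H N n c}" by blast
  then show ?thesis unfolding Phi_def k' by simp
qed

lemma Phi_class:
  assumes N: "N \<in> objs A" and k: "int k = n + int i"
    and f: "f \<in> arrs A" "src A f = syz A (R M) k" "tgt A f = syz A (R N) i"
  obtains c where "shift_iter H N n i c (ev T k f)" "c \<in> cocycles A H N n"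
    "Phi T n N i (stable_class A W f) = cohomology_class A H N n c"
proof -
  have e: "ev T k f \<in> cocycles A H (syz A (R N) i) (n + int i)"
    using ev_cocycle[OF f(1,2)] f(3) k by simp
  then obtain c where c: "shift_iter H N n i c (ev T k f)" using shift_iter_surj[OF acyclic N] by blast
  show thesis
    using that[OF c] shift_iter_cocycles(1)[OF N c] Phi_eqI[OF N k f c ev_diff_self[OF f]] by simp
qed

lemma cExt_groupE:
  assumes "y \<in> carrier (cExt_group A W R n M N i)"
  obtains f where "f \<in> arrs A" "src A f = syz A (R M) (nat (int i + n))" "tgt A f = syz A (R N) i"
    "y = stable_class A W f"
  using assms by (auto simp: cExt_group_def stable_Hom_carrier)

lemma cExt_groupI:
  assumes "f \<in> arrs A" "src A f = syz A (R M) (nat (int i + n))" "tgt A f = syz A (R N) i"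
  shows "stable_class A W f \<in> carrier (cExt_group A W R n M N i)"
  using assms by (auto simp: cExt_group_def stable_Hom_carrier)

text \<open>Besides representing the transition map, \<open>f'\<close> comes with its square, which
  the naturality proof in \<open>M\<close> composes with other squares.\<close>

lemma cExt_trans_class:
  assumes N: "N \<in> objs A" and i: "cExt_start n \<le> i"
    and f: "f \<in> arrs A" "src A f = syz A (R M) (nat (int i + n))" "tgt A f = syz A (R N) i"
  obtains f' b where "f' \<in> arrs A" "src A f' = syz A (R M) (nat (int (Suc i) + n))"
    "tgt A f' = syz A (R N) (Suc i)"
    "b \<in> arrs A" "src A b = ch (R M) (nat (int i + n))" "tgt A b = ch (R N) i"
    "b \<cdot> inc M (nat (int i + n)) = inc N i \<cdot> f'"
    "cok (R N) i \<cdot> b = f \<cdot> cok (R M) (nat (int i + n))"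
    "cExt_trans A W R n M N i (stable_class A W f) = stable_class A W f'"
    "Phi T n N (Suc i) (stable_class A W f') = Phi T n N i (stable_class A W f)"
proof -
  define k where "k = nat (int i + n)"
  have k: "int k = n + int i" "nat (int (Suc i) + n) = Suc k" "int (Suc k) = n + int (Suc i)"
    using i by (simp_all add: k_def cExt_start_def)
  note c = cok_arr[OF N] and ii = inc[OF N]
  obtain f' b where b: "f' \<in> arrs A" "src A f' = syz A (R M) (Suc k)" "tgt A f' = syz A (R N) (Suc i)"
    "b \<in> arrs A" "src A b = ch (R M) k" "tgt A b = ch (R N) i" "b \<cdot> inc M k = inc N i \<cdot> f'"
    "cok (R N) i \<cdot> b = f \<cdot> cok (R M) k"
    using precover_morphism[OF syz_precover[OF M] syz_precover[OF N], of f k i] f cokM incM c ii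
    unfolding k_def[symmetric] by metis
  have "Lam A W (inc M k, cok (R M) k) (inc N i, cok (R N) i) (stable_class A W f) = stable_class A W f'"
    by (rule Lam_class[OF syz_precover[OF M] syz_precover[OF N], where b = b])
      (use b f c ii cokM incM k_def in simp_all)
  then have 1: "cExt_trans A W R n M N i (stable_class A W f) = stable_class A W f'"
    using incM(6) ii(6) by (simp add: cExt_trans_def k_def)
  obtain d where d: "shift_iter H N n i d (ev T k f)"
    "Phi T n N i (stable_class A W f) = cohomology_class A H N n d"
    using Phi_class[OF N k(1) f(1) _ f(3)] f(2) k_def by auto
  have "shift_rel A H (inc N i) (cok (R N) i) (int k) (ev T k f) (ev T (Suc k) f')"
    using ev_step[OF N f(1) _ f(3) b] f(2) k_def by simp
  \<comment> \<open>By \<open>ev_step\<close> the chain of shifts that begins at \<open>d\<close> is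
    prolonged by one step, so both stages have the same value.\<close>
  then have d': "shift_iter H N n (Suc i) d (ev T (Suc k) f')" using d(1) k(1) by auto
  have "Phi T n N (Suc i) (stable_class A W f') = cohomology_class A H N n d"
    by (rule Phi_eqI[OF N k(3) b(1-3) d' ev_diff_self[OF b(1-3)]])
  then show thesis using that[of f' b] b 1 d(2) k(2) k_def by simp
qed

lemma Phi_target:
  assumes N: "N \<in> objs A"
  shows "sequential_target (cExt_start n) (cExt_group A W R n M N) (cExt_trans A W R n M N)
    (Hom_cohomology A H N n) (Phi T n N)"
proof
  have deg: "int (nat (int i + n)) = n + int i" if "cExt_start n \<le> i" for i
    using that by (simp add: cExt_start_def)
  fix i x assume i: "cExt_start n \<le> i" and x: "x \<in> carrier (cExt_group A W R n M N i)"
  let ?k = "nat (int i + n)"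
  obtain f where f: "f \<in> arrs A" "src A f = syz A (R M) ?k" "tgt A f = syz A (R N) i"
    "x = stable_class A W f" using cExt_groupE[OF x] .
  obtain c where c: "shift_iter H N n i c (ev T ?k f)" "c \<in> cocycles A H N n"
    "Phi T n N i x = cohomology_class A H N n c"
    using Phi_class[OF N deg[OF i] f(1-3)] unfolding f(4) .
  show "Phi T n N i x \<in> carrier (Hom_cohomology A H N n)"
    unfolding c(3) Hom_cohomology_carrier[OF H] using c(2) by blast
  obtain f' where "f' \<in> arrs A" "src A f' = syz A (R M) (nat (int (Suc i) + n))"
    "tgt A f' = syz A (R N) (Suc i)"
    "cExt_trans A W R n M N i (stable_class A W f) = stable_class A W f'"
    "Phi T n N (Suc i) (stable_class A W f') = Phi T n N i (stable_class A W f)"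
    using cExt_trans_class[OF N i f(1-3)] by metis
  then show "cExt_trans A W R n M N i x \<in> carrier (cExt_group A W R n M N (Suc i)) \<and>
      Phi T n N (Suc i) (cExt_trans A W R n M N i x) = Phi T n N i x"
    unfolding f(4) using cExt_groupI by simp
  fix y assume y: "y \<in> carrier (cExt_group A W R n M N i)"
  obtain g where g: "g \<in> arrs A" "src A g = syz A (R M) ?k" "tgt A g = syz A (R N) i"
    "y = stable_class A W g" using cExt_groupE[OF y] .
  obtain d where d: "shift_iter H N n i d (ev T ?k g)" "d \<in> cocycles A H N n"
    "Phi T n N i y = cohomology_class A H N n d"
    using Phi_class[OF N deg[OF i] g(1-3)] unfolding g(4) .
  have xy: "x \<otimes>\<^bsub>cExt_group A W R n M N i\<^esub> y = stable_class A W (madd A f g)"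
    unfolding f(4) g(4) cExt_group_def using f g by (intro stable_Hom_mult) simp_all
  have fg: "madd A f g \<in> arrs A" "src A (madd A f g) = syz A (R M) ?k"
    "tgt A (madd A f g) = syz A (R N) i" using f g by simp_all
  show "x \<otimes>\<^bsub>cExt_group A W R n M N i\<^esub> y \<in> carrier (cExt_group A W R n M N i)"
    unfolding xy using cExt_groupI[OF fg] .
  have "ev T ?k (madd A f g) = madd A (ev T ?k f) (ev T ?k g)"
    using f g cokM lft_arr(1-3) gam(1-3) by (simp add: ev_def)
  then have "shift_iter H N n i (madd A c d) (ev T ?k (madd A f g))"
    using shift_iter_madd[OF H N c(1) d(1)] by simp
  then have "Phi T n N i (stable_class A W (madd A f g)) = cohomology_class A H N n (madd A c d)"
    by (rule Phi_eqI[OF N deg[OF i] fg _ ev_diff_self[OF fg]])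
  then show "Phi T n N i (x \<otimes>\<^bsub>cExt_group A W R n M N i\<^esub> y) =
      Phi T n N i x \<otimes>\<^bsub>Hom_cohomology A H N n\<^esub> Phi T n N i y"
    unfolding xy c(3) d(3) using Hom_cohomology_mult[OF H c(2) d(2)] by simp
next
  obtain K where K: "\<And>k f X. k \<ge> K \<Longrightarrow> f \<in> Hom A (syz A (R M) k) X \<Longrightarrow>
      ev T k f \<in> coboundaries A H X (int k) \<Longrightarrow> f \<in> factoring A W (syz A (R M) k) X"
    "\<And>k X c. k \<ge> K \<Longrightarrow> c \<in> cocycles A H X (int k) \<Longrightarrow>
       \<exists>f \<in> Hom A (syz A (R M) k) X. madd A (ev T k f) (mneg A c) \<in> coboundaries A H X (int k)"
    using ev_eventually by blast
  show "\<exists>K. \<forall>i\<ge>K. inj_on (Phi T n N i) (carrier (cExt_group A W R n M N i)) \<and>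
      carrier (Hom_cohomology A H N n) \<subseteq> Phi T n N i ` carrier (cExt_group A W R n M N i)"
  \<comment> \<open>Adding the absolute value of \<open>n\<close> ensures that
    \<open>k = i + n\<close> is at least \<open>K\<close>, also for negative
    \<open>n\<close>.\<close>
  proof (intro exI[of _ "K + nat \<bar>n\<bar>"] allI impI conjI inj_onI subsetI)
    fix i assume i: "K + nat \<bar>n\<bar> \<le> i"
    define k where "k = nat (int i + n)"
    have k: "int k = n + int i" "K \<le> k" using i by (simp_all add: k_def)
    {
      fix x y assume "x \<in> carrier (cExt_group A W R n M N i)" "y \<in> carrier (cExt_group A W R n M N i)"
        and eq: "Phi T n N i x = Phi T n N i y"
      then obtain f g where f: "f \<in> arrs A" "src A f = syz A (R M) k" "tgt A f = syz A (R N) i"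
          "x = stable_class A W f"
        and g: "g \<in> arrs A" "src A g = syz A (R M) k" "tgt A g = syz A (R N) i" "y = stable_class A W g"
        unfolding k_def by (meson cExt_groupE)
      obtain c where c: "shift_iter H N n i c (ev T k f)" "c \<in> cocycles A H N n"
        "Phi T n N i x = cohomology_class A H N n c"
        using Phi_class[OF N k(1) f(1-3)] unfolding f(4) .
      obtain d where d: "shift_iter H N n i d (ev T k g)" "d \<in> cocycles A H N n"
        "Phi T n N i y = cohomology_class A H N n d"
        using Phi_class[OF N k(1) g(1-3)] unfolding g(4) .
      have "madd A c (mneg A d) \<in> coboundaries A H N n"
        using cohomology_class_eq_iff[OF H c(2) d(2)] c(3) d(3) eq by simp
      then have "madd A (ev T k f) (mneg A (ev T k g)) \<in> coboundaries A H (syz A (R N) i) (int k)"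
        using shift_iter_coboundaries[OF acyclic N shift_iter_madd[OF H N c(1) shift_iter_mneg[OF H N d(1)]]]
        unfolding k(1) by simp
      then have "ev T k (madd A f (mneg A g)) \<in> coboundaries A H (syz A (R N) i) (int k)"
        using ev_diff[of f k g] f g by simp
      then have "madd A f (mneg A g) \<in> factoring A W (syz A (R M) k) (syz A (R N) i)"
        using f g by (intro K(1)[OF k(2)]) simp_all
      then show "x = y" using stable_class_eq_iff[of f g] f g by simp
    next
      fix x assume "x \<in> carrier (Hom_cohomology A H N n)"
      then obtain c where c: "c \<in> cocycles A H N n" "x = cohomology_class A H N n c"
        unfolding Hom_cohomology_carrier[OF H] by blast
      obtain z where z: "shift_iter H N n i c z" using shift_iter_total[OF acyclic N c(1)] by blast
      have "z \<in> cocycles A H (syz A (R N) i) (int k)"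
        using shift_iter_cocycles(2)[OF N z] unfolding k(1) .
      then obtain f where f: "f \<in> Hom A (syz A (R M) k) (syz A (R N) i)"
        "madd A (ev T k f) (mneg A z) \<in> coboundaries A H (syz A (R N) i) (int k)"
        using K(2)[OF k(2)] by blast
      have "Phi T n N i (stable_class A W f) = x"
        unfolding c(2) by (rule Phi_eqI[OF N k(1) _ _ _ z f(2)]) (use f in simp_all)
      moreover have "stable_class A W f \<in> carrier (cExt_group A W R n M N i)"
        using cExt_groupI f unfolding k_def by simp
      ultimately show "x \<in> Phi T n N i ` carrier (cExt_group A W R n M N i)" by blast
    }
  qed
qed

text \<open>Composition with the i-th syzygy map of \<open>g\<close> carries the chain of shifts for
  \<open>N\<close> to one for \<open>N'\<close>, so the square commutes at every stage.\<close>

lemma Phi_right: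
  assumes g: "g \<in> Hom A N N'" and i: "cExt_start n \<le> i" and y: "y \<in> carrier (cExt_group A W R n M N i)"
  defines "q \<equiv> stable_comp A W (Lam_iter A W R N N' i (stable_class A W g)) y"
  shows "q \<in> carrier (cExt_group A W R n M N' i)"
    "Phi T n N' i q = cohomology_map_right A H g n (Phi T n N i y)"
proof -
  have N: "N \<in> objs A" "N' \<in> objs A" using g arr_objs by auto
  define k where "k = nat (int i + n)"
  have k: "int k = n + int i" using i by (simp add: k_def cExt_start_def)
  obtain f where f: "f \<in> arrs A" "src A f = syz A (R M) k" "tgt A f = syz A (R N) i"
    "y = stable_class A W f" using cExt_groupE[OF y] unfolding k_def .
  obtain s G where s: "s 0 = g" "\<And>i. s i \<in> Hom A (syz A (R N) i) (syz A (R N') i)"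
    "\<And>i. G i \<in> Hom A (ch (R N) i) (ch (R N') i)"
    "\<And>i. cok (R N') i \<cdot> G i = s i \<cdot> cok (R N) i" "\<And>i. G i \<cdot> inc N i = inc N' i \<cdot> s (Suc i)"
    "\<And>i. Lam_iter A W R N N' i (stable_class A W g) = stable_class A W (s i)"
    using syz_map_exists[OF g] by blast
  have si: "s i \<in> arrs A" "src A (s i) = syz A (R N) i" "tgt A (s i) = syz A (R N') i"
    using s(2)[of i] by simp_all
  have q: "q = stable_class A W (s i \<cdot> f)"
    unfolding q_def s(6) f(4) by (rule stable_comp_class) (use si f in simp_all)
  have sf: "s i \<cdot> f \<in> arrs A" "src A (s i \<cdot> f) = syz A (R M) k" "tgt A (s i \<cdot> f) = syz A (R N') i"
    using si f by simp_all
  show "q \<in> carrier (cExt_group A W R n M N' i)"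
    unfolding q using cExt_groupI sf unfolding k_def by simp
  obtain c where c: "shift_iter H N n i c (ev T k f)" "c \<in> cocycles A H N n"
    "Phi T n N i y = cohomology_class A H N n c"
    using Phi_class[OF N(1) k f(1-3)] unfolding f(4) .
  have "shift_iter H N' n i (g \<cdot> c) (ev T k (s i \<cdot> f))"
    using shift_iter_right[OF H N s(2-5) c(1)] ev_cmp[OF f(1,2) si(1)] f si s(1) by simp
  then have "Phi T n N' i q = cohomology_class A H N' n (g \<cdot> c)"
    unfolding q by (rule Phi_eqI[OF N(2) k sf _ ev_diff_self[OF sf]])
  then show "Phi T n N' i q = cohomology_map_right A H g n (Phi T n N i y)"
    using cohomology_map_right_class[OF H c(2), of g] g c(3) by simp
qed

end

context syzygies
begin

text \<open>
  The squares formed by \<open>u\<close>, \<open>v\<close> and the maps \<open>H \<rightarrow> P\<close> commute in large degrees only, so compatibility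
  is proved at large stages first and then transported down along the transition maps.
\<close>

lemma Phi_left:
  assumes T: "tate_resolution A W T" and T': "tate_resolution A W T'"
    and mor: "tate_morphism A T T' f u v" and N: "N \<in> objs A"
    and i: "cExt_start n \<le> i" and y: "y \<in> carrier (cExt_group A W R n (tate_obj T') N i)"
  defines "q \<equiv> \<lambda>i y. stable_comp A W y
    (Lam_iter A W R (tate_obj T) (tate_obj T') (nat (int i + n)) (stable_class A W f))"
  shows "q i y \<in> carrier (cExt_group A W R n (tate_obj T) N i) \<and>
    Phi T n N i (q i y) = cohomology_map_left A (tate_tac T) v N n (Phi T' n N i y)"
proof -
  interpret T: tate A W R T by unfold_locales fact
  interpret T': tate A W R T' by unfold_locales fact
  have f: "f \<in> Hom A T.M T'.M" and u: "chain_map A T.P T'.P u" and v: "chain_map A T.H T'.H v"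
    and aug: "T'.e \<cdot> u 0 = f \<cdot> T.e"
    and large: "\<exists>m. \<forall>n\<ge>m. tate_map T' n \<cdot> v n = u n \<cdot> tate_map T n"
    using mor by (simp_all add: tate_morphism_def del: in_Hom)
  note V = chain_mapD[OF v] and U = chain_mapD[OF u]
  obtain s F where s: "s 0 = f" "\<And>i. s i \<in> Hom A (syz A (R T.M) i) (syz A (R T'.M) i)"
    "\<And>i. F i \<in> Hom A (ch (R T.M) i) (ch (R T'.M) i)"
    "\<And>i. cok (R T'.M) i \<cdot> F i = s i \<cdot> cok (R T.M) i" "\<And>i. F i \<cdot> inc T.M i = inc T'.M i \<cdot> s (Suc i)"
    "\<And>i. Lam_iter A W R T.M T'.M i (stable_class A W f) = stable_class A W (s i)"
    using syz_map_exists[OF f] by blast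
  have s_arr: "s i \<in> arrs A" "src A (s i) = syz A (R T.M) i" "tgt A (s i) = syz A (R T'.M) i" for i
    using s(2)[of i] by simp_all
  have F_arr: "F i \<in> arrs A" "src A (F i) = ch (R T.M) i" "tgt A (F i) = ch (R T'.M) i" for i
    using s(3)[of i] by simp_all
  have q: "q i (stable_class A W h) = stable_class A W (h \<cdot> s (nat (int i + n)))"
    if "h \<in> arrs A" "src A h = syz A (R T'.M) (nat (int i + n))" for h i
    unfolding q_def s(6) by (rule stable_comp_class) (use that s_arr in simp_all)
  \<comment> \<open>The squares over consecutive syzygies glue to a chain map because every
    differential is \<open>inc\<close> after \<open>cok\<close>.\<close>
  have F_lift: "is_lift A (R T.M) (cok (R T.M) 0) (R T'.M) (cok (R T'.M) 0) f F"
    unfolding is_lift_def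
  proof (intro conjI allI)
    show "F i \<in> Hom A (ch (R T.M) i) (ch (R T'.M) i)" for i by (rule s(3))
    show "cok (R T'.M) 0 \<cdot> F 0 = f \<cdot> cok (R T.M) 0" using s(4)[of 0] s(1) by simp
    fix i
    have "dn (R T'.M) i \<cdot> F (Suc i) = inc T'.M i \<cdot> (cok (R T'.M) (Suc i) \<cdot> F (Suc i))"
      by (rule cmp_expand_left[OF T'.incM(4)]) (use T'.incM T'.cokM F_arr in simp_all)
    also have "\<dots> = (inc T'.M i \<cdot> s (Suc i)) \<cdot> cok (R T.M) (Suc i)"
      unfolding s(4) using T'.incM(1-3) s_arr T.cokM(1-3) by simp
    also have "\<dots> = F i \<cdot> (inc T.M i \<cdot> cok (R T.M) (Suc i))"
      unfolding s(5)[symmetric] using F_arr T.incM(1-3) T.cokM(1-3) by simp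
    finally show "dn (R T'.M) i \<cdot> F (Suc i) = F i \<cdot> dn (R T.M) i" unfolding T.incM(4) .
  qed
  have u_lift: "is_lift A T.P T.e T'.P T'.e f (\<lambda>i. u (int i))"
    unfolding is_lift_def
  proof (intro conjI allI)
    show "u (int i) \<in> Hom A (ch T.P i) (ch T'.P i)" for i using U by (simp add: ch_def)
    show "T'.e \<cdot> u (int 0) = f \<cdot> T.e" using aug by simp
    fix i show "dn T'.P i \<cdot> u (int (Suc i)) = u (int i) \<cdot> dn T.P i"
      unfolding dn_def using U(4)[of "int i + 1"] by (simp add: add.commute)
  qed
  note p = proper_resolutionD[OF T.proper] and p' = proper_resolutionD[OF T'.proper]
  note r = proper_resolutionD[OF resolution(1)[OF T.M]] and r' = proper_resolutionD[OF resolution(1)[OF T'.M]]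
  \<comment> \<open>Two lifts of \<open>f\<close> from \<open>P\<close> to the chosen resolution of
    the target object: compare and then apply \<open>F\<close>, or apply \<open>u\<close> and then
    compare. Their homotopy \<open>z\<close> measures the failure of strict naturality.\<close>
  have "is_lift A T.P T.e (R T'.M) (cok (R T'.M) 0) f (\<lambda>i. F i \<cdot> lft T i)"
    using lift_cmp[OF p(1) r(1) r'(1) T.lft F_lift] p r r' f T.M by simp
  moreover have "is_lift A T.P T.e (R T'.M) (cok (R T'.M) 0) f (\<lambda>i. lft T' i \<cdot> u (int i))"
    using lift_cmp[OF p(1) p'(1) r'(1) u_lift T'.lft] p p' r' f T'.M by simp
  ultimately obtain z where z: "\<And>k. z k \<in> Hom A (ch T.P k) (ch (R T'.M) (Suc k))"
    "\<And>k. F (Suc k) \<cdot> lft T (Suc k) = madd A (lft T' (Suc k) \<cdot> u (int (Suc k)))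
      (madd A (dn (R T'.M) (Suc k) \<cdot> z (Suc k)) (z k \<cdot> dn T.P k))"
    using lift_homotopy[OF T.proper resolution(1)[OF T'.M]] by blast
  have z_arr: "z k \<in> arrs A" "src A (z k) = ch T.P k" "tgt A (z k) = ch (R T'.M) (Suc k)" for k
    using z(1)[of k] by simp_all
  obtain m where m: "\<And>n. n \<ge> m \<Longrightarrow> tate_map T' n \<cdot> v n = u n \<cdot> tate_map T n" using large by blast
  \<comment> \<open>Large enough that \<open>k = i + n\<close> is at least \<open>m\<close>, where
    \<open>u\<close> and \<open>v\<close> are compatible, and positive, so that degree
    \<open>k - 1\<close> is available for coboundaries.\<close>
  define K where "K = nat \<bar>m\<bar> + Suc (nat \<bar>n\<bar>)"
  have goal_large: "Phi T n N i (q i (stable_class A W h)) =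
      cohomology_map_left A T.H v N n (Phi T' n N i (stable_class A W h))"
    if i: "K \<le> i" and h: "h \<in> arrs A" "src A h = syz A (R T'.M) (nat (int i + n))" "tgt A h = syz A (R N) i"
    for i h
  proof -
    define k where "k = nat (int i + n)"
    have "\<bar>m\<bar> + \<bar>n\<bar> + 1 \<le> int i" using i unfolding K_def by linarith
    then have k: "int k = n + int i" "m \<le> int k" "k > 0" unfolding k_def by linarith+
    then obtain j where j: "k = Suc j" by (cases k) auto
    note h' = h[folded k_def]
    obtain c where c: "shift_iter T'.H N n i c (ev T' k h)" "c \<in> cocycles A T'.H N n"
      "Phi T' n N i (stable_class A W h) = cohomology_class A T'.H N n c"
      using T'.Phi_class[OF N k(1) h'] .
    have hs: "h \<cdot> s k \<in> arrs A" "src A (h \<cdot> s k) = syz A (R T.M) k" "tgt A (h \<cdot> s k) = syz A (R N) i"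
      using h' s_arr by simp_all
    have sh: "shift_iter T.H N n i (c \<cdot> v n) (ev T' k h \<cdot> v (int k))"
      using shift_iter_left[OF T.H T'.H v N c(1)] unfolding k(1)[symmetric] .
    define hc where "hc = h \<cdot> cok (R T'.M) k"
    have hc: "hc \<in> arrs A" "src A hc = ch (R T'.M) k" "tgt A hc = syz A (R N) i"
      using h' T'.cokM by (simp_all add: hc_def)
    have vk: "v (int k) \<in> arrs A" "src A (v (int k)) = ch T.H k" "tgt A (v (int k)) = ch T'.H k"
      and uk: "u (int k) \<in> arrs A" "src A (u (int k)) = ch T.P k" "tgt A (u (int k)) = ch T'.P k"
      using V U by (simp_all add: ch_def)
    have gv: "gam T' k \<cdot> v (int k) = u (int k) \<cdot> gam T k"
      using m[OF k(2)] by (simp add: gam_def)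
    have e': "ev T' k h \<cdot> v (int k) = hc \<cdot> ((lft T' k \<cdot> u (int k)) \<cdot> gam T k)"
      using h' T'.cokM T'.lft_arr(1-3) T'.gam(1-3) vk uk T.gam(1-3)
      by (simp add: ev_def hc_def gv)
    have zero: "hc \<cdot> (dn (R T'.M) k \<cdot> (z k \<cdot> gam T k)) = mzero A (ch T.H k) (syz A (R N) i)"
    proof -
      have d: "hc \<cdot> dn (R T'.M) k = mzero A (ch (R T'.M) (Suc k)) (syz A (R N) i)"
        using h' T'.cokM T'.dnR syz_objs[OF N] by (simp add: hc_def)
      have "hc \<cdot> (dn (R T'.M) k \<cdot> (z k \<cdot> gam T k)) =
          mzero A (ch (R T'.M) (Suc k)) (syz A (R N) i) \<cdot> (z k \<cdot> gam T k)"
        by (rule cmp_reduce[OF d]) (use hc T'.dnR z_arr T.gam(1-3) in simp_all)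
      then show ?thesis using z_arr T.gam(1-3) syz_objs[OF N] by simp
    qed
    have "ev T k (h \<cdot> s k) = h \<cdot> (s k \<cdot> (cok (R T.M) k \<cdot> (lft T k \<cdot> gam T k)))"
      using h' s_arr T.cokM T.lft_arr(1-3) T.gam(1-3) by (simp add: ev_def)
    also have "s k \<cdot> (cok (R T.M) k \<cdot> (lft T k \<cdot> gam T k)) =
        (cok (R T'.M) k \<cdot> F k) \<cdot> (lft T k \<cdot> gam T k)"
      by (rule cmp_reduce[OF s(4)[symmetric]]) (use s_arr T.cokM T.lft_arr(1-3) T.gam(1-3) in simp_all)
    also have "h \<cdot> \<dots> = hc \<cdot> ((F k \<cdot> lft T k) \<cdot> gam T k)"
      using h' T'.cokM F_arr T.lft_arr(1-3) T.gam(1-3) by (simp add: hc_def)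
    \<comment> \<open>Of the two homotopy terms, the first is killed since \<open>hc\<close> starts
      from the cokernel of \<open>dn (R T'.M) k\<close>; the second ends in \<open>dn T.H j\<close>
      and is a coboundary.\<close>
    also have "F k \<cdot> lft T k = madd A (lft T' k \<cdot> u (int k))
        (madd A (dn (R T'.M) k \<cdot> z k) (z j \<cdot> dn T.P j))"
      unfolding j by (rule z(2))
    also have "hc \<cdot> (\<dots> \<cdot> gam T k) = madd A (hc \<cdot> ((lft T' k \<cdot> u (int k)) \<cdot> gam T k))
        (madd A (hc \<cdot> (dn (R T'.M) k \<cdot> (z k \<cdot> gam T k))) (hc \<cdot> (z j \<cdot> (dn T.P j \<cdot> gam T k))))"
      using hc T'.lft_arr(1-3) uk T.gam(1-3) T'.dnR z_arr T.dnP j by simp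
    also have "dn T.P j \<cdot> gam T k = gam T j \<cdot> dn T.H j" unfolding j by (rule T.gam(4))
    also have "hc \<cdot> (z j \<cdot> (gam T j \<cdot> dn T.H j)) = (hc \<cdot> (z j \<cdot> gam T j)) \<cdot> dn T.H j"
      using hc z_arr T.gam(1-3) T.dnH j by simp
    finally have "ev T k (h \<cdot> s k) = madd A (ev T' k h \<cdot> v (int k)) ((hc \<cdot> (z j \<cdot> gam T j)) \<cdot> dn T.H j)"
      unfolding zero e' using hc z_arr T.gam(1-3) T.dnH j syz_objs[OF N] by simp
    moreover have "ev T' k h \<cdot> v (int k) \<in> arrs A" "src A (ev T' k h \<cdot> v (int k)) = ch T.H k"
      "tgt A (ev T' k h \<cdot> v (int k)) = syz A (R N) i"
      using T'.ev_arr[OF h'(1,2)] vk h'(3) by simp_all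
    ultimately have "madd A (ev T k (h \<cdot> s k)) (mneg A (ev T' k h \<cdot> v (int k))) =
        (hc \<cdot> (z j \<cdot> gam T j)) \<cdot> dn T.H j"
      using T.ev_arr[OF hs(1,2)] hs(3) hc z_arr T.gam(1-3) T.dnH j
      by (subst diff_eq_iff) (simp_all add: madd_comm)
    then have cob: "madd A (ev T k (h \<cdot> s k)) (mneg A (ev T' k h \<cdot> v (int k))) \<in>
        coboundaries A T.H (syz A (R N) i) (int k)"
      unfolding j coboundaries_nat_iff using hc z_arr T.gam(1-3) j
      by (intro exI[of _ "hc \<cdot> (z j \<cdot> gam T j)"]) simp
    have "Phi T n N i (stable_class A W (h \<cdot> s k)) = cohomology_class A T.H N n (c \<cdot> v n)"
      using T.Phi_eqI[OF N k(1) hs sh cob] .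
    then show ?thesis
      using cohomology_map_left_class[OF T.H T'.H v c(2)] c(3) q[OF h(1,2)] by (simp add: k_def)
  qed
  \<comment> \<open>The number \<open>d\<close> bounds the distance from stage \<open>i\<close> up
    to \<open>K\<close>; a smaller stage is compared with its successor, whose \<open>Phi\<close>
    values are the same.\<close>
  have goal: "Phi T n N i (q i (stable_class A W h)) =
      cohomology_map_left A T.H v N n (Phi T' n N i (stable_class A W h))"
    if "K \<le> i + d" "cExt_start n \<le> i" "h \<in> arrs A" "src A h = syz A (R T'.M) (nat (int i + n))"
      "tgt A h = syz A (R N) i" for d i h
    using that
  proof (induction d arbitrary: i h)
    case 0
    then show ?case using goal_large by simp
  next
    case (Suc d)
    note h = Suc.prems(3-5)
    define k where "k = nat (int i + n)"
    have k: "nat (int (Suc i) + n) = Suc k" using Suc.prems(2) by (simp add: k_def cExt_start_def)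
    obtain h' b where h': "h' \<in> arrs A" "src A h' = syz A (R T'.M) (Suc k)" "tgt A h' = syz A (R N) (Suc i)"
      "b \<in> arrs A" "src A b = ch (R T'.M) k" "tgt A b = ch (R N) i"
      "b \<cdot> inc T'.M k = inc N i \<cdot> h'" "cok (R N) i \<cdot> b = h \<cdot> cok (R T'.M) k"
      "Phi T' n N (Suc i) (stable_class A W h') = Phi T' n N i (stable_class A W h)"
      using T'.cExt_trans_class[OF N Suc.prems(2) h] unfolding k k_def[symmetric] by metis
    have hs: "h \<cdot> s k \<in> arrs A" "src A (h \<cdot> s k) = syz A (R T.M) k" "tgt A (h \<cdot> s k) = syz A (R N) i"
      using h s_arr by (simp_all add: k_def)
    have hs': "h' \<cdot> s (Suc k) \<in> arrs A" "src A (h' \<cdot> s (Suc k)) = syz A (R T.M) (Suc k)"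
      "tgt A (h' \<cdot> s (Suc k)) = syz A (R N) (Suc i)"
      using h' s_arr by simp_all
    \<comment> \<open>Stacking the square of \<open>h\<close> on that of \<open>f\<close> gives a
      morphism of syzygy sequences with middle map \<open>b \<cdot> F k\<close>. Hence the
      transition map commutes with composition by the syzygies of \<open>f\<close>.\<close>
    have "b \<cdot> (F k \<cdot> inc T.M k) = (inc N i \<cdot> h') \<cdot> s (Suc k)"
      unfolding s(5) by (rule cmp_reduce[OF h'(7)]) (use h' T'.incM s_arr in simp_all)
    then have bF: "(b \<cdot> F k) \<cdot> inc T.M k = inc N i \<cdot> (h' \<cdot> s (Suc k))"
      using h'(1-6) F_arr T.incM(1-3) inc(1-3)[OF N] s_arr by simp
    have "cok (R N) i \<cdot> (b \<cdot> F k) = (h \<cdot> cok (R T'.M) k) \<cdot> F k"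
      by (rule cmp_reduce[OF h'(8)]) (use h' F_arr cok_arr[OF N] in simp_all)
    also have "\<dots> = h \<cdot> (s k \<cdot> cok (R T.M) k)"
      unfolding s(4)[symmetric] using h T'.cokM(1-3) F_arr by (simp add: k_def)
    finally have cF: "cok (R N) i \<cdot> (b \<cdot> F k) = (h \<cdot> s k) \<cdot> cok (R T.M) k"
      using h s_arr T.cokM(1-3) by (simp add: k_def)
    have "Lam A W (inc T.M k, cok (R T.M) k) (inc N i, cok (R N) i) (stable_class A W (h \<cdot> s k)) =
        stable_class A W (h' \<cdot> s (Suc k))"
      by (rule Lam_class[OF syz_precover[OF T.M] syz_precover[OF N] _ _ _ _ _ _ _ _ _ bF cF])
        (use hs hs' h'(1-6) F_arr inc(1-3)[OF N] cok_arr(1-3)[OF N] T.incM(1-3) T.cokM(1-3) in simp_all)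
    then have "cExt_trans A W R n T.M N i (stable_class A W (h \<cdot> s k)) = stable_class A W (h' \<cdot> s (Suc k))"
      using T.incM(6) inc(6)[OF N] by (simp add: cExt_trans_def k_def)
    moreover have "stable_class A W (h \<cdot> s k) \<in> carrier (cExt_group A W R n T.M N i)"
      using T.cExt_groupI hs unfolding k_def by simp
    ultimately have "Phi T n N (Suc i) (stable_class A W (h' \<cdot> s (Suc k))) = Phi T n N i (stable_class A W (h \<cdot> s k))"
      using sequential_target.step[OF T.Phi_target[OF N] Suc.prems(2)] by metis
    moreover have "Phi T n N (Suc i) (q (Suc i) (stable_class A W h')) =
        cohomology_map_left A T.H v N n (Phi T' n N (Suc i) (stable_class A W h'))"
      by (rule Suc.IH) (use Suc.prems h' k in simp_all)
    ultimately show ?case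
      using q[of h i] q[of h' "Suc i"] h h' k by (simp add: k_def)
  qed
  obtain h where h: "h \<in> arrs A" "src A h = syz A (R T'.M) (nat (int i + n))" "tgt A h = syz A (R N) i"
    "y = stable_class A W h" using T'.cExt_groupE[OF y] .
  have "q i y \<in> carrier (cExt_group A W R n T.M N i)"
    unfolding h(4) q[OF h(1,2)] by (rule T.cExt_groupI) (use h s_arr in simp_all)
  then show ?thesis using goal[of i K h] i h by simp
qed

end

theorem proposition4p15:
  fixes A :: "('o, 'm) cat"
    and W :: "'o set"
    and R :: "'o \<Rightarrow> ('o, 'm) syzygy_resolution"
  assumes "abelian_category A"
    and "additive_subcategory A W"
    and "special_precovering A W"
    and "closed_under_summands A W"
    and "syzygy_choice A W R"
  shows "\<exists>\<phi> :: ('o, 'm) tate \<Rightarrow> int \<Rightarrow> 'o \<Rightarrow> (nat \<times> 'm set) set \<Rightarrow> 'm set.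
    (\<forall>T n N. tate_resolution A W T \<and> N \<in> objs A \<longrightarrow>
       \<phi> T n N \<in> iso (cExt A W R n (tate_obj T) N) (Hom_cohomology A (tate_tac T) N n)) \<and>
    (\<forall>T n N N' g. tate_resolution A W T \<and> g \<in> Hom A N N' \<longrightarrow>
       (\<forall>x \<in> carrier (cExt A W R n (tate_obj T) N).
          \<phi> T n N' (cExt_map_right A W R n (tate_obj T) g x) =
          cohomology_map_right A (tate_tac T) g n (\<phi> T n N x))) \<and>
    (\<forall>T T' f u v n N. tate_resolution A W T \<and> tate_resolution A W T' \<and>
         tate_morphism A T T' f u v \<and> N \<in> objs A \<longrightarrow>
       (\<forall>x \<in> carrier (cExt A W R n (tate_obj T') N).
          \<phi> T n N (cExt_map_left A W R n f N x) =
          cohomology_map_left A (tate_tac T) v N n (\<phi> T' n N x)))"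
proof -
  interpret abelian_category A by fact
  interpret syzygies A W R by unfold_locales fact+
  have loc: "tate A W R T" if "tate_resolution A W T" for T by unfold_locales fact
  \<comment> \<open>Defined without reference to \<open>g\<close>, \<open>f\<close>,
    \<open>u\<close> or \<open>v\<close>, so one family serves all naturality squares.\<close>
  define \<phi> where "\<phi> T n N = sequential_target.colim_map (Phi T n N)" for T n N
  show ?thesis
  proof (intro exI[of _ \<phi>] conjI allI impI ballI)
    fix T n N assume "tate_resolution A W T \<and> N \<in> objs A"
    then interpret sequential_target "cExt_start n" "cExt_group A W R n (tate_obj T) N"
      "cExt_trans A W R n (tate_obj T) N" "Hom_cohomology A (tate_tac T) N n" "Phi T n N"
      using tate.Phi_target[OF loc] by blast
    show "\<phi> T n N \<in> iso (cExt A W R n (tate_obj T) N) (Hom_cohomology A (tate_tac T) N n)"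
      using colim_map_iso by (simp add: \<phi>_def cExt_def)
  next
    fix T n N N' g x
    assume "tate_resolution A W T \<and> g \<in> Hom A N N'" and x: "x \<in> carrier (cExt A W R n (tate_obj T) N)"
    then have T: "tate_resolution A W T" and g: "g \<in> Hom A N N'" by auto
    then have N: "N \<in> objs A" "N' \<in> objs A" by auto
    have sg: "src A g = N" "tgt A g = N'" using g by auto
    note target = tate.Phi_target[OF loc[OF T]]
    show "\<phi> T n N' (cExt_map_right A W R n (tate_obj T) g x) =
        cohomology_map_right A (tate_tac T) g n (\<phi> T n N x)"
      unfolding \<phi>_def cExt_map_right_def cExt_class_def sg
      by (rule colim_map_natural[OF target[OF N(1)] target[OF N(2)]])
        (use tate.Phi_right[OF loc[OF T] g] x in \<open>simp_all add: cExt_def\<close>)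
  next
    fix T T' f u v n N x
    assume "tate_resolution A W T \<and> tate_resolution A W T' \<and> tate_morphism A T T' f u v \<and> N \<in> objs A"
      and x: "x \<in> carrier (cExt A W R n (tate_obj T') N)"
    then have T: "tate_resolution A W T" "tate_resolution A W T'" and mor: "tate_morphism A T T' f u v"
      and N: "N \<in> objs A" by auto
    have sf: "src A f = tate_obj T" "tgt A f = tate_obj T'" using mor by (auto simp: tate_morphism_def)
    show "\<phi> T n N (cExt_map_left A W R n f N x) =
        cohomology_map_left A (tate_tac T) v N n (\<phi> T' n N x)"
      unfolding \<phi>_def cExt_map_left_def cExt_class_def sf
      by (rule colim_map_natural[OF tate.Phi_target[OF loc[OF T(2)] N] tate.Phi_target[OF loc[OF T(1)] N]])
        (use Phi_left[OF T mor N] x in \<open>simp_all add: cExt_def\<close>)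
  qed
qed

end
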